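(* Let $1<p,q<\infty$. Then $(RM(p,q))^{\ast}\cong RM(p',q')$, where $\frac1p+\frac1{p'}=1$ and $\frac1q+\frac1{q'}=1$.
   Context: $\mathbb{D}$ is the open unit disc of $\mathbb{C}$ and $\mathcal{H}(\mathbb{D})$ the space of holomorphic functions on $\mathbb{D}$. For $1<p,q<\infty$, $RM(p,q)=\{f\in\mathcal{H}(\mathbb{D}):\rho_{p,q}(f)<+\infty\}$, where $$\rho_{p,q}(f)=\left(\frac{1}{2\pi}\int_0^{2\pi}\left(\int_0^1|f(re^{it})|^p\,dr\right)^{q/p}dt\right)^{1/q};$$ it is a Banach space with norm $\rho_{p,q}$. $(\cdot)^\ast$ denotes the topological dual with the operator norm, and $\cong$ denotes isomorphism of Banach spaces (with equivalent, not necessarily equal, norms). *)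

theory Defs
  imports "HOL-Analysis.Analysis"
begin

(* All normed spaces below are spaces of complex-valued functions on some type 'a, with the
   pointwise complex-linear structure; such a space is given by its carrier V, a set of
   functions, and its norm N, of which only the values on V matter. *)

definition dual :: "('a \<Rightarrow> complex) set \<Rightarrow> (('a \<Rightarrow> complex) \<Rightarrow> real) \<Rightarrow> (('a \<Rightarrow> complex) \<Rightarrow> complex) set"
  where
  (* Functionals are extended by 0 off V, so that each functional on V has exactly one
     representative. *)
  "dual V N = {\<phi>.
     (\<forall>f\<in>V. \<forall>g\<in>V. \<phi> (\<lambda>x. f x + g x) = \<phi> f + \<phi> g) \<and>
     (\<forall>c. \<forall>f\<in>V. \<phi> (\<lambda>x. c * f x) = c * \<phi> f) \<and>
     (\<exists>C. \<forall>f\<in>V. cmod (\<phi> f) \<le> C * N f) \<and>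
     (\<forall>f. f \<notin> V \<longrightarrow> \<phi> f = 0)}"

definition dual_norm ::
  "('a \<Rightarrow> complex) set \<Rightarrow> (('a \<Rightarrow> complex) \<Rightarrow> real) \<Rightarrow> (('a \<Rightarrow> complex) \<Rightarrow> complex) \<Rightarrow> real"
  where
  "dual_norm V N \<phi> = (SUP f\<in>{f \<in> V. N f \<le> 1}. cmod (\<phi> f))"

definition normed_isomorphic ::
  "('a \<Rightarrow> complex) set \<Rightarrow> (('a \<Rightarrow> complex) \<Rightarrow> real) \<Rightarrow>
   ('b \<Rightarrow> complex) set \<Rightarrow> (('b \<Rightarrow> complex) \<Rightarrow> real) \<Rightarrow> bool"
  where
  "normed_isomorphic V N W M \<longleftrightarrow> (\<exists>T. bij_betw T V W \<and>
     (\<forall>f\<in>V. \<forall>g\<in>V. T (\<lambda>x. f x + g x) = (\<lambda>y. T f y + T g y)) \<and>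
     (\<forall>c. \<forall>f\<in>V. T (\<lambda>x. c * f x) = (\<lambda>y. c * T f y)) \<and>
     (\<exists>A>0. \<exists>B>0. \<forall>f\<in>V. A * N f \<le> M (T f) \<and> M (T f) \<le> B * N f))"

definition ennreal_powr :: "ennreal \<Rightarrow> real \<Rightarrow> ennreal"
  where
  (* intended for exponents a > 0 *)
  "ennreal_powr x a = (if x = \<infinity> then \<infinity> else ennreal (enn2real x powr a))"

definition rho :: "real \<Rightarrow> real \<Rightarrow> (complex \<Rightarrow> complex) \<Rightarrow> ennreal"
  where
  "rho p q f = ennreal_powr
     (ennreal (1 / (2 * pi)) *
      (\<integral>\<^sup>+t\<in>{0..2 * pi}.
         ennreal_powr (\<integral>\<^sup>+r\<in>{0..<1}. ennreal (cmod (f (of_real r * cis t)) powr p) \<partial>lborel) (q / p)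
       \<partial>lborel))
     (1 / q)"

definition RM :: "real \<Rightarrow> real \<Rightarrow> (complex \<Rightarrow> complex) set"
  where
  (* A holomorphic function on the disc is represented by its extension by 0. *)
  "RM p q = {f. f holomorphic_on ball 0 1 \<and> (\<forall>z. z \<notin> ball 0 1 \<longrightarrow> f z = 0) \<and> rho p q f < \<infinity>}"

definition RM_norm :: "real \<Rightarrow> real \<Rightarrow> (complex \<Rightarrow> complex) \<Rightarrow> real"
  where
  "RM_norm p q f = enn2real (rho p q f)"

end

theory Submission
  imports Defs "HOL-Complex_Analysis.Complex_Analysis" "HOL-Real_Asymp.Real_Asymp"
begin

text \<open>
  The isomorphism sends a functional \<open>\<phi>\<close> to \<open>g(z) = \<Sum>n. (n + 1) \<phi>(z\<^sup>n) z\<^sup>n\<close>, the function representing \<open>\<phi>\<close>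
  in the pairing \<open>1 / \<pi> \<integral> f(z) g(cnj z) dA(z)\<close>.  Hoelder's inequality and the convergence of the dilations
  \<open>f(\<rho> z)\<close> to \<open>f\<close> give \<open>|\<phi>(f)| \<le> 4 \<parallel>f\<parallel> \<parallel>g\<parallel>\<close>.

  For the converse bound \<open>\<parallel>g\<parallel> \<le> C \<parallel>\<phi>\<parallel>\<close>, test \<open>g\<close> on a disc of radius \<open>R < 1\<close> against a norming function \<open>h\<close>:
  the integral of \<open>g h\<close> is \<open>\<phi>(P h)\<close>, where \<open>P h(w) = \<integral> h(z) / (1 - w z)\<^sup>2\<close>, so it suffices to bound the positive
  operator with kernel \<open>1 / |1 - w z|\<^sup>2\<close> on \<open>L\<^sup>q(L\<^sup>p)\<close>.  As the kernel is symmetric one may assume \<open>p \<le> q\<close>.  Comparing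
  the kernel with \<open>1 / ((1 - r) + (1 - s) + |t + \<theta>|)\<^sup>2\<close>, a Schur test with the weight
  \<open>((1 - s) / (1 - r)) powr (a / p)\<close> in the radii and a weight \<open>w\<close> in the angle leaves the integral of \<open>\<parallel>F(\<cdot>, \<theta>)\<parallel>\<^sup>p\<close>
  against the Hardy-Littlewood maximal function of \<open>w\<close>, which is controlled since the maximal operator is bounded
  on \<open>L\<^sup>\<sigma>\<close>, where \<open>\<sigma> = q / (q - p)\<close>.
\<close>

section \<open>The Hardy-Littlewood maximal function\<close>

text \<open>The function \<open>g\<close> attached to a functional is not known in advance to lie in
  \<open>RM p' q'\<close>. On a disc of radius \<open>R\<close> it is bounded and every quantity to
  be estimated is finite, so a power of it may be cancelled; the outcome does not depend on
  \<open>R\<close>. For p = q a power of 1 - r alone is a sufficient Schur weight. For p < q the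
  radial integral sits inside the angular one, and a radial weight does not see the outer exponent q
  / p. The angular weight linearises the outer norm: it belongs to the dual of the space with
  exponent q / p, whose exponent is \<sigma>. The kernel acts on it by averages over intervals of
  all lengths, hence the maximal function. The factor n + 1 is both the n-th coefficient of 1 / (1 -
  x)^2 and the reciprocal of the integral of |z|^(2n) against normalised area. Evaluating
  \<open>g\<close> at cnj z makes the pairing bilinear, so the isomorphism is complex linear and
  kernels depend on the sum of two angles. The norm uses dr dt rather than area. In the pairing the
  Jacobian r is at most 1 and is harmless for Hoelder's inequality; the test functions of the
  converse bound are integrated against dr dt from the start.\<close>

abbreviation ball_integral :: "(real \<Rightarrow> ennreal) \<Rightarrow> real \<Rightarrow> real \<Rightarrow> ennreal" where
  "ball_integral w a r \<equiv> (\<integral>\<^sup>+t. w t * indicator (ball a r) t \<partial>lborel)"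

abbreviation power_integral :: "(real \<Rightarrow> real) \<Rightarrow> real \<Rightarrow> ennreal" where
  "power_integral A s \<equiv> (\<integral>\<^sup>+t. ennreal (A t powr s) \<partial>lborel)"

section \<open>Integrals of powers, and kernels as superpositions of indicators of intervals\<close>

lemma nn_integral_powr_from_0:
  fixes a c :: real
  assumes "a > -1" "c \<ge> 0"
  shows "(\<integral>\<^sup>+y. ennreal (y powr a) * indicator {0<..<c} y \<partial>lborel) = ennreal (c powr (a + 1) / (a + 1))"
proof -
  have "(\<integral>\<^sup>+y. ennreal (y powr a) * indicator {0<..<c} y \<partial>lborel) =
        (\<integral>\<^sup>+y. ennreal (indicator {0..c} y * y powr a) \<partial>lborel)"
  proof (rule nn_integral_cong_AE)
    have "AE y in lborel. y \<noteq> c" "AE y in lborel. y \<noteq> 0"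
      using AE_lborel_singleton by auto
    then show "AE y in lborel. ennreal (y powr a) * indicator {0<..<c} y = ennreal (indicator {0..c} y * y powr a)"
      by eventually_elim (auto simp: indicator_def)
  qed
  also have "\<dots> = ennreal (c powr (a + 1) / (a + 1))"
    by (rule nn_integral_has_integral_lebesgue[OF _ has_integral_powr_from_0[OF assms]]) auto
  finally show ?thesis .
qed

lemma nn_integral_powr_to_inf:
  fixes a c :: real
  assumes "a < -1" "c > 0"
  shows "(\<integral>\<^sup>+y. ennreal (y powr a) * indicator {c..} y \<partial>lborel) = ennreal (- (c powr (a + 1)) / (a + 1))"
proof -
  have "(\<integral>\<^sup>+y. ennreal (y powr a) * indicator {c..} y \<partial>lborel) =
        (\<integral>\<^sup>+y. ennreal (indicator {c..} y * y powr a) \<partial>lborel)"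
    by (intro nn_integral_cong) (auto simp: indicator_def)
  also have "\<dots> = ennreal (- (c powr (a + 1)) / (a + 1))"
    by (rule nn_integral_has_integral_lebesgue[OF _ has_integral_powr_to_inf[OF assms]]) auto
  finally show ?thesis .
qed

text \<open>Replacing x + y by the larger of x and y splits the integral at y = x into two pure
  powers; 0 < b < 1 makes both ends converge. With y = 1 - r this is the radial half of the Schur
  test.\<close>

lemma nn_integral_powr_div_add_le:
  fixes b x :: real
  assumes "0 < b" "b < 1" "x > 0"
  shows "(\<integral>\<^sup>+y. ennreal (y powr (-b) / (x + y)) * indicator {0<..} y \<partial>lborel)
           \<le> ennreal ((1 / b + 1 / (1 - b)) * x powr (-b))"
proof -
  have "(\<integral>\<^sup>+y. ennreal (y powr (-b) / (x + y)) * indicator {0<..} y \<partial>lborel)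
      \<le> (\<integral>\<^sup>+y. ennreal (1 / x) * (ennreal (y powr (-b)) * indicator {0<..<x} y)
             + ennreal (y powr (-b - 1)) * indicator {x..} y \<partial>lborel)"
  proof (rule nn_integral_mono)
    fix y :: real
    have "y powr (-b) / (x + y) \<le> 1 / x * y powr (-b)" if "0 < y"
      using that assms by (simp add: field_simps)
    moreover have "y powr (-b) / (x + y) \<le> y powr (-b - 1)" if "x \<le> y"
    proof -
      have "y powr (-b) / (x + y) \<le> y powr (-b) / y"
        using that assms by (intro divide_left_mono) auto
      also have "\<dots> = y powr (-b - 1)"
        using that assms by (simp add: powr_diff)
      finally show ?thesis .
    qed
    ultimately show "ennreal (y powr (-b) / (x + y)) * indicator {0<..} y
       \<le> ennreal (1 / x) * (ennreal (y powr (-b)) * indicator {0<..<x} y)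
             + ennreal (y powr (-b - 1)) * indicator {x..} y"
      using assms by (auto simp: indicator_def ennreal_mult'[symmetric] intro!: ennreal_leI)
  qed
  also have "\<dots> = ennreal (1 / x) * ennreal (x powr (-b + 1) / (-b + 1)) + ennreal (- (x powr (- b - 1 + 1)) / (- b - 1 + 1))"
    using assms nn_integral_powr_from_0[of "-b" x] nn_integral_powr_to_inf[of "-b-1" x]
    by (subst nn_integral_add) (auto simp: nn_integral_cmult)
  also have "\<dots> = ennreal ((1 / b + 1 / (1 - b)) * x powr (-b))"
    using assms by (simp add: ennreal_mult'[symmetric] ennreal_plus[symmetric] powr_add divide_simps del: ennreal_plus)
      (simp add: powr_add diff_conv_add_uminus field_simps del: add_uminus_conv_diff)
  finally show ?thesis .
qed

text \<open>The kernel is a superposition of indicators of balls centred at \<open>v\<close>, with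
  density 2 / (c + s)^3 in the radius s. A bound on the averages of \<open>w\<close> about
  \<open>v\<close> at all radii therefore passes to the kernel. Stating it for an arbitrary bound
  \<open>m\<close> serves both the maximal function and the constant weight.\<close>

lemma nn_integral_sq_kernel_le:
  fixes c v :: real and m :: ennreal and w :: "real \<Rightarrow> ennreal"
  assumes [measurable]: "w \<in> borel_measurable borel"
    and c: "c > 0"
    and avg: "\<And>s. s > 0 \<Longrightarrow> (ball_integral w v s) \<le> ennreal (2 * s) * m"
  shows "(\<integral>\<^sup>+t. w t * ennreal (1 / (c + \<bar>t - v\<bar>)\<^sup>2) \<partial>lborel) \<le> ennreal (4 / c) * m"
proof -
  have layer: "ennreal (1 / (c + \<bar>u\<bar>)\<^sup>2) = (\<integral>\<^sup>+s. ennreal (2 / (c + s) ^ 3) * indicator {\<bar>u\<bar><..} s \<partial>lborel)" for u :: real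
  proof -
    have "(\<integral>\<^sup>+s. ennreal (2 / (c + s) ^ 3) * indicator {\<bar>u\<bar><..} s \<partial>lborel)
       = (\<integral>\<^sup>+s. ennreal (2 / (c + s) ^ 3) * indicator {\<bar>u\<bar>..} s \<partial>lborel)"
    proof (rule nn_integral_cong_AE)
      have "AE y in lborel. y \<noteq> \<bar>u\<bar>" using AE_lborel_singleton by auto
      then show "AE s in lborel. ennreal (2 / (c + s) ^ 3) * indicator {\<bar>u\<bar><..} s = ennreal (2 / (c + s) ^ 3) * indicator {\<bar>u\<bar>..} s"
        by eventually_elim (auto simp: indicator_def)
    qed
    also have "\<dots> = ennreal (0 - (- 1 / (c + \<bar>u\<bar>)\<^sup>2))"
    proof (rule nn_integral_FTC_atLeast)
      fix s :: real assume "\<bar>u\<bar> \<le> s"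
      then show "DERIV (\<lambda>s. - 1 / (c + s)\<^sup>2) s :> 2 / (c + s) ^ 3"
        using c by (auto intro!: derivative_eq_intros simp: divide_simps power2_eq_square power3_eq_cube)
      show "0 \<le> 2 / (c + s) ^ 3" using \<open>\<bar>u\<bar> \<le> s\<close> c by auto
    next
      show "((\<lambda>s. - 1 / (c + s)\<^sup>2) \<longlongrightarrow> 0) at_top"
        by real_asymp
    qed auto
    finally show ?thesis by simp
  qed
  have "(\<integral>\<^sup>+t. w t * ennreal (1 / (c + \<bar>t - v\<bar>)\<^sup>2) \<partial>lborel)
      = (\<integral>\<^sup>+t. \<integral>\<^sup>+s. w t * (ennreal (2 / (c + s) ^ 3) * indicator {\<bar>t - v\<bar><..} s) \<partial>lborel \<partial>lborel)"
    by (subst nn_integral_cmult) (auto simp: layer)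
  also have "\<dots> = (\<integral>\<^sup>+s. \<integral>\<^sup>+t. w t * (ennreal (2 / (c + s) ^ 3) * indicator {\<bar>t - v\<bar><..} s) \<partial>lborel \<partial>lborel)"
    by (rule lborel_pair.Fubini') (simp add: indicator_def greaterThan_def cong: measurable_cong_simp)
  also have "\<dots> = (\<integral>\<^sup>+s. ennreal (2 / (c + s) ^ 3) * (indicator {0<..} s * (ball_integral w v s)) \<partial>lborel)"
  proof (rule nn_integral_cong)
    fix s :: real
    show "(\<integral>\<^sup>+t. w t * (ennreal (2 / (c + s) ^ 3) * indicator {\<bar>t - v\<bar><..} s) \<partial>lborel) =
        ennreal (2 / (c + s) ^ 3) * (indicator {0<..} s * (ball_integral w v s))"
    proof (cases "s > 0")
      case True
      then have "(\<integral>\<^sup>+t. w t * (ennreal (2 / (c + s) ^ 3) * indicator {\<bar>t - v\<bar><..} s) \<partial>lborel) =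
        (\<integral>\<^sup>+t. ennreal (2 / (c + s) ^ 3) * (w t * indicator (ball v s) t) \<partial>lborel)"
        by (intro nn_integral_cong) (auto simp: indicator_def dist_real_def mult_ac)
      moreover have [measurable]: "ball v s \<in> sets borel" by simp
      ultimately show ?thesis using True by (simp add: nn_integral_cmult)
    next
      case False
      then have "(\<integral>\<^sup>+t. w t * (ennreal (2 / (c + s) ^ 3) * indicator {\<bar>t - v\<bar><..} s) \<partial>lborel) =
        (\<integral>\<^sup>+t. 0 \<partial>(lborel :: real measure))"
        by (intro nn_integral_cong) (auto simp: indicator_def)
      then show ?thesis using False by simp
    qed
  qed
  also have "\<dots> \<le> (\<integral>\<^sup>+s. m * (ennreal (4 / (c + s)\<^sup>2) * indicator {0..} s) \<partial>lborel)"
  proof (rule nn_integral_mono)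
    fix s :: real
    show "ennreal (2 / (c + s) ^ 3) * (indicator {0<..} s * (ball_integral w v s))
      \<le> m * (ennreal (4 / (c + s)\<^sup>2) * indicator {0..} s)"
    proof (cases "s > 0")
      case True
      \<comment> \<open>The length 2 s of the ball is absorbed by one factor c + s; the remaining 4
        / (c + s)^2 integrates to 4 / c.\<close>
      have "2 / (c + s) ^ 3 * (2 * s) = 4 / (c + s)\<^sup>2 * (s / (c + s))"
        using True c by (simp add: power2_eq_square power3_eq_cube)
      also have "\<dots> \<le> 4 / (c + s)\<^sup>2 * 1"
        using True c by (intro mult_left_mono) auto
      finally have le: "2 / (c + s) ^ 3 * (2 * s) \<le> 4 / (c + s)\<^sup>2" by simp
      have "ennreal (2 / (c + s) ^ 3) * (ball_integral w v s)
          \<le> ennreal (2 / (c + s) ^ 3) * (ennreal (2 * s) * m)"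
        by (intro mult_left_mono avg True) auto
      also have "\<dots> = ennreal (2 / (c + s) ^ 3 * (2 * s)) * m"
        using True c by (subst ennreal_mult) (simp_all add: mult.assoc)
      also have "\<dots> \<le> ennreal (4 / (c + s)\<^sup>2) * m"
        by (intro mult_right_mono ennreal_leI le) auto
      finally show ?thesis using True by (simp add: mult.commute)
    qed auto
  qed
  also have "\<dots> = m * ennreal (0 - (- 4 / (c + 0)))"
  proof (subst nn_integral_cmult)
    have "(\<integral>\<^sup>+s. ennreal (4 / (c + s)\<^sup>2) * indicator {0..} s \<partial>lborel) = ennreal (0 - (- 4 / (c + 0)))"
    proof (rule nn_integral_FTC_atLeast)
      fix s :: real assume "0 \<le> s"
      then show "DERIV (\<lambda>s. - 4 / (c + s)) s :> 4 / (c + s)\<^sup>2"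
        using c by (auto intro!: derivative_eq_intros simp: divide_simps power2_eq_square)
    next
      show "((\<lambda>s. - 4 / (c + s)) \<longlongrightarrow> 0) at_top" by real_asymp
    qed auto
    then show "m * (\<integral>\<^sup>+s. ennreal (4 / (c + s)\<^sup>2) * indicator {0..} s \<partial>lborel) = m * ennreal (0 - (- 4 / (c + 0)))"
      by simp
  qed auto
  finally show ?thesis by (simp add: mult.commute)
qed

section \<open>The uncentred maximal function and its weak and strong bounds\<close>

text \<open>The supremum over all open balls that contain \<open>v\<close>, not only those centred
  there, makes each superlevel set a union of open balls. This gives measurability at once, and
  these balls are the family handed to the covering lemma.\<close>

definition maximal_function :: "(real \<Rightarrow> ennreal) \<Rightarrow> real \<Rightarrow> ennreal" where
  "maximal_function w v = (SUP (a, r)\<in>{(a, r). r > 0 \<and> v \<in> ball a r}.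
     ennreal (1 / (2 * r)) * (ball_integral w a r))"

lemma maximal_function_greater_eq:
  "{v. l < maximal_function w v} =
     (\<Union>(a, r)\<in>{(a, r). r > 0 \<and> l < ennreal (1 / (2 * r)) * (ball_integral w a r)}. ball a r)"
  unfolding maximal_function_def less_SUP_iff by fastforce

lemma open_maximal_function_greater: "open {v. l < maximal_function w v}"
  unfolding maximal_function_greater_eq by (intro open_UN) auto

lemma measurable_maximal_function [measurable]: "maximal_function w \<in> borel_measurable borel"
  by (rule borel_measurableI_greater) (use open_maximal_function_greater in auto)

lemma average_le_maximal_function:
  assumes "s > 0" "v \<in> ball a s"
  shows "(ball_integral w a s) \<le> ennreal (2 * s) * maximal_function w v"
proof -
  have "ennreal (1 / (2 * s)) * (ball_integral w a s) \<le> maximal_function w v"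
    unfolding maximal_function_def using assms by (intro SUP_upper2[of "(a, s)"]) auto
  then have "ennreal (2 * s) * (ennreal (1 / (2 * s)) * (ball_integral w a s)) \<le> ennreal (2 * s) * maximal_function w v"
    by (intro mult_left_mono) auto
  then show ?thesis
    using assms by (simp add: mult.assoc[symmetric] ennreal_mult'[symmetric])
qed

lemma maximal_function_le_bound:
  assumes "\<And>t. w t \<le> ennreal B"
  shows "maximal_function w v \<le> ennreal B"
  unfolding maximal_function_def
proof (intro SUP_least, clarify)
  fix a r :: real assume r: "0 < r"
  have "(ball_integral w a r) \<le> (\<integral>\<^sup>+t. ennreal B * indicator (ball a r) t \<partial>lborel)"
    by (intro nn_integral_mono mult_right_mono assms) auto
  also have "\<dots> = ennreal B * ennreal (2 * r)"
    using r by (simp add: nn_integral_cmult_indicator ball_eq_greaterThanLessThan)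
  finally have "ennreal (1 / (2 * r)) * (ball_integral w a r) \<le> ennreal (1 / (2 * r)) * (ennreal B * ennreal (2 * r))"
    by (intro mult_left_mono) auto
  also have "\<dots> = ennreal B"
    using r by (simp add: ennreal_mult''[symmetric] mult.commute[of "ennreal B"] mult.assoc[symmetric])
  finally show "ennreal (1 / (2 * r)) * (ball_integral w a r) \<le> ennreal B" .
qed

text \<open>Each point of the superlevel set lies in a ball on which the integral of
  \<open>w\<close> exceeds \<open>l\<close> times the length. The Vitali lemma selects countably
  many disjoint ones whose fivefold enlargements still cover the set; this is the constant
  5.\<close>

lemma maximal_function_weak_type:
  assumes [measurable]: "w \<in> borel_measurable borel" and l: "l > 0"
  shows "ennreal l * emeasure lborel {v. ennreal l < maximal_function w v} \<le> 5 * (\<integral>\<^sup>+t. w t \<partial>lborel)"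
proof (cases "(\<integral>\<^sup>+t. w t \<partial>lborel) = \<infinity>")
  case True
  then show ?thesis by (simp add: ennreal_mult_top)
next
  case False
  define K where "K = {(a, r). r > 0 \<and> ennreal l < ennreal (1 / (2 * r)) * (ball_integral w a r)}"
  have big: "ennreal l * ennreal (2 * r) \<le> (ball_integral w a r)" if "(a, r) \<in> K" for a r
  proof -
    have "ennreal (2 * r) * ennreal l \<le> ennreal (2 * r) * (ennreal (1 / (2 * r)) * (ball_integral w a r))"
      using that by (intro mult_left_mono) (auto simp: K_def)
    also have "\<dots> = (ball_integral w a r)"
      using that by (simp add: K_def mult.assoc[symmetric] ennreal_mult'[symmetric])
    finally show ?thesis by (simp only: mult.commute)
  qed
  \<comment> \<open>The Vitali lemma asks for uniformly bounded radii. The bound comes from the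
    total integral of \<open>w\<close>, hence the separate treatment of an infinite
    integral.\<close>
  have rad: "0 < snd i \<and> snd i \<le> enn2real (\<integral>\<^sup>+t. w t \<partial>lborel) / (2 * l)" if "i \<in> K" for i
  proof -
    have "ennreal l * ennreal (2 * snd i) \<le> (\<integral>\<^sup>+t. w t \<partial>lborel)"
    proof (rule order_trans)
      show "ennreal l * ennreal (2 * snd i) \<le> (\<integral>\<^sup>+t. w t * indicator (ball (fst i) (snd i)) t \<partial>lborel)"
        using big[of "fst i" "snd i"] that by simp
      show "(\<integral>\<^sup>+t. w t * indicator (ball (fst i) (snd i)) t \<partial>lborel) \<le> (\<integral>\<^sup>+t. w t \<partial>lborel)"
        by (intro nn_integral_mono) (auto simp: indicator_def)
    qed
    then have "l * (2 * snd i) \<le> enn2real (\<integral>\<^sup>+t. w t \<partial>lborel)"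
      using False l that by (cases "\<integral>\<^sup>+t. w t \<partial>lborel") (auto simp: ennreal_mult'[symmetric] K_def)
    then show ?thesis using that l by (auto simp: K_def field_simps)
  qed
  obtain C where C: "countable C" "C \<subseteq> K"
     "pairwise (\<lambda>i j. disjnt (cball (fst i) (snd i)) (cball (fst j) (snd j))) C"
     "\<And>i. i \<in> K \<Longrightarrow> \<exists>j. j \<in> C \<and> \<not> disjnt (cball (fst i) (snd i)) (cball (fst j) (snd j)) \<and>
                        cball (fst i) (snd i) \<subseteq> ball (fst j) (5 * snd j)"
    by (rule Vitali_covering_lemma_cballs_balls[of K snd _ fst, OF rad]) (assumption, blast intro: that)
  define E where "E = {v. ennreal l < maximal_function w v}"
  have Em [measurable]: "E \<in> sets borel" unfolding E_def by (intro borel_open open_maximal_function_greater)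
  have E_sub: "E \<subseteq> (\<Union>i\<in>C. ball (fst i) (5 * snd i))"
  proof
    fix v assume "v \<in> E"
    then obtain a r where ar: "(a, r) \<in> K" "v \<in> ball a r"
      unfolding E_def maximal_function_greater_eq K_def by blast
    then obtain j where "j \<in> C" "cball a r \<subseteq> ball (fst j) (5 * snd j)"
      using C(4) by force
    then show "v \<in> (\<Union>i\<in>C. ball (fst i) (5 * snd i))"
      using ar(2) ball_subset_cball by blast
  qed
  have "emeasure lborel E = (\<integral>\<^sup>+v. indicator E v \<partial>lborel)" by simp
  also have "\<dots> \<le> (\<integral>\<^sup>+v. \<integral>\<^sup>+i. indicator (ball (fst i) (5 * snd i)) v \<partial>count_space C \<partial>lborel)"
  proof (rule nn_integral_mono)
    fix v :: real
    show "indicator E v \<le> (\<integral>\<^sup>+i. indicator (ball (fst i) (5 * snd i)) v \<partial>count_space C)"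
    proof (cases "v \<in> E")
      case True
      then obtain i where "i \<in> C" "v \<in> ball (fst i) (5 * snd i)" using E_sub by blast
      then have "indicator (ball (fst i) (5 * snd i)) v \<le> (\<integral>\<^sup>+i. indicator (ball (fst i) (5 * snd i)) v \<partial>count_space C)"
        by (intro nn_integral_ge_point)
      then show ?thesis using \<open>v \<in> ball _ _\<close> True by simp
    qed auto
  qed
  also have "\<dots> = (\<integral>\<^sup>+i. \<integral>\<^sup>+v. indicator (ball (fst i) (5 * snd i)) v \<partial>lborel \<partial>count_space C)"
    using C(1) by (intro nn_integral_count_space_nn_integral borel_measurable_indicator) auto
  also have "\<dots> = (\<integral>\<^sup>+i. 5 * ennreal (2 * snd i) \<partial>count_space C)"
  proof (rule nn_integral_cong)
    fix i assume "i \<in> space (count_space C)"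
    then have "snd i > 0" using C(2) rad[of i] by auto
    then show "(\<integral>\<^sup>+v. indicator (ball (fst i) (5 * snd i)) v \<partial>lborel) = 5 * ennreal (2 * snd i)"
      by (simp add: ball_eq_greaterThanLessThan ennreal_mult'[symmetric] ennreal_numeral[symmetric] del: ennreal_numeral)
  qed
  finally have "ennreal l * emeasure lborel E \<le> ennreal l * (\<integral>\<^sup>+i. 5 * ennreal (2 * snd i) \<partial>count_space C)"
    by (intro mult_left_mono) auto
  also have "\<dots> = (\<integral>\<^sup>+i. 5 * (ennreal l * ennreal (2 * snd i)) \<partial>count_space C)"
    by (simp add: nn_integral_cmult mult.left_commute)
  also have "\<dots> \<le> (\<integral>\<^sup>+i. 5 * emeasure (density lborel w) (cball (fst i) (snd i)) \<partial>count_space C)"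
  proof (intro nn_integral_mono mult_left_mono)
    fix i assume "i \<in> space (count_space C)"
    then have "ennreal l * ennreal (2 * snd i) \<le> (\<integral>\<^sup>+t. w t * indicator (ball (fst i) (snd i)) t \<partial>lborel)"
      using big[of "fst i" "snd i"] C(2) by auto
    also have "\<dots> \<le> (\<integral>\<^sup>+t. w t * indicator (cball (fst i) (snd i)) t \<partial>lborel)"
      by (intro nn_integral_mono mult_left_mono) (auto simp: indicator_def)
    finally show "ennreal l * ennreal (2 * snd i) \<le> emeasure (density lborel w) (cball (fst i) (snd i))"
      by (simp add: emeasure_density)
  qed auto
  also have "\<dots> = 5 * emeasure (density lborel w) (\<Union>i\<in>C. cball (fst i) (snd i))"
    using C(1,3) by (subst emeasure_UN_countable)
      (auto simp: nn_integral_cmult disjoint_family_on_def pairwise_def disjnt_def)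
  also have "\<dots> \<le> 5 * emeasure (density lborel w) (space (density lborel w))"
    by (intro mult_left_mono emeasure_space) auto
  also have "\<dots> = 5 * (\<integral>\<^sup>+t. w t \<partial>lborel)"
    by (subst emeasure_density) auto
  finally show ?thesis unfolding E_def .
qed

text \<open>Marcinkiewicz interpolation between the weak bound for integrable functions and the
  trivial bound for bounded ones. In the constant, 10 is 2 * 5 from the weak bound at level l / 2,
  \<open>\<rho>\<close> comes from the layer-cake formula, and the rest from integrating
  \<open>l powr (\<rho> - 2)\<close> over 0 < l < 2 * w t. The real-valued copy \<open>m\<close> of
  the maximal function is there because \<open>powr\<close> acts on reals.\<close>

lemma nn_integral_maximal_function_powr_le:
  fixes w m :: "real \<Rightarrow> real" and \<rho> :: real
  assumes [measurable]: "w \<in> borel_measurable borel" "m \<in> borel_measurable borel"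
    and w: "\<And>t. 0 \<le> w t" and m: "\<And>t. 0 \<le> m t"
    and max: "\<And>t. ennreal (m t) = maximal_function (\<lambda>t. ennreal (w t)) t"
    and rho: "\<rho> > 1"
  shows "(power_integral m \<rho>)
           \<le> ennreal (10 * \<rho> * 2 powr (\<rho> - 1) / (\<rho> - 1)) * (power_integral w \<rho>)"
proof -
  have level: "ennreal l * emeasure lborel {t. l < m t}
      \<le> 10 * (\<integral>\<^sup>+t. ennreal (w t) * indicator {t. l < 2 * w t} t \<partial>lborel)" if l: "l > 0" for l :: real
  proof -
    \<comment> \<open>\<open>v\<close> keeps \<open>w\<close> only where it exceeds l / 2. The
      discarded part contributes at most l / 2 to any average, so an average of \<open>w\<close>
      above \<open>l\<close> forces one of \<open>v\<close> above l / 2.\<close>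
    define v where "v = (\<lambda>t. ennreal (w t) * indicator {t. l < 2 * w t} t)"
    have [measurable]: "v \<in> borel_measurable borel" unfolding v_def by measurable
    have "{t. l < m t} \<subseteq> {t. ennreal (l / 2) < maximal_function v t}"
    proof clarify
      fix t assume "l < m t"
      then have "ennreal l < maximal_function (\<lambda>t. ennreal (w t)) t"
        using l by (simp add: max[symmetric] ennreal_less_iff)
      then obtain a r where ar: "r > 0" "t \<in> ball a r"
        and big: "ennreal l < ennreal (1 / (2 * r)) * (ball_integral (\<lambda>t. ennreal (w t)) a r)"
        unfolding maximal_function_def less_SUP_iff by auto
      note big
      also have "(ball_integral (\<lambda>t. ennreal (w t)) a r)
          \<le> (\<integral>\<^sup>+t. v t * indicator (ball a r) t + ennreal (l / 2) * indicator (ball a r) t \<partial>lborel)"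
        by (intro nn_integral_mono) (auto simp: v_def indicator_def intro!: ennreal_leI)
      also have "\<dots> = (ball_integral v a r) + ennreal (l / 2) * ennreal (2 * r)"
        using ar by (subst nn_integral_add) (auto simp: nn_integral_cmult_indicator ball_eq_greaterThanLessThan)
      also have "ennreal (1 / (2 * r)) * \<dots>
         = ennreal (1 / (2 * r)) * (ball_integral v a r) + ennreal (l / 2)"
        using ar l by (simp add: distrib_left ennreal_mult'[symmetric])
      also have "\<dots> \<le> maximal_function v t + ennreal (l / 2)"
        unfolding maximal_function_def using ar by (intro add_right_mono SUP_upper2[of "(a, r)"]) auto
      finally have "ennreal l < maximal_function v t + ennreal (l / 2)"
        by (simp add: mult_left_mono)
      moreover have "ennreal l = ennreal (l / 2) + ennreal (l / 2)"
        using l by (simp add: ennreal_plus[symmetric] del: ennreal_plus)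
      ultimately show "ennreal (l / 2) < maximal_function v t"
        by (metis add_right_mono leD leI)
    qed
    then have "emeasure lborel {t. l < m t} \<le> emeasure lborel {t. ennreal (l / 2) < maximal_function v t}"
      by (intro emeasure_mono) (auto intro!: borel_open open_maximal_function_greater)
    then have "ennreal l * emeasure lborel {t. l < m t} \<le> ennreal l * emeasure lborel {t. ennreal (l / 2) < maximal_function v t}"
      by (intro mult_left_mono) auto
    also have "\<dots> = 2 * (ennreal (l / 2) * emeasure lborel {t. ennreal (l / 2) < maximal_function v t})"
      using l by (simp add: mult.assoc[symmetric] ennreal_mult'[symmetric] ennreal_numeral[symmetric] del: ennreal_numeral)
    also have "\<dots> \<le> 2 * (5 * (\<integral>\<^sup>+t. v t \<partial>lborel))"
      using l by (intro mult_left_mono maximal_function_weak_type) auto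
    finally show ?thesis by (simp add: v_def mult.assoc[symmetric])
  qed
  have "(power_integral m \<rho>)
      = (\<integral>\<^sup>+t. \<integral>\<^sup>+l. ennreal \<rho> * (ennreal (l powr (\<rho> - 1)) * indicator {0<..<m t} l) \<partial>lborel \<partial>lborel)"
    using rho m by (intro nn_integral_cong)
      (simp add: nn_integral_cmult nn_integral_powr_from_0 ennreal_mult'[symmetric])
  also have "\<dots> = (\<integral>\<^sup>+l. \<integral>\<^sup>+t. ennreal \<rho> * (ennreal (l powr (\<rho> - 1)) * indicator {0<..<m t} l) \<partial>lborel \<partial>lborel)"
    by (rule lborel_pair.Fubini') (simp add: indicator_def greaterThanLessThan_def greaterThan_def lessThan_def)
  also have "\<dots> \<le> (\<integral>\<^sup>+l. \<integral>\<^sup>+t. ennreal (10 * \<rho>) * (ennreal (w t) * (ennreal (l powr (\<rho> - 2)) * indicator {0<..<2 * w t} l)) \<partial>lborel \<partial>lborel)"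
  proof (rule nn_integral_mono)
    fix l :: real
    show "(\<integral>\<^sup>+t. ennreal \<rho> * (ennreal (l powr (\<rho> - 1)) * indicator {0<..<m t} l) \<partial>lborel)
      \<le> (\<integral>\<^sup>+t. ennreal (10 * \<rho>) * (ennreal (w t) * (ennreal (l powr (\<rho> - 2)) * indicator {0<..<2 * w t} l)) \<partial>lborel)"
    proof (cases "l > 0")
      case True
      have "(\<integral>\<^sup>+t. ennreal \<rho> * (ennreal (l powr (\<rho> - 1)) * indicator {0<..<m t} l) \<partial>lborel)
          = (\<integral>\<^sup>+t. ennreal (\<rho> * l powr (\<rho> - 1)) * indicator {t. l < m t} t \<partial>lborel)"
        using True rho by (intro nn_integral_cong) (auto simp: indicator_def ennreal_mult')
      also have "\<dots> = ennreal (\<rho> * l powr (\<rho> - 1)) * emeasure lborel {t. l < m t}"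
        by (subst nn_integral_cmult_indicator) auto
      also have "\<dots> = ennreal (\<rho> * l powr (\<rho> - 2)) * (ennreal l * emeasure lborel {t. l < m t})"
        using True rho by (simp add: mult.assoc[symmetric] ennreal_mult''[symmetric] powr_diff power2_eq_square)
      also have "\<dots> \<le> ennreal (\<rho> * l powr (\<rho> - 2)) * (10 * (\<integral>\<^sup>+t. ennreal (w t) * indicator {t. l < 2 * w t} t \<partial>lborel))"
        by (intro mult_left_mono level True) auto
      also have "\<dots> = (\<integral>\<^sup>+t. ennreal (\<rho> * l powr (\<rho> - 2)) * (10 * (ennreal (w t) * indicator {t. l < 2 * w t} t)) \<partial>lborel)"
        by (simp add: nn_integral_cmult)
      also have "\<dots> = (\<integral>\<^sup>+t. ennreal (10 * \<rho>) * (ennreal (w t) * (ennreal (l powr (\<rho> - 2)) * indicator {0<..<2 * w t} l)) \<partial>lborel)"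
        using True rho w by (intro nn_integral_cong)
          (auto simp: indicator_def ennreal_mult''[symmetric] ennreal_mult'[symmetric] ennreal_numeral[symmetric] mult_ac simp del: ennreal_numeral)
      finally show ?thesis .
    qed (simp add: indicator_def)
  qed
  also have "\<dots> = (\<integral>\<^sup>+t. \<integral>\<^sup>+l. ennreal (10 * \<rho>) * (ennreal (w t) * (ennreal (l powr (\<rho> - 2)) * indicator {0<..<2 * w t} l)) \<partial>lborel \<partial>lborel)"
    by (rule lborel_pair.Fubini') (simp add: indicator_def greaterThanLessThan_def greaterThan_def lessThan_def)
  also have "\<dots> = (\<integral>\<^sup>+t. ennreal (10 * \<rho> * 2 powr (\<rho> - 1) / (\<rho> - 1)) * ennreal (w t powr \<rho>) \<partial>lborel)"
  proof (rule nn_integral_cong)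
    fix t
    have "w t * (2 * w t) powr (\<rho> - 1) = 2 powr (\<rho> - 1) * w t powr \<rho>"
      using w[of t] by (cases "w t = 0") (auto simp: powr_mult powr_diff)
    then show "(\<integral>\<^sup>+l. ennreal (10 * \<rho>) * (ennreal (w t) * (ennreal (l powr (\<rho> - 2)) * indicator {0<..<2 * w t} l)) \<partial>lborel)
        = ennreal (10 * \<rho> * 2 powr (\<rho> - 1) / (\<rho> - 1)) * ennreal (w t powr \<rho>)"
      using w[of t] rho by (simp add: nn_integral_cmult nn_integral_powr_from_0 ennreal_mult''[symmetric] ennreal_mult'[symmetric])
  qed
  finally show ?thesis by (simp add: nn_integral_cmult)
qed

lemma maximal_function_majorant:
  fixes w :: "real \<Rightarrow> real"
  assumes "\<And>t. w t \<le> B" "B \<ge> 0"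
  shows "ennreal (enn2real (maximal_function (\<lambda>t. ennreal (w t)) v)) = maximal_function (\<lambda>t. ennreal (w t)) v"
proof -
  have "maximal_function (\<lambda>t. ennreal (w t)) v \<le> ennreal B"
    by (intro maximal_function_le_bound ennreal_leI assms)
  then show ?thesis by (metis ennreal_enn2real ennreal_less_top order_le_less_trans)
qed

section \<open>The Bergman kernel on mixed norm spaces\<close>

abbreviation plane :: "(real \<times> real) measure" where
  "plane \<equiv> lborel \<Otimes>\<^sub>M lborel"

abbreviation ray_integral :: "real \<Rightarrow> (real \<times> real \<Rightarrow> real) \<Rightarrow> real \<Rightarrow> ennreal" where
  "ray_integral p F t \<equiv> (\<integral>\<^sup>+r. ennreal (F (r, t) powr p) \<partial>lborel)"

abbreviation kernel_form ::
  "(real \<times> real \<Rightarrow> real \<times> real \<Rightarrow> real) \<Rightarrow> (real \<times> real \<Rightarrow> real) \<Rightarrow> (real \<times> real \<Rightarrow> real) \<Rightarrow> ennreal" where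
  "kernel_form K F G \<equiv> (\<integral>\<^sup>+z. \<integral>\<^sup>+v. ennreal (F v * G z * K z v) \<partial>plane \<partial>plane)"

abbreviation shifted_kernel :: "real \<Rightarrow> real \<times> real \<Rightarrow> real \<times> real \<Rightarrow> real" where
  "shifted_kernel d z v \<equiv> 1 / ((1 - fst z) + (1 - fst v) + \<bar>snd z + snd v - d\<bar>)\<^sup>2"

interpretation plane_pair: pair_sigma_finite plane plane
  by (intro pair_sigma_finite.intro lborel_pair.sigma_finite_measure_axioms
      sigma_finite_pair_measure lborel.sigma_finite_measure_axioms)

section \<open>The Schur test for the shifted kernels\<close>

lemma nn_integral_reflect:
  assumes [measurable]: "f \<in> borel_measurable borel"
  shows "(\<integral>\<^sup>+t. f (d - t) \<partial>lborel) = (\<integral>\<^sup>+t. f t \<partial>(lborel :: real measure))"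
  using nn_integral_real_affine[of f "-1" d] by simp

text \<open>Integrating the angle first gives the factor 4 / ((1 - r) + (1 - s)) by the averaging
  bound centred at d - \<theta>; what remains is the radial integral in y = 1 - r. The weight with
  exponent -a is reproduced in the other radius s, which is the property a Schur test rests
  on.\<close>

lemma weighted_kernel_integral_le:
  fixes w m :: "real \<Rightarrow> real" and a s d \<theta> :: real
  assumes [measurable]: "w \<in> borel_measurable borel"
    and a: "0 < a" "a < 1" and s: "s < 1" and w: "\<And>t. 0 \<le> w t" and m: "\<And>t. 0 \<le> m t"
    and avg: "\<And>v h. h > 0 \<Longrightarrow> (ball_integral (\<lambda>t. ennreal (w t)) v h) \<le> ennreal (2 * h) * ennreal (m v)"
  shows "(\<integral>\<^sup>+z. ennreal ((1 - fst z) powr (-a) * w (snd z) / ((1 - fst z) + (1 - s) + \<bar>snd z + \<theta> - d\<bar>)\<^sup>2)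
            * indicator {..<1} (fst z) \<partial>plane)
     \<le> ennreal (4 * (1 / a + 1 / (1 - a)) * (1 - s) powr (-a) * m (d - \<theta>))"
proof -
  have "(\<integral>\<^sup>+z. ennreal ((1 - fst z) powr (-a) * w (snd z) / ((1 - fst z) + (1 - s) + \<bar>snd z + \<theta> - d\<bar>)\<^sup>2)
            * indicator {..<1} (fst z) \<partial>plane)
     = (\<integral>\<^sup>+r. \<integral>\<^sup>+t. ennreal ((1 - r) powr (-a) * w t / ((1 - r) + (1 - s) + \<bar>t + \<theta> - d\<bar>)\<^sup>2) * indicator {..<1} r \<partial>lborel \<partial>lborel)"
    by (subst lborel.nn_integral_fst[symmetric]) auto
  also have "\<dots> \<le> (\<integral>\<^sup>+r. ennreal (4 * m (d - \<theta>)) * (ennreal ((1 - r) powr (-a) / ((1 - s) + (1 - r))) * indicator {0<..} (1 - r)) \<partial>lborel)"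
  proof (rule nn_integral_mono)
    fix r :: real
    show "(\<integral>\<^sup>+t. ennreal ((1 - r) powr (-a) * w t / ((1 - r) + (1 - s) + \<bar>t + \<theta> - d\<bar>)\<^sup>2) * indicator {..<1} r \<partial>lborel)
      \<le> ennreal (4 * m (d - \<theta>)) * (ennreal ((1 - r) powr (-a) / ((1 - s) + (1 - r))) * indicator {0<..} (1 - r))"
    proof (cases "r < 1")
      case True
      have "(\<integral>\<^sup>+t. ennreal ((1 - r) powr (-a) * w t / ((1 - r) + (1 - s) + \<bar>t + \<theta> - d\<bar>)\<^sup>2) * indicator {..<1} r \<partial>lborel)
         = (\<integral>\<^sup>+t. ennreal ((1 - r) powr (-a)) * (ennreal (w t) * ennreal (1 / ((1 - r) + (1 - s) + \<bar>t - (d - \<theta>)\<bar>)\<^sup>2)) \<partial>lborel)"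
        using True w by (intro nn_integral_cong) (simp add: ennreal_mult'[symmetric] algebra_simps)
      also have "\<dots> = ennreal ((1 - r) powr (-a)) * (\<integral>\<^sup>+t. ennreal (w t) * ennreal (1 / ((1 - r) + (1 - s) + \<bar>t - (d - \<theta>)\<bar>)\<^sup>2) \<partial>lborel)"
        by (rule nn_integral_cmult) measurable
      also have "\<dots> \<le> ennreal ((1 - r) powr (-a)) * (ennreal (4 / ((1 - r) + (1 - s))) * ennreal (m (d - \<theta>)))"
        using True s avg by (intro mult_left_mono nn_integral_sq_kernel_le) auto
      also have "\<dots> = ennreal (4 * m (d - \<theta>)) * (ennreal ((1 - r) powr (-a) / ((1 - s) + (1 - r))) * indicator {0<..} (1 - r))"
        using True s m by (simp add: ennreal_mult'[symmetric] ennreal_mult''[symmetric] ac_simps)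
      finally show ?thesis .
    qed simp
  qed
  also have "\<dots> = ennreal (4 * m (d - \<theta>)) * (\<integral>\<^sup>+y. ennreal (y powr (-a) / ((1 - s) + y)) * indicator {0<..} y \<partial>lborel)"
    by (subst nn_integral_cmult, measurable)
       (subst nn_integral_reflect[where f = "\<lambda>y. ennreal (y powr (-a) / ((1 - s) + y)) * indicator {0<..} y"], auto)
  also have "\<dots> \<le> ennreal (4 * m (d - \<theta>)) * ennreal ((1 / a + 1 / (1 - a)) * (1 - s) powr (-a))"
    using a s by (intro mult_left_mono nn_integral_powr_div_add_le) auto
  also have "\<dots> = ennreal (4 * (1 / a + 1 / (1 - a)) * (1 - s) powr (-a) * m (d - \<theta>))"
    using m a by (simp add: ennreal_mult''[symmetric] mult_ac)
  finally show ?thesis .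
qed

text \<open>Here \<open>\<alpha> t\<close> is the \<open>p\<close>-th power of the \<open>L\<^sup>p\<close> norm of \<open>F\<close> on the ray at angle \<open>t\<close>.  The last
  clause, which strengthens vanishing almost everywhere, allows division by powers of \<open>\<alpha>\<close>.\<close>

definition radial_profile :: "real \<Rightarrow> (real \<times> real \<Rightarrow> real) \<Rightarrow> (real \<Rightarrow> real) \<Rightarrow> bool" where
  "radial_profile p F \<alpha> \<longleftrightarrow> F \<in> borel_measurable plane \<and> (\<forall>z. 0 \<le> F z) \<and> (\<forall>r t. 1 \<le> r \<longrightarrow> F (r, t) = 0) \<and>
     \<alpha> \<in> borel_measurable borel \<and> (\<exists>B. \<forall>t. \<alpha> t \<le> B) \<and> (\<forall>t. 0 \<le> \<alpha> t) \<and>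
     (\<forall>t. (ray_integral p F t) = ennreal (\<alpha> t)) \<and>
     (\<forall>r t. \<alpha> t = 0 \<longrightarrow> F (r, t) = 0)"

lemma conjugate_exponent:
  fixes p p' :: real
  assumes "1 < p" "1 / p + 1 / p' = 1"
  shows "p' = p / (p - 1)" "1 < p'"
proof -
  have "1 / p' = (p - 1) / p" using assms by (simp add: field_simps)
  then show "p' = p / (p - 1)" by (metis inverse_divide inverse_eq_divide inverse_inverse_eq)
  then show "1 < p'" using assms by simp
qed

text \<open>The exponent of the weight \<open>w\<close> makes both \<open>\<beta> * w powr (- p' / p)\<close>, which comes from Young's inequality,
  and \<open>w powr \<sigma>\<close>, which comes from the maximal theorem, equal to \<open>\<beta> powr (q' / p')\<close>.\<close>

lemma mean_bound_of_profile:
  fixes p q p' q' d :: real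
  assumes p: "1 < p" "p \<le> q" and conj: "1 / p + 1 / p' = 1" "1 / q + 1 / q' = 1"
    and F: "radial_profile p F \<alpha>" and G: "radial_profile p' G \<beta>"
    and Fn: "(power_integral \<alpha> (q / p)) \<le> 1"
    and Gn: "(power_integral \<beta> (q' / p')) \<le> 1"
  defines "\<sigma> \<equiv> q / (q - p)" and "w \<equiv> \<lambda>t. \<beta> t powr ((q - p) / ((q - 1) * p'))"
  obtains m where "m \<in> borel_measurable borel" "\<And>t. 0 \<le> m t"
    "\<And>v h. h > 0 \<Longrightarrow> (ball_integral (\<lambda>t. ennreal (w t)) v h) \<le> ennreal (2 * h) * ennreal (m v)"
    "(\<integral>\<^sup>+t. ennreal (\<alpha> t * m (d - t)) \<partial>lborel) \<le> ennreal (1 + 10 * \<sigma> * 2 powr (\<sigma> - 1) / (\<sigma> - 1))"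
proof (cases "p = q")
  \<comment> \<open>For p = q the exponent of \<open>w\<close> is 0, so \<open>w\<close> takes only
    the values 0 and 1, and the constant 1 serves as \<open>m\<close>. Here \<open>\<sigma>\<close>
    is a division by zero, hence 0, and the claimed bound reduces to 1.\<close>
  case True
  have "(ball_integral (\<lambda>t. ennreal (w t)) v h) \<le> ennreal (2 * h) * ennreal 1" if "h > 0" for v h :: real
  proof -
    have "(ball_integral (\<lambda>t. ennreal (w t)) v h) \<le> (\<integral>\<^sup>+t. indicator (ball v h) t \<partial>lborel)"
      by (intro nn_integral_mono) (auto simp: w_def True indicator_def powr_def)
    also have "\<dots> = ennreal (2 * h)" using that by (simp add: ball_eq_greaterThanLessThan)
    finally show ?thesis by simp
  qed
  moreover have "(\<integral>\<^sup>+t. ennreal (\<alpha> t * 1) \<partial>lborel) \<le> 1"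
    using Fn F p unfolding True radial_profile_def by (simp cong: nn_integral_cong)
  ultimately show ?thesis using True
    by (intro that[of "\<lambda>_. 1"]) (auto simp: \<sigma>_def)
next
  case False
  then have pq: "p < q" using p by simp
  have p': "1 < p'" and q': "q' = q / (q - 1)" using conjugate_exponent[OF _ conj(1)] conjugate_exponent[OF _ conj(2)] p by auto
  have [measurable]: "\<alpha> \<in> borel_measurable borel" "\<beta> \<in> borel_measurable borel"
    using F G by (auto simp: radial_profile_def)
  have \<alpha>0: "0 \<le> \<alpha> t" and \<beta>0: "0 \<le> \<beta> t" for t using F G by (auto simp: radial_profile_def)
  have [measurable]: "w \<in> borel_measurable borel" unfolding w_def by measurable
  obtain B where B: "\<And>t. \<beta> t \<le> B" using G by (auto simp: radial_profile_def)
  have wB: "w t \<le> B powr ((q - p) / ((q - 1) * p'))" for t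
    unfolding w_def using pq p p' by (intro powr_mono2 B \<beta>0) auto
  define m where "m = (\<lambda>v. enn2real (maximal_function (\<lambda>t. ennreal (w t)) v))"
  have m: "ennreal (m v) = maximal_function (\<lambda>t. ennreal (w t)) v" for v
    unfolding m_def by (rule maximal_function_majorant[OF wB]) auto
  have [measurable]: "m \<in> borel_measurable borel" unfolding m_def by measurable
  have sig: "\<sigma> > 1" "1 / (q / p) + 1 / \<sigma> = 1" using pq p by (auto simp: \<sigma>_def field_simps)
  show ?thesis
  proof (rule that[of m])
    show "(ball_integral (\<lambda>t. ennreal (w t)) v h) \<le> ennreal (2 * h) * ennreal (m v)" if "h > 0" for v h :: real
      unfolding m by (rule average_le_maximal_function) (use that in auto)
    \<comment> \<open>Young's inequality with the conjugate exponents q / p and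
      \<open>\<sigma>\<close> separates \<open>\<alpha>\<close> from the maximal function; the
      reflection t \<mapsto> d - t then leaves the second integral unchanged.\<close>
    have "(\<integral>\<^sup>+t. ennreal (\<alpha> t * m (d - t)) \<partial>lborel)
        \<le> (\<integral>\<^sup>+t. ennreal (\<alpha> t powr (q / p)) + ennreal (m (d - t) powr \<sigma>) \<partial>lborel)"
    proof (rule nn_integral_mono)
      fix t
      have "\<alpha> t * m (d - t) \<le> \<alpha> t powr (q / p) / (q / p) + m (d - t) powr \<sigma> / \<sigma>"
        using pq p sig \<alpha>0 by (intro Youngs_inequality) (auto simp: m_def)
      also have "\<dots> \<le> \<alpha> t powr (q / p) / 1 + m (d - t) powr \<sigma> / 1"
        using pq p sig by (intro add_mono divide_left_mono) auto
      finally show "ennreal (\<alpha> t * m (d - t)) \<le> ennreal (\<alpha> t powr (q / p)) + ennreal (m (d - t) powr \<sigma>)"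
        by (simp add: ennreal_plus[symmetric] ennreal_leI del: ennreal_plus)
    qed
    also have "\<dots> = (power_integral \<alpha> (q / p)) + (\<integral>\<^sup>+t. ennreal (m (d - t) powr \<sigma>) \<partial>lborel)"
      by (rule nn_integral_add) auto
    also have "(\<integral>\<^sup>+t. ennreal (m (d - t) powr \<sigma>) \<partial>lborel) = (power_integral m \<sigma>)"
      by (rule nn_integral_reflect[where f = "\<lambda>t. ennreal (m t powr \<sigma>)"]) measurable
    also have "\<dots> \<le> ennreal (10 * \<sigma> * 2 powr (\<sigma> - 1) / (\<sigma> - 1)) * (power_integral w \<sigma>)"
      using sig by (intro nn_integral_maximal_function_powr_le m) (auto simp: m_def w_def)
    also have "(power_integral w \<sigma>) = (power_integral \<beta> (q' / p'))"
    proof -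
      have "(q - p) / ((q - 1) * p') * \<sigma> = q' / p'" using pq by (simp add: \<sigma>_def q')
      then show ?thesis unfolding w_def by (simp add: powr_powr)
    qed
    finally have "(\<integral>\<^sup>+t. ennreal (\<alpha> t * m (d - t)) \<partial>lborel) \<le> 1 + ennreal (10 * \<sigma> * 2 powr (\<sigma> - 1) / (\<sigma> - 1)) * 1"
      using Fn Gn by (meson add_mono mult_left_mono order_trans zero_le order_refl)
    then show "(\<integral>\<^sup>+t. ennreal (\<alpha> t * m (d - t)) \<partial>lborel) \<le> ennreal (1 + 10 * \<sigma> * 2 powr (\<sigma> - 1) / (\<sigma> - 1))"
      using sig by simp
  qed (auto simp: m_def)
qed

text \<open>\<open>F\<close> and \<open>G\<close> are multiplied by reciprocal powers of
  \<open>w\<close>, \<open>x\<close> and \<open>y\<close> before Young's inequality, which leaves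
  their product unchanged. In the application \<open>y\<close> and \<open>x\<close> are the
  distances 1 - r of the points of \<open>F\<close> and of \<open>G\<close> from the boundary. Each
  bracket containing \<open>k\<close>, joined by \<open>w\<close> in the first summand, is then
  integrated over the variable of the other function.\<close>

lemma weighted_Young:
  fixes F G k w x y a p p' :: real
  assumes p: "1 < p" and p': "1 / p + 1 / p' = 1" and nn: "0 \<le> F" "0 \<le> G" "0 \<le> k" "0 < w" "0 < x" "0 < y"
  shows "F * G * k \<le> F powr p * w * y powr a * (x powr (-a) * k)
     + G powr p' * w powr (-p' / p) * x powr (a / (p - 1)) * (y powr (-(a / (p - 1))) * k)"
proof -
  have pp: "1 < p'" and e: "p' / p = 1 / (p - 1)" using conjugate_exponent[OF p p'] p by auto
  define A where "A = F * w powr (1 / p) * y powr (a / p) * x powr (-a / p)"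
  define D where "D = G * w powr (- 1 / p) * y powr (- a / p) * x powr (a / p)"
  have "F * G = A * D"
    using nn by (simp add: A_def D_def powr_minus field_simps)
  also have "\<dots> \<le> A powr p / p + D powr p' / p'"
    using nn p pp p' by (intro Youngs_inequality) (auto simp: A_def D_def)
  also have "\<dots> \<le> A powr p / 1 + D powr p' / 1"
    using p pp by (intro add_mono divide_left_mono) auto
  also have "A powr p = F powr p * w * y powr a * x powr (-a)"
    using nn p by (simp add: A_def powr_mult powr_powr)
  also have "D powr p' = G powr p' * w powr (-p' / p) * x powr (a / (p - 1)) * y powr (-(a / (p - 1)))"
  proof -
    have "a / p * p' = a * (p' / p)" by simp
    also have "\<dots> = a / (p - 1)" unfolding e by simp
    finally have "- 1 / p * p' = - p' / p" "- a / p * p' = - (a / (p - 1))" "a / p * p' = a / (p - 1)"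
      by simp_all
    then show ?thesis
      using nn by (simp add: D_def powr_mult powr_powr)
  qed
  finally have "F * G * k \<le> (F powr p * w * y powr a * x powr (-a) / 1
     + G powr p' * w powr (-p' / p) * x powr (a / (p - 1)) * y powr (-(a / (p - 1))) / 1) * k"
    using nn(3) by (rule mult_right_mono)
  then show ?thesis by (simp add: algebra_simps)
qed

text \<open>In the first summand of the weighted Young inequality the variable of \<open>G\<close>
  is integrated out, which leaves the p-th power of \<open>F\<close> against the maximal function;
  in the second the variable of \<open>F\<close> is integrated out with angular weight 1, which
  leaves an integral of \<open>G\<close> alone. The assumption p \<le> q keeps the exponent of the
  weight \<open>w\<close> nonnegative.\<close>

lemma shifted_kernel_bilinear_le:
  fixes p q p' q' :: real
  assumes p: "1 < p" "p \<le> q" and conj: "1 / p + 1 / p' = 1" "1 / q + 1 / q' = 1"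
  obtains C where "0 \<le> C"
    "\<And>d F G \<alpha> \<beta>. radial_profile p F \<alpha> \<Longrightarrow> radial_profile p' G \<beta> \<Longrightarrow>
       (power_integral \<alpha> (q / p)) \<le> 1 \<Longrightarrow> (power_integral \<beta> (q' / p')) \<le> 1 \<Longrightarrow>
       (kernel_form (shifted_kernel d) F G) \<le> ennreal C"
proof -
  \<comment> \<open>This choice puts both \<open>a\<close> and a / (p - 1) strictly between 0 and 1,
    as the radial integrals of the two summands require.\<close>
  define a where "a = min 1 (p - 1) / 2"
  define b where "b = a / (p - 1)"
  have a: "0 < a" "a < 1" "0 < b" "b < 1" using p by (auto simp: a_def b_def field_simps min_def)
  define \<sigma> where "\<sigma> = q / (q - p)"
  define C0 where "C0 = 1 + 10 * \<sigma> * 2 powr (\<sigma> - 1) / (\<sigma> - 1)"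
  define Ka where "Ka = 4 * (1 / a + 1 / (1 - a))"
  define Kb where "Kb = 4 * (1 / b + 1 / (1 - b))"
  have K0: "0 \<le> Ka" "0 \<le> Kb" using a by (auto simp: Ka_def Kb_def)
  have "0 \<le> C0"
  proof (cases "p = q")
    case False
    then have "\<sigma> > 1" using p by (simp add: \<sigma>_def)
    then show ?thesis by (auto simp: C0_def intro!: add_nonneg_nonneg divide_nonneg_nonneg)
  qed (simp add: C0_def \<sigma>_def)
  have p': "1 < p'" "p' = p / (p - 1)" and q': "q' = q / (q - 1)" "1 < q'"
    using conjugate_exponent[OF _ conj(1)] conjugate_exponent[OF _ conj(2)] p by auto
  show thesis
  proof (rule that[of "Ka * C0 + Kb"])
    show "0 \<le> Ka * C0 + Kb" using K0 \<open>0 \<le> C0\<close> by simp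
    fix d F G \<alpha> \<beta>
    assume F: "radial_profile p F \<alpha>" and G: "radial_profile p' G \<beta>"
      and Fn: "(power_integral \<alpha> (q / p)) \<le> 1"
      and Gn: "(power_integral \<beta> (q' / p')) \<le> 1"
    define w where "w = (\<lambda>t. \<beta> t powr ((q - p) / ((q - 1) * p')))"
    obtain m where m [measurable]: "m \<in> borel_measurable borel" and m0: "\<And>t. 0 \<le> m t"
      and avg: "\<And>v h. h > 0 \<Longrightarrow> (ball_integral (\<lambda>t. ennreal (w t)) v h) \<le> ennreal (2 * h) * ennreal (m v)"
      and mint: "(\<integral>\<^sup>+t. ennreal (\<alpha> t * m (d - t)) \<partial>lborel) \<le> ennreal C0"
      by (rule mean_bound_of_profile[OF p conj F G Fn Gn, where d = d]) (rule that, unfold w_def C0_def \<sigma>_def)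
    have [measurable]: "F \<in> borel_measurable plane" "G \<in> borel_measurable plane"
        "\<alpha> \<in> borel_measurable borel" "\<beta> \<in> borel_measurable borel"
      and F0: "\<And>z. 0 \<le> F z" "\<And>r t. 1 \<le> r \<Longrightarrow> F (r, t) = 0"
      and G0: "\<And>z. 0 \<le> G z" "\<And>r t. 1 \<le> r \<Longrightarrow> G (r, t) = 0"
      and \<alpha>: "\<And>t. 0 \<le> \<alpha> t" "\<And>t. (ray_integral p F t) = ennreal (\<alpha> t)"
      and \<beta>: "\<And>t. 0 \<le> \<beta> t" "\<And>t. (ray_integral p' G t) = ennreal (\<beta> t)"
        "\<And>r t. \<beta> t = 0 \<Longrightarrow> G (r, t) = 0"
      using F G unfolding radial_profile_def by auto
    have wm [measurable]: "w \<in> borel_measurable borel" unfolding w_def by measurable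
    have w0: "0 \<le> w t" for t by (simp add: w_def)
    define k where "k = shifted_kernel d"
    have k0: "0 \<le> k z v" for z v by (simp add: k_def)
    define I where "I = (\<lambda>z :: real \<times> real. indicator {..<1} (fst z) :: ennreal)"
    define P where "P = (\<lambda>v. ennreal (F v powr p * (1 - fst v) powr a))"
    define Q where "Q = (\<lambda>z. ennreal (G z powr p' * w (snd z) powr (-p' / p) * (1 - fst z) powr b))"
    have [measurable]: "P \<in> borel_measurable plane" "Q \<in> borel_measurable plane" "I \<in> borel_measurable plane"
      "(\<lambda>(z, v). k z v) \<in> borel_measurable (plane \<Otimes>\<^sub>M plane)"
      unfolding P_def Q_def I_def k_def by measurable
    have "(kernel_form k F G)
      \<le> (\<integral>\<^sup>+z. \<integral>\<^sup>+v. P v * (ennreal ((1 - fst z) powr (-a) * w (snd z) * k z v) * I z)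
            + Q z * (ennreal ((1 - fst v) powr (-b) * 1 * k z v) * I v) \<partial>plane \<partial>plane)"
    proof (intro nn_integral_mono)
      fix z v :: "real \<times> real"
      show "ennreal (F v * G z * k z v) \<le> P v * (ennreal ((1 - fst z) powr (-a) * w (snd z) * k z v) * I z)
            + Q z * (ennreal ((1 - fst v) powr (-b) * 1 * k z v) * I v)"
      \<comment> \<open>The weighted Young inequality needs w > 0. Where \<open>\<beta>\<close>
        vanishes so does \<open>w\<close>, but there \<open>G\<close> is zero by the last clause of
        \<open>radial_profile\<close>.\<close>
      proof (cases "fst z < 1 \<and> fst v < 1 \<and> \<beta> (snd z) \<noteq> 0")
        case True
        then have wp: "w (snd z) > 0" by (simp add: w_def)
        have "F v * G z * k z v \<le> F v powr p * w (snd z) * (1 - fst v) powr a * ((1 - fst z) powr (-a) * k z v)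
          + G z powr p' * w (snd z) powr (-p' / p) * (1 - fst z) powr b * ((1 - fst v) powr (- b) * k z v)"
          unfolding b_def using True by (intro weighted_Young p conj F0 G0 k0 wp) auto
        then show ?thesis using True k0 w0
          by (simp add: P_def Q_def I_def ennreal_mult'[symmetric] ennreal_plus[symmetric] mult_ac ennreal_leI del: ennreal_plus)
      next
        case False
        then have "F v * G z = 0" using F0(2)[of "fst v" "snd v"] G0(2)[of "fst z" "snd z"] \<beta>(3)[of "snd z" "fst z"] by auto
        then show ?thesis by auto
      qed
    qed
    also have "\<dots> = (\<integral>\<^sup>+z. (\<integral>\<^sup>+v. P v * (ennreal ((1 - fst z) powr (-a) * w (snd z) * k z v) * I z) \<partial>plane)
            + (\<integral>\<^sup>+v. Q z * (ennreal ((1 - fst v) powr (-b) * 1 * k z v) * I v) \<partial>plane) \<partial>plane)"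
      by (intro nn_integral_cong nn_integral_add) measurable
    also have "\<dots> = (\<integral>\<^sup>+z. \<integral>\<^sup>+v. P v * (ennreal ((1 - fst z) powr (-a) * w (snd z) * k z v) * I z) \<partial>plane \<partial>plane)
            + (\<integral>\<^sup>+z. \<integral>\<^sup>+v. Q z * (ennreal ((1 - fst v) powr (-b) * 1 * k z v) * I v) \<partial>plane \<partial>plane)"
      by (intro nn_integral_add) measurable
    also have "\<dots> \<le> ennreal (Ka * C0) + ennreal Kb"
    proof (rule add_mono)
      have "(\<integral>\<^sup>+z. \<integral>\<^sup>+v. P v * (ennreal ((1 - fst z) powr (-a) * w (snd z) * k z v) * I z) \<partial>plane \<partial>plane)
        = (\<integral>\<^sup>+v. \<integral>\<^sup>+z. P v * (ennreal ((1 - fst z) powr (-a) * w (snd z) * k z v) * I z) \<partial>plane \<partial>plane)"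
        by (rule plane_pair.Fubini') measurable
      also have "\<dots> = (\<integral>\<^sup>+v. P v * (\<integral>\<^sup>+z. ennreal ((1 - fst z) powr (-a) * w (snd z) * k z v) * I z \<partial>plane) \<partial>plane)"
        by (intro nn_integral_cong nn_integral_cmult) measurable
      also have "\<dots> \<le> (\<integral>\<^sup>+v. ennreal (Ka * m (d - snd v)) * ennreal (F v powr p) \<partial>plane)"
      proof (rule nn_integral_mono)
        fix v :: "real \<times> real"
        show "P v * (\<integral>\<^sup>+z. ennreal ((1 - fst z) powr (-a) * w (snd z) * k z v) * I z \<partial>plane)
            \<le> ennreal (Ka * m (d - snd v)) * ennreal (F v powr p)"
        proof (cases "fst v < 1")
          case True
          have "(\<integral>\<^sup>+z. ennreal ((1 - fst z) powr (-a) * w (snd z) * k z v) * I z \<partial>plane)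
              \<le> ennreal (Ka * (1 - fst v) powr (-a) * m (d - snd v))"
            using weighted_kernel_integral_le[OF wm a(1,2) True w0 m0 avg, of "snd v" d]
            by (simp add: k_def I_def Ka_def)
          then have "P v * (\<integral>\<^sup>+z. ennreal ((1 - fst z) powr (-a) * w (snd z) * k z v) * I z \<partial>plane)
              \<le> P v * ennreal (Ka * (1 - fst v) powr (-a) * m (d - snd v))"
            by (intro mult_left_mono) auto
          also have "\<dots> = ennreal (Ka * m (d - snd v)) * ennreal (F v powr p)"
            using True K0 m0 by (simp add: P_def ennreal_mult'[symmetric] ennreal_mult''[symmetric] powr_minus field_simps)
          finally show ?thesis .
        next
          case False
          then have "F v = 0" using F0(2)[of "fst v" "snd v"] by simp
          then show ?thesis by (simp add: P_def)
        qed
      qed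
      also have "\<dots> = (\<integral>\<^sup>+t. \<integral>\<^sup>+r. ennreal (Ka * m (d - t)) * ennreal (F (r, t) powr p) \<partial>lborel \<partial>lborel)"
        by (subst lborel_pair.nn_integral_snd[symmetric]) auto
      also have "\<dots> = (\<integral>\<^sup>+t. ennreal Ka * ennreal (\<alpha> t * m (d - t)) \<partial>lborel)"
      proof (rule nn_integral_cong)
        fix t
        have "(\<integral>\<^sup>+r. ennreal (Ka * m (d - t)) * ennreal (F (r, t) powr p) \<partial>lborel) = ennreal (Ka * m (d - t)) * ennreal (\<alpha> t)"
          by (subst nn_integral_cmult) (simp_all add: \<alpha>(2))
        also have "\<dots> = ennreal Ka * ennreal (\<alpha> t * m (d - t))"
          using K0 m0 \<alpha>(1) by (simp add: ennreal_mult'[symmetric] ennreal_mult''[symmetric] mult_ac)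
        finally show "(\<integral>\<^sup>+r. ennreal (Ka * m (d - t)) * ennreal (F (r, t) powr p) \<partial>lborel) = ennreal Ka * ennreal (\<alpha> t * m (d - t))" .
      qed
      also have "\<dots> \<le> ennreal Ka * ennreal C0"
        by (subst nn_integral_cmult) (auto intro!: mult_left_mono mint)
      finally show "(\<integral>\<^sup>+z. \<integral>\<^sup>+v. P v * (ennreal ((1 - fst z) powr (-a) * w (snd z) * k z v) * I z) \<partial>plane \<partial>plane) \<le> ennreal (Ka * C0)"
        using K0 by (simp add: ennreal_mult')
    next
      have "(\<integral>\<^sup>+z. \<integral>\<^sup>+v. Q z * (ennreal ((1 - fst v) powr (-b) * 1 * k z v) * I v) \<partial>plane \<partial>plane)
        = (\<integral>\<^sup>+z. Q z * (\<integral>\<^sup>+v. ennreal ((1 - fst v) powr (-b) * 1 * k z v) * I v \<partial>plane) \<partial>plane)"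
        by (intro nn_integral_cong nn_integral_cmult) measurable
      also have "\<dots> \<le> (\<integral>\<^sup>+z. ennreal (Kb * w (snd z) powr (-p' / p)) * ennreal (G z powr p') \<partial>plane)"
      proof (rule nn_integral_mono)
        fix z :: "real \<times> real"
        show "Q z * (\<integral>\<^sup>+v. ennreal ((1 - fst v) powr (-b) * 1 * k z v) * I v \<partial>plane)
            \<le> ennreal (Kb * w (snd z) powr (-p' / p)) * ennreal (G z powr p')"
        proof (cases "fst z < 1")
          case True
          have "(\<integral>\<^sup>+v. ennreal ((1 - fst v) powr (-b) * 1 * k z v) * I v \<partial>plane)
              \<le> ennreal (Kb * (1 - fst z) powr (-b) * 1)"
            using weighted_kernel_integral_le[of "\<lambda>_. 1" b "fst z" "\<lambda>_. 1" "snd z" d] True a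
            by (simp add: k_def I_def Kb_def ball_eq_greaterThanLessThan algebra_simps)
          then have "Q z * (\<integral>\<^sup>+v. ennreal ((1 - fst v) powr (-b) * 1 * k z v) * I v \<partial>plane)
              \<le> Q z * ennreal (Kb * (1 - fst z) powr (-b) * 1)"
            by (intro mult_left_mono) auto
          also have "\<dots> = ennreal (Kb * w (snd z) powr (-p' / p)) * ennreal (G z powr p')"
            using True K0 by (simp add: Q_def ennreal_mult'[symmetric] ennreal_mult''[symmetric] powr_minus field_simps)
          finally show ?thesis .
        next
          case False
          then have "G z = 0" using G0(2)[of "fst z" "snd z"] by simp
          then show ?thesis by (simp add: Q_def)
        qed
      qed
      also have "\<dots> = (\<integral>\<^sup>+t. \<integral>\<^sup>+r. ennreal (Kb * w t powr (-p' / p)) * ennreal (G (r, t) powr p') \<partial>lborel \<partial>lborel)"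
        by (subst lborel_pair.nn_integral_snd[symmetric]) auto
      also have "\<dots> = (\<integral>\<^sup>+t. ennreal Kb * ennreal (\<beta> t powr (q' / p')) \<partial>lborel)"
      proof (rule nn_integral_cong)
        fix t
        have "w t powr (-p' / p) * \<beta> t = \<beta> t powr (q' / p')"
        proof (cases "\<beta> t = 0")
          case False
          then have "\<beta> t > 0" using \<beta>(1)[of t] by simp
          then have "w t powr (-p' / p) * \<beta> t = \<beta> t powr ((q - p) / ((q - 1) * p') * (-p' / p) + 1)"
            by (simp only: w_def powr_powr powr_add powr_one[OF less_imp_le])
          also have "(q - p) / ((q - 1) * p') * (-p' / p) + 1 = q' / p'"
            using p p'(1) unfolding q'(1) p'(2) by (simp add: divide_simps) (simp add: algebra_simps)
          finally show ?thesis .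
        qed simp
        then have "Kb * w t powr (-p' / p) * \<beta> t = Kb * \<beta> t powr (q' / p')" by simp
        moreover have "(\<integral>\<^sup>+r. ennreal (Kb * w t powr (-p' / p)) * ennreal (G (r, t) powr p') \<partial>lborel) = ennreal (Kb * w t powr (-p' / p)) * ennreal (\<beta> t)"
          by (subst nn_integral_cmult) (simp_all add: \<beta>(2))
        ultimately show "(\<integral>\<^sup>+r. ennreal (Kb * w t powr (-p' / p)) * ennreal (G (r, t) powr p') \<partial>lborel) = ennreal Kb * ennreal (\<beta> t powr (q' / p'))"
          using K0 \<beta>(1) by (simp only: ennreal_mult'[symmetric] ennreal_mult''[symmetric])
      qed
      also have "\<dots> \<le> ennreal Kb * 1"
        by (subst nn_integral_cmult, measurable) (rule mult_left_mono[OF Gn], simp)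
      finally show "(\<integral>\<^sup>+z. \<integral>\<^sup>+v. Q z * (ennreal ((1 - fst v) powr (-b) * 1 * k z v) * I v) \<partial>plane \<partial>plane) \<le> ennreal Kb"
        by simp
    qed
    finally show "(kernel_form (shifted_kernel d) F G) \<le> ennreal (Ka * C0 + Kb)"
      using K0 \<open>0 \<le> C0\<close> by (simp add: k_def)
  qed
qed

section \<open>Comparison of the disc kernel with shifted kernels\<close>

lemma norm_one_minus_mult_cis_ge:
  fixes \<rho> u :: real
  assumes "0 \<le> \<rho>" "\<rho> \<le> 1" "\<bar>u\<bar> \<le> pi"
  shows "\<bar>u\<bar> / pi \<le> cmod (1 - of_real \<rho> * cis u)" "1 - \<rho> \<le> cmod (1 - of_real \<rho> * cis u)"
proof -
  show b: "1 - \<rho> \<le> cmod (1 - of_real \<rho> * cis u)"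
    using norm_triangle_ineq2[of 1 "of_real \<rho> * cis u"] assms by (simp add: norm_mult)
  have "(cmod (1 - cis u))\<^sup>2 = (2 * sin (\<bar>u\<bar> / 2))\<^sup>2"
  proof -
    have "(cmod (1 - cis u))\<^sup>2 = 2 - 2 * cos u"
      using sin_cos_squared_add[of u] unfolding cmod_power2 by (simp add: power2_eq_square algebra_simps)
    also have "cos u = cos (2 * (\<bar>u\<bar> / 2))" by simp
    also have "2 - 2 * cos (2 * (\<bar>u\<bar> / 2)) = (2 * sin (\<bar>u\<bar> / 2))\<^sup>2"
      unfolding cos_double_sin by (simp add: power_mult_distrib)
    finally show ?thesis .
  qed
  then have c: "cmod (1 - cis u) = 2 * sin (\<bar>u\<bar> / 2)"
  proof (rule power2_eq_imp_eq)
    show "0 \<le> 2 * sin (\<bar>u\<bar> / 2)" using assms by (simp add: sin_ge_zero)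
  qed simp
  \<comment> \<open>Moving from the circle to radius \<rho> costs 1 - \<rho>, which is itself at
    most the modulus in question; this uses up the factor 2 in 2 sin(|u| / 2). Concavity of the sine
    then gives Jordan's inequality.\<close>
  have "cmod (1 - cis u) \<le> cmod (1 - of_real \<rho> * cis u) + cmod (of_real \<rho> * cis u - cis u)"
    using norm_triangle_ineq[of "1 - of_real \<rho> * cis u" "of_real \<rho> * cis u - cis u"] by simp
  also have "cmod (of_real \<rho> * cis u - cis u) = 1 - \<rho>"
  proof -
    have "of_real \<rho> * cis u - cis u = of_real (\<rho> - 1) * cis u" by (simp add: algebra_simps)
    then show ?thesis using assms by (simp add: norm_mult del: of_real_diff)
  qed
  finally have "sin (\<bar>u\<bar> / 2) \<le> cmod (1 - of_real \<rho> * cis u)" using b c by simp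
  moreover have "\<bar>u\<bar> / pi \<le> sin (\<bar>u\<bar> / 2)"
  proof -
    have "concave_on {0..pi / 2} sin"
    proof (rule f''_le0_imp_concave)
      show "DERIV sin x :> cos x" "DERIV cos x :> - sin x" for x :: real
        by (rule DERIV_sin DERIV_cos)+
      show "- sin x \<le> 0" if "x \<in> {0..pi / 2}" for x :: real
        using that by (auto intro!: sin_ge_zero)
    qed auto
    then show ?thesis
      using concave_onD_Icc'[of 0 "pi / 2" sin "\<bar>u\<bar> / 2"] assms by simp
  qed
  ultimately show "\<bar>u\<bar> / pi \<le> cmod (1 - of_real \<rho> * cis u)" by simp
qed

lemma measurable_cis [measurable]: "cis \<in> borel_measurable borel"
  by (intro borel_measurable_continuous_onI continuous_intros)

lemma measurable_cnj [measurable]: "cnj \<in> borel_measurable borel"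
  by (intro borel_measurable_continuous_onI continuous_intros)

text \<open>The modulus of the Bergman kernel in polar coordinates, up to 1 / pi and conjugation of
  one argument. Without the conjugate the angles are added and the kernel is symmetric.\<close>

definition disc_kernel :: "real \<times> real \<Rightarrow> real \<times> real \<Rightarrow> real" where
  "disc_kernel z v = 1 / (cmod (1 - of_real (fst z * fst v) * cis (snd z + snd v)))\<^sup>2"

lemma disc_kernel_measurable [measurable]: "(\<lambda>(z, v). disc_kernel z v) \<in> borel_measurable (plane \<Otimes>\<^sub>M plane)"
  unfolding disc_kernel_def by measurable

lemma disc_kernel_nonneg [simp]: "0 \<le> disc_kernel z v"
  by (simp add: disc_kernel_def)

text \<open>Two angles between 0 and 2 pi have a sum within pi of 0, 2 pi or 4 pi; adding the three
  kernels avoids a choice that depends on the points. With c the modulus in the kernel, pi + 2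
  combines |u| \<le> pi c with (1 - r) + (1 - s) \<le> 2 c.\<close>

lemma disc_kernel_le_shifted:
  assumes "fst z \<in> {0..<1}" "fst v \<in> {0..<1}" "snd z \<in> {0..2 * pi}" "snd v \<in> {0..2 * pi}"
  shows "disc_kernel z v \<le> (pi + 2)\<^sup>2 * (\<Sum>k<3. shifted_kernel (2 * pi * real k) z v)"
proof -
  let ?K = "\<lambda>k. shifted_kernel (2 * pi * real k) z v"
  obtain k :: nat where k: "k < 3" "\<bar>snd z + snd v - 2 * pi * real k\<bar> \<le> pi"
  proof -
    consider "snd z + snd v \<le> pi" | "pi < snd z + snd v" "snd z + snd v \<le> 3 * pi" | "3 * pi < snd z + snd v" by linarith
    then show ?thesis
    proof cases
      case 1 then show ?thesis using assms by (intro that[of 0]) auto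
    next
      case 2 then show ?thesis using assms by (intro that[of 1]) auto
    next
      case 3 then show ?thesis using assms by (intro that[of 2]) auto
    qed
  qed
  define u where "u = snd z + snd v - 2 * pi * real k"
  define \<rho> where "\<rho> = fst z * fst v"
  have \<rho>: "0 \<le> \<rho>" "\<rho> \<le> 1" "\<rho> \<le> fst z" "\<rho> \<le> fst v"
    using assms by (auto simp: \<rho>_def intro: mult_le_one mult_left_le mult_left_le_one_le)
  have "cis (snd z + snd v) = cis u"
  proof -
    have "cis (2 * pi * real k) = 1" by (metis cis_multiple_2pi Ints_of_nat)
    then show ?thesis by (simp add: u_def cis_divide[symmetric])
  qed
  then have e: "disc_kernel z v = 1 / (cmod (1 - of_real \<rho> * cis u))\<^sup>2"
    by (simp add: disc_kernel_def \<rho>_def)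
  define c where "c = cmod (1 - of_real \<rho> * cis u)"
  have c: "\<bar>u\<bar> / pi \<le> c" "1 - \<rho> \<le> c"
    using norm_one_minus_mult_cis_ge[OF \<rho>(1,2), of u] k unfolding c_def u_def by auto
  have "\<bar>u\<bar> \<le> pi * c" using c(1) by (simp add: field_simps)
  moreover have "(1 - fst z) + (1 - fst v) \<le> 2 * c" using c(2) \<rho> by linarith
  ultimately have le: "(1 - fst z) + (1 - fst v) + \<bar>u\<bar> \<le> (pi + 2) * c" by (simp add: algebra_simps)
  have pos: "0 < (1 - fst z) + (1 - fst v) + \<bar>u\<bar>" using assms by auto
  have "0 < c" using le pos by (smt (verit) mult_nonneg_nonpos pi_gt_zero)
  have "1 / c\<^sup>2 = (pi + 2)\<^sup>2 * (1 / ((pi + 2) * c)\<^sup>2)"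
  proof -
    have "pi + 2 \<noteq> 0" using pi_gt_zero by linarith
    then show ?thesis by (simp add: power_mult_distrib)
  qed
  also have "\<dots> \<le> (pi + 2)\<^sup>2 * ?K k"
  proof -
    have "((1 - fst z) + (1 - fst v) + \<bar>u\<bar>)\<^sup>2 \<le> ((pi + 2) * c)\<^sup>2"
      using pos by (intro power_mono le) simp
    then have "1 / ((pi + 2) * c)\<^sup>2 \<le> 1 / ((1 - fst z) + (1 - fst v) + \<bar>u\<bar>)\<^sup>2"
      using pos by (intro frac_le zero_less_power) auto
    then show ?thesis by (intro mult_left_mono) (auto simp: u_def)
  qed
  also have "\<dots> \<le> (pi + 2)\<^sup>2 * (\<Sum>k<3. ?K k)"
    using k by (intro mult_left_mono member_le_sum) auto
  finally show ?thesis by (simp add: e c_def)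
qed

text \<open>The Schur test for shifted kernels runs over all real angles, whereas their comparison
  with the disc kernel is made on this box.\<close>

definition in_box :: "(real \<times> real \<Rightarrow> real) \<Rightarrow> bool" where
  "in_box F \<longleftrightarrow> (\<forall>z. z \<notin> {0..<1} \<times> {0..2 * pi} \<longrightarrow> F z = 0)"

text \<open>When q < p, passing to conjugate exponents reverses the order, so the Schur test applies
  with \<open>F\<close> and \<open>G\<close> exchanged; symmetry of the kernel and Fubini bring the
  two integrals back into place.\<close>

lemma disc_kernel_bilinear_normalised:
  fixes p q p' q' :: real
  assumes p: "1 < p" "1 < q" and conj: "1 / p + 1 / p' = 1" "1 / q + 1 / q' = 1"
  obtains C where "0 \<le> C"
    "\<And>F G \<alpha> \<beta>. radial_profile p F \<alpha> \<Longrightarrow> radial_profile p' G \<beta> \<Longrightarrow> in_box F \<Longrightarrow> in_box G \<Longrightarrow>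
       (power_integral \<alpha> (q / p)) \<le> 1 \<Longrightarrow> (power_integral \<beta> (q' / p')) \<le> 1 \<Longrightarrow>
       (kernel_form disc_kernel F G) \<le> ennreal C"
proof -
  have "\<exists>C\<ge>0. \<forall>d F G \<alpha> \<beta>. radial_profile p F \<alpha> \<longrightarrow> radial_profile p' G \<beta> \<longrightarrow>
       (power_integral \<alpha> (q / p)) \<le> 1 \<longrightarrow> (power_integral \<beta> (q' / p')) \<le> 1 \<longrightarrow>
       (kernel_form (shifted_kernel d) F G) \<le> ennreal C"
  proof (cases "p \<le> q")
    case True
    show ?thesis
      by (rule shifted_kernel_bilinear_le[OF p(1) True conj]) blast
  next
    case False
    have p': "p' = p / (p - 1)" "1 < p'" and q': "q' = q / (q - 1)" "1 < q'"
      using conjugate_exponent[OF p(1) conj(1)] conjugate_exponent[OF p(2) conj(2)] by auto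
    have "p' \<le> q'" using False p by (simp add: p'(1) q'(1) field_simps)
    have conj': "1 / p' + 1 / p = 1" "1 / q' + 1 / q = 1" using conj by auto
    obtain C where C: "0 \<le> C"
    "\<And>d F G \<alpha> \<beta>. radial_profile p' F \<alpha> \<Longrightarrow> radial_profile p G \<beta> \<Longrightarrow>
       (power_integral \<alpha> (q' / p')) \<le> 1 \<Longrightarrow> (power_integral \<beta> (q / p)) \<le> 1 \<Longrightarrow>
       (kernel_form (shifted_kernel d) F G) \<le> ennreal C"
      by (rule shifted_kernel_bilinear_le[OF p'(2) \<open>p' \<le> q'\<close> conj']) (rule that)
    show ?thesis
    proof (intro exI[of _ C] conjI C(1) allI impI)
      fix d F G \<alpha> \<beta>
      assume F: "radial_profile p F \<alpha>" and G: "radial_profile p' G \<beta>"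
        and n: "(power_integral \<alpha> (q / p)) \<le> 1" "(power_integral \<beta> (q' / p')) \<le> 1"
      have [measurable]: "F \<in> borel_measurable plane" "G \<in> borel_measurable plane"
        using F G by (auto simp: radial_profile_def)
      have "(kernel_form (shifted_kernel d) F G)
         = (\<integral>\<^sup>+v. \<integral>\<^sup>+z. ennreal (F v * G z * (1 / ((1 - fst z) + (1 - fst v) + \<bar>snd z + snd v - d\<bar>)\<^sup>2)) \<partial>plane \<partial>plane)"
        by (rule plane_pair.Fubini') measurable
      also have "\<dots> = (\<integral>\<^sup>+v. \<integral>\<^sup>+z. ennreal (G z * F v * (1 / ((1 - fst v) + (1 - fst z) + \<bar>snd v + snd z - d\<bar>)\<^sup>2)) \<partial>plane \<partial>plane)"
        by (simp only: ac_simps)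
      also have "\<dots> \<le> ennreal C" by (rule C(2)[OF G F n(2,1)])
      finally show "(kernel_form (shifted_kernel d) F G) \<le> ennreal C" .
    qed
  qed
  then obtain C where C: "0 \<le> C" and le: "\<And>d F G \<alpha> \<beta>. radial_profile p F \<alpha> \<Longrightarrow> radial_profile p' G \<beta> \<Longrightarrow>
       (power_integral \<alpha> (q / p)) \<le> 1 \<Longrightarrow> (power_integral \<beta> (q' / p')) \<le> 1 \<Longrightarrow>
       (kernel_form (shifted_kernel d) F G) \<le> ennreal C"
    by blast
  show thesis
  proof (rule that[of "(pi + 2)\<^sup>2 * (3 * C)"])
    show "0 \<le> (pi + 2)\<^sup>2 * (3 * C)" using C by simp
    fix F G \<alpha> \<beta>
    assume F: "radial_profile p F \<alpha>" and G: "radial_profile p' G \<beta>" and box: "in_box F" "in_box G"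
      and n: "(power_integral \<alpha> (q / p)) \<le> 1" "(power_integral \<beta> (q' / p')) \<le> 1"
    have [measurable]: "F \<in> borel_measurable plane" "G \<in> borel_measurable plane"
      and nn: "\<And>z. 0 \<le> F z" "\<And>z. 0 \<le> G z"
      using F G by (auto simp: radial_profile_def)
    define k where "k = (\<lambda>j z v. shifted_kernel (2 * pi * real j) z v)"
    have [measurable]: "(\<lambda>(z, v). k j z v) \<in> borel_measurable (plane \<Otimes>\<^sub>M plane)" for j
      unfolding k_def by measurable
    have k0: "0 \<le> k j z v" for j z v by (simp add: k_def)
    have "(kernel_form disc_kernel F G)
      \<le> (\<integral>\<^sup>+z. \<integral>\<^sup>+v. ennreal ((pi + 2)\<^sup>2) * (\<Sum>j<3. ennreal (F v * G z * k j z v)) \<partial>plane \<partial>plane)"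
    proof (intro nn_integral_mono)
      fix z v :: "real \<times> real"
      show "ennreal (F v * G z * disc_kernel z v) \<le> ennreal ((pi + 2)\<^sup>2) * (\<Sum>j<3. ennreal (F v * G z * k j z v))"
      proof (cases "z \<in> {0..<1} \<times> {0..2 * pi} \<and> v \<in> {0..<1} \<times> {0..2 * pi}")
        case True
        have "F v * G z * disc_kernel z v \<le> F v * G z * ((pi + 2)\<^sup>2 * (\<Sum>j<3. k j z v))"
          unfolding k_def using True nn by (intro mult_left_mono disc_kernel_le_shifted) auto
        also have "\<dots> = (pi + 2)\<^sup>2 * (\<Sum>j<3. F v * G z * k j z v)"
          by (simp add: sum_distrib_left mult_ac)
        finally show ?thesis
          using nn k0 by (simp add: ennreal_mult'[symmetric] sum_nonneg ennreal_leI)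
      next
        case False
        then have "F v * G z = 0" using box unfolding in_box_def by (metis mult_eq_0_iff)
        then show ?thesis by auto
      qed
    qed
    also have "\<dots> = ennreal ((pi + 2)\<^sup>2) * (\<Sum>j<3. \<integral>\<^sup>+z. \<integral>\<^sup>+v. ennreal (F v * G z * k j z v) \<partial>plane \<partial>plane)"
      by (simp add: nn_integral_cmult nn_integral_sum space_pair_measure)
    also have "\<dots> \<le> ennreal ((pi + 2)\<^sup>2) * (\<Sum>j<3::nat. ennreal C)"
      unfolding k_def by (intro mult_left_mono sum_mono le[OF F G n]) auto
    also have "\<dots> = ennreal ((pi + 2)\<^sup>2 * (3 * C))"
      using C by (simp add: ennreal_mult'[symmetric] ennreal_numeral[symmetric] ennreal_of_nat_eq_real_of_nat del: ennreal_numeral)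
    finally show "(kernel_form disc_kernel F G) \<le> ennreal ((pi + 2)\<^sup>2 * (3 * C))" .
  qed
qed

lemma radial_profile_scale:
  assumes F: "radial_profile p F \<alpha>" and c: "0 < c"
  shows "radial_profile p (\<lambda>z. c * F z) (\<lambda>t. c powr p * \<alpha> t)"
proof -
  have [measurable]: "F \<in> borel_measurable plane" "\<alpha> \<in> borel_measurable borel" and F0: "\<And>z. 0 \<le> F z"
    and i: "\<And>t. (ray_integral p F t) = ennreal (\<alpha> t)"
    using F by (auto simp: radial_profile_def)
  have "(\<integral>\<^sup>+r. ennreal ((c * F (r, t)) powr p) \<partial>lborel) = ennreal (c powr p * \<alpha> t)" for t
  proof -
    have "(\<integral>\<^sup>+r. ennreal ((c * F (r, t)) powr p) \<partial>lborel) = (\<integral>\<^sup>+r. ennreal (c powr p) * ennreal (F (r, t) powr p) \<partial>lborel)"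
      using F0 c by (simp add: powr_mult ennreal_mult)
    also have "\<dots> = ennreal (c powr p) * ennreal (\<alpha> t)"
      by (subst nn_integral_cmult) (simp_all add: i)
    finally show ?thesis by (simp add: ennreal_mult')
  qed
  moreover have "\<exists>B. \<forall>t. c powr p * \<alpha> t \<le> B"
  proof -
    obtain B where "\<And>t. \<alpha> t \<le> B" using F by (auto simp: radial_profile_def)
    then show ?thesis by (intro exI[of _ "c powr p * B"]) (auto intro!: mult_left_mono)
  qed
  ultimately show ?thesis
    using F c unfolding radial_profile_def by auto
qed

text \<open>Homogeneity: multiplying \<open>F\<close> by \<open>N powr (-1 / q)\<close> multiplies
  \<open>\<alpha>\<close> by the p-th power of that number, hence its integral by 1 / N. The same
  holds for \<open>G\<close> with \<open>M\<close>.\<close>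

lemma disc_kernel_bilinear_le:
  fixes p q p' q' :: real
  assumes p: "1 < p" "1 < q" and conj: "1 / p + 1 / p' = 1" "1 / q + 1 / q' = 1"
  obtains C where "0 \<le> C"
    "\<And>F G \<alpha> \<beta> N M. radial_profile p F \<alpha> \<Longrightarrow> radial_profile p' G \<beta> \<Longrightarrow> in_box F \<Longrightarrow> in_box G \<Longrightarrow>
       (power_integral \<alpha> (q / p)) = ennreal N \<Longrightarrow>
       (power_integral \<beta> (q' / p')) = ennreal M \<Longrightarrow> 0 < N \<Longrightarrow> 0 < M \<Longrightarrow>
       (kernel_form disc_kernel F G) \<le> ennreal (C * N powr (1 / q) * M powr (1 / q'))"
proof -
  obtain C where C: "0 \<le> C" and le:
    "\<And>F G \<alpha> \<beta>. radial_profile p F \<alpha> \<Longrightarrow> radial_profile p' G \<beta> \<Longrightarrow> in_box F \<Longrightarrow> in_box G \<Longrightarrow>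
       (power_integral \<alpha> (q / p)) \<le> 1 \<Longrightarrow> (power_integral \<beta> (q' / p')) \<le> 1 \<Longrightarrow>
       (kernel_form disc_kernel F G) \<le> ennreal C"
    by (rule disc_kernel_bilinear_normalised[OF p conj]) (rule that)
  have norm1: "(\<integral>\<^sup>+t. ennreal (((N powr (-1 / b)) powr a * \<alpha> t) powr (b / a)) \<partial>lborel) \<le> 1"
    if "radial_profile a F \<alpha>" "(power_integral \<alpha> (b / a)) = ennreal N" "0 < N" "1 < a" "1 < b"
    for N a b :: real and F \<alpha>
  proof -
    have [measurable]: "\<alpha> \<in> borel_measurable borel" and \<alpha>: "\<And>t. 0 \<le> \<alpha> t" using that by (auto simp: radial_profile_def)
    have "((N powr (-1 / b)) powr a * \<alpha> t) powr (b / a) = \<alpha> t powr (b / a) / N" for t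
    proof -
      have "-1 / b * a * (b / a) = -1" using that by simp
      then have "((N powr (-1 / b)) powr a) powr (b / a) = 1 / N"
        unfolding powr_powr using that by (simp add: powr_minus_divide)
      then show ?thesis using \<alpha>[of t] by (simp add: powr_mult)
    qed
    then have "(\<integral>\<^sup>+t. ennreal (((N powr (-1 / b)) powr a * \<alpha> t) powr (b / a)) \<partial>lborel) = (\<integral>\<^sup>+t. ennreal (1 / N) * ennreal (\<alpha> t powr (b / a)) \<partial>lborel)"
      using that by (simp add: ennreal_mult'[symmetric])
    also have "\<dots> = ennreal (1 / N) * ennreal N"
      by (subst nn_integral_cmult) (simp_all add: that(2))
    also have "\<dots> = 1" using that by (simp add: ennreal_mult'[symmetric])
    finally show ?thesis by simp
  qed
  have pp: "1 < p'" "1 < q'" using conjugate_exponent[OF p(1) conj(1)] conjugate_exponent[OF p(2) conj(2)] by auto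
  show thesis
  proof (rule that[OF C])
    fix F G \<alpha> \<beta> N M
    assume F: "radial_profile p F \<alpha>" and G: "radial_profile p' G \<beta>" and box: "in_box F" "in_box G"
      and N: "(power_integral \<alpha> (q / p)) = ennreal N"
       "(power_integral \<beta> (q' / p')) = ennreal M" and pos: "0 < N" "0 < M"
    have [measurable]: "F \<in> borel_measurable plane" "G \<in> borel_measurable plane"
      and nn: "\<And>z. 0 \<le> F z" "\<And>z. 0 \<le> G z"
      using F G by (auto simp: radial_profile_def)
    define c where "c = N powr (-1 / q)"
    define e where "e = M powr (-1 / q')"
    have ce: "0 < c" "0 < e" using pos by (auto simp: c_def e_def)
    have box': "in_box (\<lambda>z. c * F z)" "in_box (\<lambda>z. e * G z)" using box by (auto simp: in_box_def)
    have "(kernel_form disc_kernel F G)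
       = (\<integral>\<^sup>+z. \<integral>\<^sup>+v. ennreal (1 / (c * e)) * ennreal (c * F v * (e * G z) * disc_kernel z v) \<partial>plane \<partial>plane)"
      using ce by (simp add: ennreal_mult'[symmetric] mult.assoc)
    also have "\<dots> = ennreal (1 / (c * e)) * (\<integral>\<^sup>+z. \<integral>\<^sup>+v. ennreal (c * F v * (e * G z) * disc_kernel z v) \<partial>plane \<partial>plane)"
      by (simp add: nn_integral_cmult space_pair_measure)
    also have "\<dots> \<le> ennreal (1 / (c * e)) * ennreal C"
      using norm1[OF F N(1) pos(1) p] norm1[OF G N(2) pos(2) pp]
      by (intro mult_left_mono le[OF radial_profile_scale[OF F ce(1)] radial_profile_scale[OF G ce(2)] box'])
         (auto simp: c_def e_def)
    also have "\<dots> = ennreal (C * N powr (1 / q) * M powr (1 / q'))"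
    proof -
      have "1 / (c * e) * C = C * N powr (1 / q) * M powr (1 / q')"
        using pos by (simp add: c_def e_def powr_minus field_simps)
      then show ?thesis using ce by (simp add: ennreal_mult'[symmetric])
    qed
    finally show "(kernel_form disc_kernel F G) \<le> ennreal (C * N powr (1 / q) * M powr (1 / q'))" .
  qed
qed

section \<open>Norming functions and the bound for the positive operator\<close>

lemma norming_exponent:
  fixes p q p' q' :: real
  assumes "1 < p" "1 < q" "1 / p + 1 / p' = 1" "1 / q + 1 / q' = 1"
  shows "(p' * (q / p - 1) + 1) * (q' / p') = q / p" "0 < p' * (q / p - 1) + 1"
proof -
  have c: "p' = p / (p - 1)" "q' = q / (q - 1)" "1 < p'" "1 < q'"
    using conjugate_exponent[OF assms(1,3)] conjugate_exponent[OF assms(2,4)] by auto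
  have "q - 1 \<noteq> 0" "p - 1 \<noteq> 0" "p \<noteq> 0" "q \<noteq> 0" using assms by auto
  then show e: "(p' * (q / p - 1) + 1) * (q' / p') = q / p"
    unfolding c(1,2) by (simp add: divide_simps)
  have "0 < q / p" "0 < q' / p'" using assms c by auto
  \<comment> \<open>For q < p the term q / p - 1 is negative; positivity is inherited from q / p
    through the identity just proved.\<close>
  then show "0 < p' * (q / p - 1) + 1" using e by (metis zero_less_mult_pos2)
qed

text \<open>\<open>G\<close> is the extremal function of Hoelder's inequality for the mixed norm:
  after integration over the angle, its pairing with \<open>\<Phi>\<close>, the q-th power of the
  norm of \<open>\<Phi>\<close> and the q'-th power of its own norm are all the integral of
  \<open>A powr (q / p)\<close>. For q < p the exponent of \<open>A\<close> is negative; on rays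
  with A t = 0 the convention 0 powr x = 0 makes \<open>G\<close> vanish, as
  \<open>radial_profile\<close> demands.\<close>

lemma norming_function:
  fixes p q p' q' :: real and \<Phi> :: "real \<times> real \<Rightarrow> real" and A :: "real \<Rightarrow> real"
  assumes p: "1 < p" "1 < q" and conj: "1 / p + 1 / p' = 1" "1 / q + 1 / q' = 1"
    and [measurable]: "\<Phi> \<in> borel_measurable plane" "A \<in> borel_measurable borel"
    and \<Phi>: "\<And>z. 0 \<le> \<Phi> z" "\<And>r t. 1 \<le> r \<Longrightarrow> \<Phi> (r, t) = 0"
    and A: "\<And>t. 0 \<le> A t" "\<And>t. A t \<le> B" "\<And>t. (ray_integral p \<Phi> t) = ennreal (A t)"
  defines "G \<equiv> \<lambda>z. \<Phi> z powr (p - 1) * A (snd z) powr (q / p - 1)"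
    and "\<beta> \<equiv> \<lambda>t. A t powr (p' * (q / p - 1) + 1)"
  shows "radial_profile p' G \<beta>"
    and "\<beta> t powr (q' / p') = A t powr (q / p)"
    and "(\<integral>\<^sup>+r. ennreal (\<Phi> (r, t) * G (r, t)) \<partial>lborel) = ennreal (A t powr (q / p))"
proof -
  have pp: "p' = p / (p - 1)" "1 < p'" using conjugate_exponent[OF p(1) conj(1)] by auto
  note e = norming_exponent[OF p conj]
  show "\<beta> t powr (q' / p') = A t powr (q / p)"
    unfolding \<beta>_def powr_powr e(1) ..
  have "(ray_integral p' G t) = ennreal (\<beta> t)" for t
  proof (cases "A t = 0")
    case True
    then show ?thesis by (simp add: G_def \<beta>_def)
  next
    case False
    then have At: "A t > 0" using A(1)[of t] by simp
    have pe: "p' * (p - 1) = p" using p pp by simp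
    have "(ray_integral p' G t) = (\<integral>\<^sup>+r. ennreal (A t powr (p' * (q / p - 1))) * ennreal (\<Phi> (r, t) powr p) \<partial>lborel)"
      using \<Phi>(1) by (simp add: G_def powr_mult powr_powr ennreal_mult'[symmetric] mult.commute) (simp add: pe mult.commute)
    also have "\<dots> = ennreal (A t powr (p' * (q / p - 1))) * ennreal (A t)"
      by (subst nn_integral_cmult) (simp_all add: A(3))
    also have "\<dots> = ennreal (\<beta> t)"
      using At by (simp add: \<beta>_def powr_add ennreal_mult'[symmetric])
    finally show ?thesis .
  qed
  moreover have "\<beta> t \<le> B powr (p' * (q / p - 1) + 1)" for t
    unfolding \<beta>_def using e A by (intro powr_mono2) auto
  moreover have "G \<in> borel_measurable plane" "\<beta> \<in> borel_measurable borel" unfolding G_def \<beta>_def by measurable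
  ultimately show "radial_profile p' G \<beta>"
    using \<Phi> p unfolding radial_profile_def by (auto simp: G_def \<beta>_def)
  show "(\<integral>\<^sup>+r. ennreal (\<Phi> (r, t) * G (r, t)) \<partial>lborel) = ennreal (A t powr (q / p))"
  proof (cases "A t = 0")
    case True
    then show ?thesis by (simp add: G_def)
  next
    case False
    then have At: "A t > 0" using A(1)[of t] by simp
    have pw: "x * x powr (p - 1) = x powr p" if "0 \<le> x" for x :: real
      using that p by (cases "x = 0") (auto simp: powr_diff)
    have "(\<integral>\<^sup>+r. ennreal (\<Phi> (r, t) * G (r, t)) \<partial>lborel) = (\<integral>\<^sup>+r. ennreal (A t powr (q / p - 1)) * ennreal (\<Phi> (r, t) powr p) \<partial>lborel)"
      using \<Phi>(1) by (simp add: G_def pw[symmetric] ennreal_mult'[symmetric] mult_ac)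
    also have "\<dots> = ennreal (A t powr (q / p - 1)) * ennreal (A t)"
      by (subst nn_integral_cmult) (simp_all add: A(3))
    also have "\<dots> = ennreal (A t powr (q / p))"
      using At by (simp add: powr_diff ennreal_mult'[symmetric])
    finally show ?thesis .
  qed
qed

text \<open>\<open>\<Phi>\<close> is tested against its own norming function. With M the integral to
  be bounded this gives \<open>M \<le> C * N powr (1 / q) * M powr (1 / q')\<close>, and cancelling
  the last factor needs M finite; hence the box and the bounded profile. \<open>\<Phi>\<close> is
  only dominated by the kernel integral because it will be the modulus of a holomorphic
  function.\<close>

lemma disc_kernel_operator_bound:
  fixes p q p' q' :: real
  assumes p: "1 < p" "1 < q" and conj: "1 / p + 1 / p' = 1" "1 / q + 1 / q' = 1"
  obtains C where "0 \<le> C"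
    "\<And>F \<alpha> \<Phi> A N B. radial_profile p F \<alpha> \<Longrightarrow> in_box F \<Longrightarrow>
       (power_integral \<alpha> (q / p)) = ennreal N \<Longrightarrow> 0 < N \<Longrightarrow>
       \<Phi> \<in> borel_measurable plane \<Longrightarrow> in_box \<Phi> \<Longrightarrow> (\<forall>z. 0 \<le> \<Phi> z) \<Longrightarrow>
       (\<forall>z. ennreal (\<Phi> z) \<le> (\<integral>\<^sup>+v. ennreal (F v * disc_kernel z v) \<partial>plane)) \<Longrightarrow>
       A \<in> borel_measurable borel \<Longrightarrow> (\<forall>t. 0 \<le> A t) \<Longrightarrow> (\<forall>t. A t \<le> B) \<Longrightarrow>
       (\<forall>t. (ray_integral p \<Phi> t) = ennreal (A t)) \<Longrightarrow>
       (power_integral A (q / p)) \<le> ennreal (C powr q * N)"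
proof -
  obtain C where C: "0 \<le> C" and le:
    "\<And>F G \<alpha> \<beta> N M. radial_profile p F \<alpha> \<Longrightarrow> radial_profile p' G \<beta> \<Longrightarrow> in_box F \<Longrightarrow> in_box G \<Longrightarrow>
       (power_integral \<alpha> (q / p)) = ennreal N \<Longrightarrow>
       (power_integral \<beta> (q' / p')) = ennreal M \<Longrightarrow> 0 < N \<Longrightarrow> 0 < M \<Longrightarrow>
       (kernel_form disc_kernel F G) \<le> ennreal (C * N powr (1 / q) * M powr (1 / q'))"
    by (rule disc_kernel_bilinear_le[OF p conj]) (rule that)
  show thesis
  proof (rule that[OF C])
    fix F \<alpha> \<Phi> A N B
    assume F: "radial_profile p F \<alpha>" and boxF: "in_box F"
      and N: "(power_integral \<alpha> (q / p)) = ennreal N" "0 < N"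
      and \<Phi>m [measurable]: "\<Phi> \<in> borel_measurable plane" and box: "in_box \<Phi>" and \<Phi>': "\<forall>z. 0 \<le> \<Phi> z"
      and dom': "\<forall>z. ennreal (\<Phi> z) \<le> (\<integral>\<^sup>+v. ennreal (F v * disc_kernel z v) \<partial>plane)"
      and Am [measurable]: "A \<in> borel_measurable borel" and A': "\<forall>t. 0 \<le> A t" "\<forall>t. A t \<le> B"
      and Ai': "\<forall>t. (ray_integral p \<Phi> t) = ennreal (A t)"
    have \<Phi>: "\<And>z. 0 \<le> \<Phi> z" and dom: "\<And>z. ennreal (\<Phi> z) \<le> (\<integral>\<^sup>+v. ennreal (F v * disc_kernel z v) \<partial>plane)"
      and A: "\<And>t. 0 \<le> A t" "\<And>t. A t \<le> B" and Ai: "\<And>t. (ray_integral p \<Phi> t) = ennreal (A t)"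
      using \<Phi>' dom' A' Ai' by auto
    have [measurable]: "F \<in> borel_measurable plane" and F0: "\<And>z. 0 \<le> F z" using F by (auto simp: radial_profile_def)
    have \<Phi>1: "\<And>r t. 1 \<le> r \<Longrightarrow> \<Phi> (r, t) = 0" using box by (auto simp: in_box_def)
    define G where "G = (\<lambda>z. \<Phi> z powr (p - 1) * A (snd z) powr (q / p - 1))"
    define \<beta> where "\<beta> = (\<lambda>t. A t powr (p' * (q / p - 1) + 1))"
    have nf: "radial_profile p' G \<beta>" "\<And>t. \<beta> t powr (q' / p') = A t powr (q / p)"
        "\<And>t. (\<integral>\<^sup>+r. ennreal (\<Phi> (r, t) * G (r, t)) \<partial>lborel) = ennreal (A t powr (q / p))"
      unfolding G_def \<beta>_def by (rule norming_function[OF p conj \<Phi>m Am \<Phi> \<Phi>1 A Ai]; assumption)+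
    have [measurable]: "G \<in> borel_measurable plane" and G0: "\<And>z. 0 \<le> G z" using nf(1) by (auto simp: radial_profile_def)
    have boxG: "in_box G" using box p by (auto simp: in_box_def G_def)
    have Asupp: "A t = 0" if "t \<notin> {0..2 * pi}" for t
    proof -
      have "\<Phi> (r, t) = 0" for r using box that unfolding in_box_def by (metis mem_Sigma_iff)
      then show ?thesis using Ai[of t] A(1)[of t] by simp
    qed
    have "(power_integral A (q / p)) \<le> (\<integral>\<^sup>+t. ennreal (B powr (q / p)) * indicator {0..2 * pi} t \<partial>lborel)"
      using A p Asupp by (intro nn_integral_mono) (auto simp: indicator_def intro!: ennreal_leI powr_mono2)
    also have "\<dots> < \<infinity>" by (subst nn_integral_cmult_indicator) (auto simp: ennreal_mult_less_top)
    finally obtain M where M: "(power_integral A (q / p)) = ennreal M" "0 \<le> M"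
      by (cases "\<integral>\<^sup>+t. ennreal (A t powr (q / p)) \<partial>lborel") auto
    show "(power_integral A (q / p)) \<le> ennreal (C powr q * N)"
    proof (cases "M = 0")
      case False
      then have Mp: "0 < M" using M by simp
      have "ennreal M = (\<integral>\<^sup>+t. \<integral>\<^sup>+r. ennreal (\<Phi> (r, t) * G (r, t)) \<partial>lborel \<partial>lborel)"
        by (simp add: M(1)[symmetric] nf(3))
      also have "\<dots> = (\<integral>\<^sup>+z. ennreal (\<Phi> z * G z) \<partial>plane)"
        by (subst lborel_pair.nn_integral_snd[symmetric]) auto
      also have "\<dots> \<le> (\<integral>\<^sup>+z. ennreal (G z) * (\<integral>\<^sup>+v. ennreal (F v * disc_kernel z v) \<partial>plane) \<partial>plane)"
        using G0 \<Phi> by (intro nn_integral_mono) (auto simp: ennreal_mult mult.commute intro!: mult_left_mono dom)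
      also have "\<dots> = (kernel_form disc_kernel F G)"
        using G0 F0 by (simp add: nn_integral_cmult[symmetric] ennreal_mult'[symmetric] mult_ac space_pair_measure)
      also have "\<dots> \<le> ennreal (C * N powr (1 / q) * M powr (1 / q'))"
        by (rule le[OF F nf(1) boxF boxG N(1) _ N(2) Mp]) (simp add: nf(2) M(1))
      finally have "M \<le> C * N powr (1 / q) * M powr (1 / q')"
        using C by (simp add: ennreal_le_iff)
      moreover have "M = M powr (1 / q) * M powr (1 / q')"
        using Mp conj by (simp add: powr_add[symmetric])
      ultimately have "M powr (1 / q) * M powr (1 / q') \<le> C * N powr (1 / q) * M powr (1 / q')" by simp
      then have "M powr (1 / q) \<le> C * N powr (1 / q)"
        using Mp by simp
      then have "(M powr (1 / q)) powr q \<le> (C * N powr (1 / q)) powr q"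
        using p by (intro powr_mono2) auto
      then show ?thesis using Mp N C p by (simp add: M(1) powr_powr powr_mult ennreal_leI)
    qed (simp add: M)
  qed
qed

section \<open>Mixed norms\<close>

lemma ennreal_powr_ennreal [simp]: "0 \<le> x \<Longrightarrow> ennreal_powr (ennreal x) a = ennreal (x powr a)"
  by (simp add: ennreal_powr_def)

lemma ennreal_powr_0 [simp]: "ennreal_powr 0 a = 0"
  by (simp add: ennreal_powr_def)

lemma ennreal_powr_top [simp]: "ennreal_powr top a = top"
  by (simp add: ennreal_powr_def)

lemma ennreal_powr_less_top_iff [simp]: "ennreal_powr x a < top \<longleftrightarrow> x < top"
  by (cases x) auto

lemma ennreal_powr_eq_0_iff [simp]: "ennreal_powr x a = 0 \<longleftrightarrow> x = 0"
  by (cases x) (auto simp: ennreal_eq_0_iff)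

lemma ennreal_powr_mono: "x \<le> y \<Longrightarrow> 0 \<le> a \<Longrightarrow> ennreal_powr x a \<le> ennreal_powr y a"
  by (cases x; cases y) (auto simp: top_unique intro!: ennreal_leI powr_mono2)

lemma ennreal_powr_mult: "ennreal_powr (x * y) a = ennreal_powr x a * ennreal_powr y a"
proof (cases "x = 0 \<or> y = 0")
  case False
  then show ?thesis
    by (cases x; cases y) (auto simp: ennreal_mult'[symmetric] ennreal_top_mult ennreal_mult_top powr_mult)
qed auto

lemma ennreal_powr_powr: "ennreal_powr (ennreal_powr x a) b = ennreal_powr x (a * b)"
  by (cases x) (auto simp: powr_powr)

lemma ennreal_powr_one [simp]: "ennreal_powr x 1 = x"
  by (cases x) auto

lemma ennreal_powr_indicator [simp]: "ennreal_powr (indicator A x) a = indicator A x"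
  by (auto simp: indicator_def ennreal_powr_def)

lemma measurable_ennreal_powr [measurable (raw)]:
  assumes [measurable]: "f \<in> borel_measurable M"
  shows "(\<lambda>x. ennreal_powr (f x) a) \<in> borel_measurable M"
  unfolding ennreal_powr_def by measurable

lemma ennreal_powr_add_le:
  assumes "0 \<le> a"
  shows "ennreal_powr (x + y) a \<le> ennreal (2 powr a) * (ennreal_powr x a + ennreal_powr y a)"
proof -
  have "x + y \<le> 2 * max x y" by (cases "x \<le> y") (auto simp: max_def mult_2 intro: add_mono)
  then have "ennreal_powr (x + y) a \<le> ennreal_powr (ennreal 2 * max x y) a"
    using assms by (intro ennreal_powr_mono) auto
  also have "\<dots> = ennreal (2 powr a) * ennreal_powr (max x y) a"
    unfolding ennreal_powr_mult by (subst ennreal_powr_ennreal) simp_all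
  also have "\<dots> \<le> ennreal (2 powr a) * (ennreal_powr x a + ennreal_powr y a)"
    by (intro mult_left_mono) (auto simp: max_def)
  finally show ?thesis .
qed

lemma ennreal_Young:
  fixes p p' :: real
  assumes "1 < p" "1 < p'" "1 / p + 1 / p' = 1"
  shows "x * y \<le> ennreal (1 / p) * ennreal_powr x p + ennreal (1 / p') * ennreal_powr y p'"
proof (cases "x = top \<or> y = top")
  case True
  then show ?thesis using assms by (auto simp: ennreal_mult_top)
next
  case False
  then obtain a b where ab: "x = ennreal a" "y = ennreal b" "0 \<le> a" "0 \<le> b"
    by (cases x; cases y) auto
  have "a * b \<le> 1 / p * a powr p + 1 / p' * b powr p'"
    using Youngs_inequality[OF assms ab(3,4)] by simp
  then show ?thesis
    using ab assms by (simp add: ennreal_mult'[symmetric] ennreal_plus[symmetric] ennreal_leI del: ennreal_plus)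
qed

text \<open>Young's inequality for functions normalised to have integral 1. The degenerate cases are
  genuine in \<open>ennreal\<close>: a factor that vanishes almost everywhere annihilates the
  product even where the other is infinite, and an infinite integral beside a nonzero one makes the
  right side infinite.\<close>

lemma nn_integral_Hoelder:
  fixes p p' :: real
  assumes p: "1 < p" "1 < p'" "1 / p + 1 / p' = 1"
    and [measurable]: "u \<in> borel_measurable M" "v \<in> borel_measurable M"
  shows "(\<integral>\<^sup>+x. u x * v x \<partial>M) \<le> ennreal_powr (\<integral>\<^sup>+x. ennreal_powr (u x) p \<partial>M) (1 / p)
           * ennreal_powr (\<integral>\<^sup>+x. ennreal_powr (v x) p' \<partial>M) (1 / p')"
proof -
  define a where "a = (\<integral>\<^sup>+x. ennreal_powr (u x) p \<partial>M)"
  define b where "b = (\<integral>\<^sup>+x. ennreal_powr (v x) p' \<partial>M)"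
  consider "a = 0 \<or> b = 0" | "a \<noteq> 0" "b \<noteq> 0" "a = top \<or> b = top" | "0 < a" "0 < b" "a < top" "b < top"
    using less_top zero_less_iff_neq_zero by metis
  then show ?thesis
  proof cases
    case 1
    then have "AE x in M. u x * v x = 0"
    proof
      assume "a = 0"
      then have "AE x in M. ennreal_powr (u x) p = 0" unfolding a_def by (subst (asm) nn_integral_0_iff_AE) auto
      then show ?thesis by eventually_elim simp
    next
      assume "b = 0"
      then have "AE x in M. ennreal_powr (v x) p' = 0" unfolding b_def by (subst (asm) nn_integral_0_iff_AE) auto
      then show ?thesis by eventually_elim simp
    qed
    then have "(\<integral>\<^sup>+x. u x * v x \<partial>M) = 0" by (subst nn_integral_0_iff_AE) auto
    then show ?thesis by simp
  next
    case 2
    then have "ennreal_powr a (1 / p) * ennreal_powr b (1 / p') = top"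
      by (auto simp: ennreal_mult_top ennreal_top_mult)
    then show ?thesis unfolding a_def b_def by simp
  next
    case 3
    then obtain s t where st: "a = ennreal s" "b = ennreal t" "0 < s" "0 < t"
      by (cases a; cases b) auto
    define c where "c = s powr (1 / p)"
    define d where "d = t powr (1 / p')"
    have cd: "0 < c" "0 < d" using st by (auto simp: c_def d_def)
    have cp: "(1 / c) powr p = 1 / s" "(1 / d) powr p' = 1 / t"
      using st p by (auto simp: c_def d_def powr_divide powr_powr)
    have "(\<integral>\<^sup>+x. u x * v x \<partial>M) \<le> (\<integral>\<^sup>+x. ennreal (c * d) * (ennreal (1 / p * (1 / s)) * ennreal_powr (u x) p
        + ennreal (1 / p' * (1 / t)) * ennreal_powr (v x) p') \<partial>M)"
    proof (rule nn_integral_mono)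
      fix x
      have "u x * v x = ennreal (c * d) * ((ennreal (1 / c) * u x) * (ennreal (1 / d) * v x))"
      proof -
        have "ennreal (c * d) * ennreal (1 / c) * ennreal (1 / d) = 1"
          using cd by (simp add: ennreal_mult'[symmetric])
        then show ?thesis by (metis mult.assoc mult.left_commute mult_1)
      qed
      also have "\<dots> \<le> ennreal (c * d) * (ennreal (1 / p) * ennreal_powr (ennreal (1 / c) * u x) p
          + ennreal (1 / p') * ennreal_powr (ennreal (1 / d) * v x) p')"
        by (intro mult_left_mono ennreal_Young p) auto
      also have "\<dots> = ennreal (c * d) * (ennreal (1 / p * (1 / s)) * ennreal_powr (u x) p
        + ennreal (1 / p' * (1 / t)) * ennreal_powr (v x) p')"
        using cd cp st p by (simp add: ennreal_powr_mult mult.assoc[symmetric] ennreal_mult'[symmetric])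
      finally show "u x * v x \<le> ennreal (c * d) * (ennreal (1 / p * (1 / s)) * ennreal_powr (u x) p
        + ennreal (1 / p' * (1 / t)) * ennreal_powr (v x) p')" .
    qed
    also have "\<dots> = ennreal (c * d) * (ennreal (1 / p * (1 / s)) * a + ennreal (1 / p' * (1 / t)) * b)"
      unfolding a_def b_def by (simp add: nn_integral_cmult nn_integral_add)
    also have "\<dots> = ennreal (c * d) * ennreal (1 / p + 1 / p')"
      using st p by (simp add: ennreal_mult'[symmetric] ennreal_plus[symmetric] del: ennreal_plus)
    also have "\<dots> = ennreal_powr a (1 / p) * ennreal_powr b (1 / p')"
      using st cd by (simp add: p(3) c_def d_def ennreal_mult')
    finally show ?thesis unfolding a_def b_def .
  qed
qed

section \<open>The mixed norm as an iterated integral, and the linear structure of the space\<close>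

definition radial :: "real \<Rightarrow> (complex \<Rightarrow> complex) \<Rightarrow> real \<Rightarrow> ennreal" where
  "radial p f t = (\<integral>\<^sup>+r\<in>{0..<1}. ennreal (cmod (f (of_real r * cis t)) powr p) \<partial>lborel)"

text \<open>The q-th power of the norm, without the factor 1 / (2 pi); \<open>radial\<close> is the
  p-th power of the norm along a ray. Working at this level postpones the outer root.\<close>

definition rho_power :: "real \<Rightarrow> real \<Rightarrow> (complex \<Rightarrow> complex) \<Rightarrow> ennreal" where
  "rho_power p q f = (\<integral>\<^sup>+t\<in>{0..2 * pi}. ennreal_powr (radial p f t) (q / p) \<partial>lborel)"

lemma rho_eq: "rho p q f = ennreal_powr (ennreal (1 / (2 * pi)) * rho_power p q f) (1 / q)"
  unfolding rho_def rho_power_def radial_def ..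

lemma rho_less_top_iff: "rho p q f < top \<longleftrightarrow> rho_power p q f < top"
  unfolding rho_eq ennreal_powr_less_top_iff by (auto simp: ennreal_mult_less_top)

lemma rho_power_eq:
  assumes "0 < q"
  shows "rho_power p q f = ennreal (2 * pi) * ennreal_powr (rho p q f) q"
  using assms unfolding rho_eq ennreal_powr_powr
  by (simp add: mult.assoc[symmetric] ennreal_mult'[symmetric])

lemma measurable_radial [measurable]:
  assumes [measurable]: "f \<in> borel_measurable borel"
  shows "radial p f \<in> borel_measurable borel"
  unfolding radial_def by measurable

lemma disc_holomorphic_measurable:
  assumes "f holomorphic_on ball 0 1" "\<And>z. z \<notin> ball 0 1 \<Longrightarrow> f z = 0"
  shows "f \<in> borel_measurable borel"
proof -
  have "(\<lambda>z. if z \<in> ball 0 1 then f z else 0) \<in> borel_measurable borel"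
    using assms by (intro borel_measurable_continuous_on_if) (auto simp: holomorphic_on_imp_continuous_on)
  also have "(\<lambda>z. if z \<in> ball 0 1 then f z else 0) = f"
    using assms(2) by (auto simp: fun_eq_iff)
  finally show ?thesis .
qed

lemma RM_measurable: "f \<in> RM p q \<Longrightarrow> f \<in> borel_measurable borel"
  by (rule disc_holomorphic_measurable) (auto simp: RM_def)

text \<open>The radii and the normalised circle both have total mass 1, so the supremum norm
  dominates with constant 1.\<close>

lemma rho_le_bound:
  assumes p: "0 < p" "0 < q" and M: "0 \<le> M" and f: "\<And>z. z \<in> ball 0 1 \<Longrightarrow> cmod (f z) \<le> M"
  shows "rho p q f \<le> ennreal M"
proof -
  have "radial p f t \<le> ennreal (M powr p)" for t
  proof -
    have "radial p f t \<le> (\<integral>\<^sup>+r\<in>{0..<1::real}. ennreal (M powr p) \<partial>lborel)"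
      unfolding radial_def using p
      by (intro nn_integral_mono) (auto simp: indicator_def norm_mult intro!: ennreal_leI powr_mono2 f)
    also have "\<dots> = ennreal (M powr p)" by (subst nn_integral_cmult_indicator) auto
    finally show ?thesis .
  qed
  then have "ennreal_powr (radial p f t) (q / p) \<le> ennreal (M powr q)" for t
    using ennreal_powr_mono[of "radial p f t" "ennreal (M powr p)" "q / p"] p by (simp add: powr_powr)
  then have "rho_power p q f \<le> (\<integral>\<^sup>+t\<in>{0..2 * pi}. ennreal (M powr q) \<partial>lborel)"
    unfolding rho_power_def by (intro nn_integral_mono mult_right_mono) auto
  also have "\<dots> = ennreal (2 * pi * M powr q)"
    by (subst nn_integral_cmult_indicator) (auto simp: ennreal_mult'[symmetric] mult.commute)
  finally have "ennreal (1 / (2 * pi)) * rho_power p q f \<le> ennreal (1 / (2 * pi)) * ennreal (2 * pi * M powr q)"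
    by (rule mult_left_mono) auto
  also have "\<dots> = ennreal (M powr q)" by (simp add: ennreal_mult'[symmetric])
  finally have "rho p q f \<le> ennreal_powr (ennreal (M powr q)) (1 / q)"
    unfolding rho_eq using p by (intro ennreal_powr_mono) auto
  then show ?thesis using p M by (simp add: powr_powr)
qed

lemma rho_scale:
  assumes p: "0 < p" "0 < q" and [measurable]: "f \<in> borel_measurable borel"
  shows "rho p q (\<lambda>z. c * f z) = ennreal (cmod c) * rho p q f"
proof -
  have "radial p (\<lambda>z. c * f z) t = ennreal (cmod c powr p) * radial p f t" for t
    unfolding radial_def by (subst nn_integral_cmult[symmetric]) (auto simp: norm_mult powr_mult ennreal_mult' mult.assoc)
  then have "rho_power p q (\<lambda>z. c * f z) = ennreal (cmod c powr q) * rho_power p q f"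
    unfolding rho_power_def using p
    by (subst nn_integral_cmult[symmetric]) (auto simp: ennreal_powr_mult powr_powr mult.assoc)
  then show ?thesis
    using p unfolding rho_eq by (simp add: ennreal_powr_mult powr_powr mult_ac)
qed

text \<open>The constant is harmless: the inequality serves to show that sums stay finite and to
  dominate differences with dilations.\<close>

lemma norm_add_powr_le:
  assumes "0 < p"
  shows "cmod (a + b) powr p \<le> 2 powr p * (cmod a powr p + cmod b powr p)"
proof -
  have "ennreal (cmod (a + b) powr p) \<le> ennreal_powr (ennreal (cmod a) + ennreal (cmod b)) p"
    using assms by (simp add: ennreal_plus[symmetric] ennreal_leI powr_mono2 norm_triangle_ineq del: ennreal_plus)
  also have "\<dots> \<le> ennreal (2 powr p) * (ennreal (cmod a powr p) + ennreal (cmod b powr p))"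
    using ennreal_powr_add_le[of p "ennreal (cmod a)" "ennreal (cmod b)"] assms by simp
  finally show ?thesis
    by (simp add: ennreal_plus[symmetric] ennreal_mult'[symmetric] del: ennreal_plus)
qed

lemma radial_add_le:
  assumes p: "0 < p" and [measurable]: "f \<in> borel_measurable borel" "g \<in> borel_measurable borel"
  shows "radial p (\<lambda>z. f z + g z) t \<le> ennreal (2 powr p) * (radial p f t + radial p g t)"
proof -
  have "radial p (\<lambda>z. f z + g z) t \<le> (\<integral>\<^sup>+r. ennreal (2 powr p) * (ennreal (cmod (f (of_real r * cis t)) powr p) * indicator {0..<1} r
      + ennreal (cmod (g (of_real r * cis t)) powr p) * indicator {0..<1} r) \<partial>lborel)"
    unfolding radial_def
  proof (rule nn_integral_mono)
    fix r :: real
    let ?z = "of_real r * cis t"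
    have "ennreal (cmod (f ?z + g ?z) powr p) \<le> ennreal (2 powr p) * (ennreal (cmod (f ?z) powr p) + ennreal (cmod (g ?z) powr p))"
      using norm_add_powr_le[OF p, of "f ?z" "g ?z"]
      by (simp add: ennreal_plus[symmetric] ennreal_mult'[symmetric] ennreal_leI del: ennreal_plus)
    then show "ennreal (cmod (f ?z + g ?z) powr p) * indicator {0..<1} r
       \<le> ennreal (2 powr p) * (ennreal (cmod (f ?z) powr p) * indicator {0..<1} r + ennreal (cmod (g ?z) powr p) * indicator {0..<1} r)"
      by (auto simp: indicator_def)
  qed
  also have "\<dots> = ennreal (2 powr p) * (radial p f t + radial p g t)"
    unfolding radial_def by (simp add: nn_integral_cmult nn_integral_add)
  finally show ?thesis .
qed

lemma rho_power_add_le: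
  assumes p: "0 < p" "0 < q" and [measurable]: "f \<in> borel_measurable borel" "g \<in> borel_measurable borel"
  shows "rho_power p q (\<lambda>z. f z + g z) \<le> ennreal (2 powr q * 2 powr (q / p)) * (rho_power p q f + rho_power p q g)"
proof -
  have le: "ennreal_powr (radial p (\<lambda>z. f z + g z) t) (q / p)
     \<le> ennreal (2 powr q * 2 powr (q / p)) * (ennreal_powr (radial p f t) (q / p) + ennreal_powr (radial p g t) (q / p))" for t
  proof -
    have "ennreal_powr (radial p (\<lambda>z. f z + g z) t) (q / p) \<le> ennreal_powr (ennreal (2 powr p) * (radial p f t + radial p g t)) (q / p)"
      using p by (intro ennreal_powr_mono radial_add_le) auto
    also have "\<dots> = ennreal (2 powr q) * ennreal_powr (radial p f t + radial p g t) (q / p)"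
      using p by (simp add: ennreal_powr_mult powr_powr)
    also have "\<dots> \<le> ennreal (2 powr q) * (ennreal (2 powr (q / p)) * (ennreal_powr (radial p f t) (q / p) + ennreal_powr (radial p g t) (q / p)))"
      using p by (intro mult_left_mono ennreal_powr_add_le) auto
    finally show ?thesis by (simp add: ennreal_mult' mult.assoc)
  qed
  have "rho_power p q (\<lambda>z. f z + g z) \<le> (\<integral>\<^sup>+t. ennreal (2 powr q * 2 powr (q / p)) * (ennreal_powr (radial p f t) (q / p) * indicator {0..2 * pi} t
      + ennreal_powr (radial p g t) (q / p) * indicator {0..2 * pi} t) \<partial>lborel)"
    unfolding rho_power_def using le by (intro nn_integral_mono) (auto simp: indicator_def)
  also have "\<dots> = ennreal (2 powr q * 2 powr (q / p)) * (rho_power p q f + rho_power p q g)"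
    unfolding rho_power_def by (simp add: nn_integral_cmult nn_integral_add)
  finally show ?thesis .
qed

lemma RM_add:
  assumes "0 < p" "0 < q" "f \<in> RM p q" "g \<in> RM p q"
  shows "(\<lambda>z. f z + g z) \<in> RM p q"
proof -
  have "rho_power p q (\<lambda>z. f z + g z) < top"
    using rho_power_add_le[of p q f g] assms RM_measurable[of f] RM_measurable[of g]
    by (auto simp: RM_def rho_less_top_iff ennreal_mult_less_top elim!: order_le_less_trans)
  then show ?thesis using assms by (auto simp: RM_def rho_less_top_iff intro!: holomorphic_intros)
qed

lemma RM_scale:
  assumes "0 < p" "0 < q" "f \<in> RM p q"
  shows "(\<lambda>z. c * f z) \<in> RM p q"
  using assms rho_scale[OF assms(1,2) RM_measurable[OF assms(3)]]
  by (auto simp: RM_def ennreal_mult_less_top intro!: holomorphic_intros)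

lemma RM_norm_scale:
  assumes "0 < p" "0 < q" "f \<in> RM p q"
  shows "RM_norm p q (\<lambda>z. c * f z) = cmod c * RM_norm p q f"
  using rho_scale[OF assms(1,2) RM_measurable[OF assms(3)]] by (simp add: RM_norm_def enn2real_mult)

section \<open>Polar coordinates and Hoelder's inequality for the pairing\<close>

definition polar :: "real \<times> real \<Rightarrow> complex" where
  "polar z = of_real (fst z) * cis (snd z)"

abbreviation polar_box :: "(real \<times> real) set" where
  "polar_box \<equiv> {0..<1} \<times> {0..2 * pi}"

lemma measurable_polar [measurable]: "polar \<in> borel_measurable (borel \<Otimes>\<^sub>M borel)"
  unfolding polar_def by measurable

lemma cmod_polar: "cmod (polar z) = \<bar>fst z\<bar>"
  by (simp add: polar_def norm_mult)

lemma polar_in_ball: "z \<in> polar_box \<Longrightarrow> cmod (polar z) < 1"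
  by (auto simp: cmod_polar)

lemma rho_power_reflect:
  assumes [measurable]: "g \<in> borel_measurable borel"
  shows "rho_power p q (\<lambda>z. g (cnj z)) = rho_power p q g"
proof -
  have "radial p (\<lambda>z. g (cnj z)) t = radial p g (2 * pi - t)" for t
  proof -
    have "cis (2 * pi - t) = cnj (cis t)" by (simp add: cis_cnj cis_divide[symmetric] divide_inverse)
    then show ?thesis unfolding radial_def by simp
  qed
  then have "rho_power p q (\<lambda>z. g (cnj z)) = (\<integral>\<^sup>+t. (\<lambda>t. ennreal_powr (radial p g t) (q / p) * indicator {0..2 * pi} t) (2 * pi - t) \<partial>lborel)"
    unfolding rho_power_def by (intro nn_integral_cong) (auto simp: indicator_def)
  also have "\<dots> = (\<integral>\<^sup>+t. ennreal_powr (radial p g t) (q / p) * indicator {0..2 * pi} t \<partial>lborel)"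
    by (rule nn_integral_reflect) measurable
  finally show ?thesis by (simp add: rho_power_def)
qed

text \<open>Hoelder's inequality along each ray, then in the angle. The conjugate reflects the
  angle, which leaves \<open>rho_power\<close> unchanged. The constant is
  \<open>(2 * pi) powr (1 / q) * (2 * pi) powr (1 / q')\<close>, from undoing the normalisation of
  both norms.\<close>

lemma rho_Hoelder:
  assumes p: "1 < p" "1 < q" and conj: "1 / p + 1 / p' = 1" "1 / q + 1 / q' = 1"
    and [measurable]: "f \<in> borel_measurable borel" "g \<in> borel_measurable borel"
  shows "(\<integral>\<^sup>+z\<in>polar_box. ennreal (cmod (f (polar z)) * cmod (g (cnj (polar z)))) \<partial>plane)
           \<le> ennreal (2 * pi) * (rho p q f * rho p' q' g)"
proof -
  have pp: "1 < p'" "1 < q'" using conjugate_exponent[OF p(1) conj(1)] conjugate_exponent[OF p(2) conj(2)] by auto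
  define h where "h = (\<lambda>z. g (cnj z))"
  have [measurable]: "h \<in> borel_measurable borel" unfolding h_def by measurable
  let ?U = "\<lambda>t r. ennreal (cmod (f (of_real r * cis t))) * indicator {0..<1} r"
  let ?V = "\<lambda>t r. ennreal (cmod (h (of_real r * cis t))) * indicator {0..<1} r"
  have inner: "(\<integral>\<^sup>+r. ?U t r * ?V t r \<partial>lborel) \<le> ennreal_powr (radial p f t) (1 / p) * ennreal_powr (radial p' h t) (1 / p')" for t
    using nn_integral_Hoelder[OF p(1) pp(1) conj(1), of "?U t" lborel "?V t"]
    by (simp add: radial_def ennreal_powr_mult)
  have "(\<integral>\<^sup>+z\<in>polar_box. ennreal (cmod (f (polar z)) * cmod (g (cnj (polar z)))) \<partial>plane)
      = (\<integral>\<^sup>+t. \<integral>\<^sup>+r. ennreal (cmod (f (polar (r, t))) * cmod (g (cnj (polar (r, t))))) * indicator polar_box (r, t) \<partial>lborel \<partial>lborel)"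
    by (subst lborel_pair.nn_integral_snd) auto
  also have "\<dots> = (\<integral>\<^sup>+t. (\<integral>\<^sup>+r. ?U t r * ?V t r \<partial>lborel) * indicator {0..2 * pi} t \<partial>lborel)"
    by (intro nn_integral_cong, subst nn_integral_multc[symmetric])
       (auto intro!: nn_integral_cong simp: polar_def h_def ennreal_mult indicator_def)
  also have "\<dots> \<le> (\<integral>\<^sup>+t. (ennreal_powr (radial p f t) (1 / p) * indicator {0..2 * pi} t) *
       (ennreal_powr (radial p' h t) (1 / p') * indicator {0..2 * pi} t) \<partial>lborel)"
  proof (rule nn_integral_mono)
    fix t
    show "(\<integral>\<^sup>+r. ?U t r * ?V t r \<partial>lborel) * indicator {0..2 * pi} t
      \<le> (ennreal_powr (radial p f t) (1 / p) * indicator {0..2 * pi} t) * (ennreal_powr (radial p' h t) (1 / p') * indicator {0..2 * pi} t)"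
    proof -
      have "indicator {0..2 * pi} t = (1 :: ennreal) \<or> indicator {0..2 * pi} t = (0 :: ennreal)"
        by (simp add: indicator_def)
      then show ?thesis
        using inner[of t] by (elim disjE) (simp_all only: mult_1_right mult_zero_right order_refl)
    qed
  qed
  also have "\<dots> \<le> ennreal_powr (\<integral>\<^sup>+t. ennreal_powr (ennreal_powr (radial p f t) (1 / p) * indicator {0..2 * pi} t) q \<partial>lborel) (1 / q)
     * ennreal_powr (\<integral>\<^sup>+t. ennreal_powr (ennreal_powr (radial p' h t) (1 / p') * indicator {0..2 * pi} t) q' \<partial>lborel) (1 / q')"
    by (rule nn_integral_Hoelder[OF p(2) pp(2) conj(2)]) measurable
  also have "\<dots> = ennreal_powr (rho_power p q f) (1 / q) * ennreal_powr (rho_power p' q' g) (1 / q')"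
    unfolding rho_power_reflect[of g p' q', folded h_def, OF \<open>g \<in> _\<close>, symmetric]
    by (simp add: ennreal_powr_mult ennreal_powr_powr rho_power_def)
  also have "\<dots> = ennreal ((2 * pi) powr (1 / q)) * ennreal ((2 * pi) powr (1 / q')) * (rho p q f * rho p' q' g)"
    using p pp by (simp add: rho_power_eq ennreal_powr_mult ennreal_powr_powr mult_ac)
  also have "ennreal ((2 * pi) powr (1 / q)) * ennreal ((2 * pi) powr (1 / q')) = ennreal (2 * pi)"
    by (simp add: ennreal_mult'[symmetric] powr_add[symmetric] conj)
  finally show ?thesis .
qed

section \<open>Dilations and their convergence in the mixed norm\<close>

lemma ennreal_powr_tendsto_0:
  assumes x: "(x \<longlongrightarrow> 0) F" and a: "0 < a"
  shows "((\<lambda>n. ennreal_powr (x n) a) \<longlongrightarrow> 0) F"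
proof -
  have "((\<lambda>n. enn2real (x n)) \<longlongrightarrow> 0) F"
    using tendsto_enn2real[of x 0 F] x by simp
  then have "((\<lambda>n. enn2real (x n) powr a) \<longlongrightarrow> 0) F"
    by (rule tendsto_zero_powrI[OF _ tendsto_const]) (use a in auto)
  then have "((\<lambda>n. ennreal (enn2real (x n) powr a)) \<longlongrightarrow> ennreal 0) F"
    by (rule tendsto_ennrealI)
  moreover have "\<forall>\<^sub>F n in F. x n < top"
    using x by (rule order_tendstoD) simp
  then have "\<forall>\<^sub>F n in F. ennreal (enn2real (x n) powr a) = ennreal_powr (x n) a"
    by eventually_elim (simp add: ennreal_powr_def)
  ultimately show ?thesis unfolding ennreal_0 by (rule Lim_transform_eventually)
qed

definition dilation :: "real \<Rightarrow> (complex \<Rightarrow> complex) \<Rightarrow> complex \<Rightarrow> complex" where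
  "dilation \<rho> f z = (if cmod z < 1 then f (of_real \<rho> * z) else 0)"

lemma dilation_measurable [measurable]:
  assumes [measurable]: "f \<in> borel_measurable borel"
  shows "dilation \<rho> f \<in> borel_measurable borel"
  unfolding dilation_def by measurable

text \<open>The substitution r = \<rho> s turns the ray into 0 \<le> s < 1 / \<rho>, of which the
  dilation uses only the part s < 1.\<close>

lemma radial_dilation_le:
  assumes [measurable]: "f \<in> borel_measurable borel" and \<rho>: "0 < \<rho>" "\<rho> < 1"
  shows "radial p (dilation \<rho> f) t \<le> ennreal (1 / \<rho>) * radial p f t"
proof -
  have "radial p f t = ennreal \<rho> * (\<integral>\<^sup>+s. ennreal (cmod (f (of_real (\<rho> * s) * cis t)) powr p) * indicator {0..<1} (\<rho> * s) \<partial>lborel)"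
    unfolding radial_def using \<rho>
    by (subst nn_integral_real_affine[of _ \<rho> 0]) auto
  then have "ennreal (1 / \<rho>) * radial p f t = (\<integral>\<^sup>+s. ennreal (cmod (f (of_real (\<rho> * s) * cis t)) powr p) * indicator {0..<1} (\<rho> * s) \<partial>lborel)"
    using \<rho> by (simp add: mult.assoc[symmetric] ennreal_mult'[symmetric])
  moreover have "radial p (dilation \<rho> f) t \<le> (\<integral>\<^sup>+s. ennreal (cmod (f (of_real (\<rho> * s) * cis t)) powr p) * indicator {0..<1} (\<rho> * s) \<partial>lborel)"
    unfolding radial_def
  proof (rule nn_integral_mono)
    fix s :: real
    have "\<rho> * s < 1" if "0 \<le> s" "s < 1" using that \<rho> mult_left_le_one_le[of s \<rho>] by linarith
    then show "ennreal (cmod (dilation \<rho> f (of_real s * cis t)) powr p) * indicator {0..<1} s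
      \<le> ennreal (cmod (f (of_real (\<rho> * s) * cis t)) powr p) * indicator {0..<1} (\<rho> * s)"
      using \<rho> by (auto simp: indicator_def dilation_def norm_mult mult.assoc)
  qed
  ultimately show ?thesis by simp
qed

text \<open>Scheffe's lemma, applied to the nonnegative functions
  \<open>2\<^sup>p (|f|\<^sup>p + |f\<^sub>n|\<^sup>p) - |f - f\<^sub>n|\<^sup>p\<close>, replaces a dominating function.\<close>

lemma radial_diff_dilation_tendsto_0:
  assumes p: "0 < p" and fm [measurable]: "f \<in> borel_measurable borel" and cont: "continuous_on (ball 0 1) f"
    and fin: "radial p f t < top"
    and \<rho>: "\<And>n. 0 < \<rho> n" "\<And>n. \<rho> n < 1" "\<rho> \<longlonglongrightarrow> 1"
  shows "(\<lambda>n. radial p (\<lambda>z. f z - dilation (\<rho> n) f z) t) \<longlonglongrightarrow> 0"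
proof -
  define v where "v = (\<lambda>s. cmod (f (of_real s * cis t)) powr p * indicator {0..<1} s)"
  define w where "w = (\<lambda>n s. cmod (dilation (\<rho> n) f (of_real s * cis t)) powr p * indicator {0..<1} s)"
  define e where "e = (\<lambda>n s. cmod (f (of_real s * cis t) - dilation (\<rho> n) f (of_real s * cis t)) powr p * indicator {0..<1} s)"
  define F where "F = (\<lambda>n s. 2 powr p * (v s + w n s) - e n s)"
  have [measurable]: "v \<in> borel_measurable borel" "\<And>n. w n \<in> borel_measurable borel" "\<And>n. e n \<in> borel_measurable borel"
    unfolding v_def w_def e_def by measurable
  have nn: "0 \<le> v s" "0 \<le> w n s" "0 \<le> e n s" for n s by (auto simp: v_def w_def e_def)
  have vi: "(\<integral>\<^sup>+s. ennreal (v s) \<partial>lborel) = radial p f t"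
    and wi: "(\<integral>\<^sup>+s. ennreal (w n s) \<partial>lborel) = radial p (dilation (\<rho> n) f) t"
    and ei: "(\<integral>\<^sup>+s. ennreal (e n s) \<partial>lborel) = radial p (\<lambda>z. f z - dilation (\<rho> n) f z) t" for n
    unfolding v_def w_def e_def radial_def by (auto intro!: nn_integral_cong simp: indicator_def)
  obtain I where I: "radial p f t = ennreal I" "0 \<le> I" using fin by (cases "radial p f t") auto
  have wle: "(\<integral>\<^sup>+s. ennreal (w n s) \<partial>lborel) \<le> ennreal (I / \<rho> n)" for n
    using radial_dilation_le[OF fm \<rho>(1)[of n] \<rho>(2)[of n], of p t] \<rho>(1)[of n] I
    by (simp add: wi ennreal_mult'[symmetric] less_imp_le)
  have eF: "e n s \<le> 2 powr p * (v s + w n s)" for n s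
  proof (cases "s \<in> {0..<1}")
    case True
    let ?a = "f (of_real s * cis t)" and ?b = "dilation (\<rho> n) f (of_real s * cis t)"
    have "cmod (?a - ?b) powr p \<le> 2 powr p * (cmod ?a powr p + cmod ?b powr p)"
      using norm_add_powr_le[OF p, of ?a "- ?b"] by simp
    then show ?thesis using True by (simp add: e_def v_def w_def)
  qed (simp add: e_def v_def w_def)
  have int: "integrable lborel v" "integrable lborel (w n)" for n
    using nn vi wle[of n] I by (auto intro!: integrableI_nonneg simp: wi elim!: order_le_less_trans)
  have inte: "integrable lborel (e n)" for n
    by (rule Bochner_Integration.integrable_bound[of _ "\<lambda>s. 2 powr p * (v s + w n s)"])
       (use int eF nn in \<open>auto intro!: AE_I2\<close>)
  have intF: "integrable lborel (F n)" for n unfolding F_def using int inte by auto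
  have F0: "0 \<le> F n s" for n s using eF by (simp add: F_def)
  have lim: "(\<lambda>n. F n s) \<longlonglongrightarrow> 2 powr p * (v s + v s)" for s
  proof (cases "s \<in> {0..<1}")
    case True
    have "(\<lambda>n. of_real (\<rho> n) * (of_real s * cis t)) \<longlonglongrightarrow> of_real 1 * (of_real s * cis t)"
      by (intro tendsto_intros \<rho>)
    moreover have "isCont f (of_real s * cis t)"
      using cont True by (intro continuous_on_interior[of "ball 0 1"]) (auto simp: norm_mult)
    ultimately have fl: "(\<lambda>n. f (of_real (\<rho> n) * (of_real s * cis t))) \<longlonglongrightarrow> f (of_real s * cis t)"
      by (intro isCont_tendsto_compose[of _ f]) auto
    have d: "dilation (\<rho> n) f (of_real s * cis t) = f (of_real (\<rho> n) * (of_real s * cis t))" for n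
      using True by (simp add: dilation_def norm_mult)
    have "(\<lambda>n. cmod (f (of_real s * cis t) - f (of_real (\<rho> n) * (of_real s * cis t))) powr p) \<longlonglongrightarrow> 0"
    proof (rule tendsto_zero_powrI[OF _ tendsto_const])
      show "(\<lambda>n. cmod (f (of_real s * cis t) - f (of_real (\<rho> n) * (of_real s * cis t)))) \<longlonglongrightarrow> 0"
        using tendsto_norm[OF tendsto_diff[OF tendsto_const[of "f (of_real s * cis t)"] fl]] by simp
    qed (use p in auto)
    moreover have "(\<lambda>n. cmod (f (of_real (\<rho> n) * (of_real s * cis t))) powr p) \<longlonglongrightarrow> cmod (f (of_real s * cis t)) powr p"
      using p by (intro tendsto_powr2[OF tendsto_norm[OF fl] tendsto_const]) auto
    ultimately have "(\<lambda>n. 2 powr p * (v s + cmod (f (of_real (\<rho> n) * (of_real s * cis t))) powr p)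
        - cmod (f (of_real s * cis t) - f (of_real (\<rho> n) * (of_real s * cis t))) powr p) \<longlonglongrightarrow> 2 powr p * (v s + cmod (f (of_real s * cis t)) powr p) - 0"
      by (intro tendsto_diff tendsto_mult tendsto_add tendsto_const)
    then show ?thesis using True by (simp add: F_def v_def w_def e_def d)
  qed (simp add: F_def e_def v_def w_def)
  have \<rho>I: "(\<lambda>n. I / \<rho> n) \<longlonglongrightarrow> I"
    using tendsto_divide[OF tendsto_const \<rho>(3), of I] by simp
  have intI: "(LINT s|lborel. v s) = I"
    using vi I nn int by (simp add: integral_eq_nn_integral)
  have wI: "(LINT s|lborel. w n s) \<le> I / \<rho> n" for n
    using wle[of n] nn int(2)[of n] \<rho>(1)[of n] I
    by (simp add: nn_integral_eq_integral)
  have "(\<lambda>n. \<integral>\<^sup>+s. norm (F n s - 2 powr p * (v s + v s)) \<partial>lborel) \<longlonglongrightarrow> 0"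
  proof (rule Scheffe_lemma1)
    have "(\<integral>\<^sup>+s. norm (F n s) \<partial>lborel) \<le> ennreal (2 powr p * (I + I / \<rho> n))" for n
    proof -
      have "(\<integral>\<^sup>+s. norm (F n s) \<partial>lborel) \<le> (\<integral>\<^sup>+s. ennreal (2 powr p * (v s + w n s)) \<partial>lborel)"
        using F0 nn by (intro nn_integral_mono) (auto simp: F_def intro!: ennreal_leI)
      also have "\<dots> = ennreal (LINT s|lborel. 2 powr p * (v s + w n s))"
        using int nn by (intro nn_integral_eq_integral) auto
      also have "\<dots> \<le> ennreal (2 powr p * (I + I / \<rho> n))"
        using int wI[of n] by (intro ennreal_leI) (simp add: intI)
      finally show ?thesis .
    qed
    then have "limsup (\<lambda>n. \<integral>\<^sup>+s. norm (F n s) \<partial>lborel) \<le> limsup (\<lambda>n. ennreal (2 powr p * (I + I / \<rho> n)))"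
      by (intro Limsup_mono always_eventually allI)
    also have "\<dots> = ennreal (2 powr p * (I + I))"
      by (intro lim_imp_Limsup tendsto_ennrealI tendsto_intros \<rho>I) simp
    also have "\<dots> = (\<integral>\<^sup>+s. norm (2 powr p * (v s + v s)) \<partial>lborel)"
      using int nn by (subst nn_integral_eq_integral) (auto simp: intI)
    finally show "limsup (\<lambda>n. \<integral>\<^sup>+s. norm (F n s) \<partial>lborel) \<le> (\<integral>\<^sup>+s. norm (2 powr p * (v s + v s)) \<partial>lborel)" .
  qed (use intF int lim in auto)
  then have "(\<lambda>n. LINT s|lborel. F n s) \<longlonglongrightarrow> (LINT s|lborel. 2 powr p * (v s + v s))"
    using int by (intro tendsto_L1_int[OF intF]) auto
  then have FI: "(\<lambda>n. LINT s|lborel. F n s) \<longlonglongrightarrow> 2 powr p * (I + I)"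
    using int by (simp add: intI)
  \<comment> \<open>The integral of \<open>e n\<close> is the amount by which that of
    \<open>F n\<close> falls short of \<open>2 powr p\<close> times the integral of \<open>v\<close>
    plus \<open>w n\<close>. Both quantities are now under control: the former converges, and the
    latter is at most a sequence with the same limit.\<close>
  have "(\<lambda>n. LINT s|lborel. e n s) \<longlonglongrightarrow> 0"
  proof (rule tendsto_sandwich[OF _ _ tendsto_const])
    show "\<forall>\<^sub>F n in sequentially. 0 \<le> (LINT s|lborel. e n s)" using nn by auto
    have "(LINT s|lborel. F n s) = 2 powr p * (I + (LINT s|lborel. w n s)) - (LINT s|lborel. e n s)" for n
      unfolding F_def using int inte by (simp add: intI)
    then show "\<forall>\<^sub>F n in sequentially. (LINT s|lborel. e n s) \<le> 2 powr p * (I + I / \<rho> n) - (LINT s|lborel. F n s)"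
      using wI by auto
    show "(\<lambda>n. 2 powr p * (I + I / \<rho> n) - (LINT s|lborel. F n s)) \<longlonglongrightarrow> 0"
      using tendsto_diff[OF tendsto_mult[OF tendsto_const tendsto_add[OF tendsto_const \<rho>I]] FI, of "2 powr p" I] by simp
  qed
  then have "(\<lambda>n. ennreal (LINT s|lborel. e n s)) \<longlonglongrightarrow> ennreal 0" by (rule tendsto_ennrealI)
  then show ?thesis
    unfolding ei[symmetric] using nn inte by (simp add: nn_integral_eq_integral)
qed

text \<open>On almost every ray \<open>radial p f t\<close> is finite and the radial convergence
  applies. In the angle dominated convergence works, because each difference is at most a multiple
  of \<open>radial p f t\<close>; the bound 1 / 2 \<le> \<rho> n makes that multiple independent of
  n.\<close>

lemma rho_diff_dilation_tendsto_0:
  assumes p: "0 < p" "0 < q" and f: "f \<in> RM p q"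
    and \<rho>: "\<And>n. 1 / 2 \<le> \<rho> n" "\<And>n. \<rho> n < 1" "\<rho> \<longlonglongrightarrow> 1"
  shows "(\<lambda>n. rho p q (\<lambda>z. f z - dilation (\<rho> n) f z)) \<longlonglongrightarrow> 0"
proof -
  have fm [measurable]: "f \<in> borel_measurable borel" by (rule RM_measurable[OF f])
  have \<rho>0: "0 < \<rho> n" for n using \<rho>(1)[of n] by simp
  have cont: "continuous_on (ball 0 1) f" using f by (auto simp: RM_def holomorphic_on_imp_continuous_on)
  have fin: "rho_power p q f < top" using f by (simp add: RM_def rho_less_top_iff)
  define D where "D = (\<lambda>n t. radial p (\<lambda>z. f z - dilation (\<rho> n) f z) t)"
  have [measurable]: "D n \<in> borel_measurable borel" for n unfolding D_def by measurable
  have D_le: "D n t \<le> ennreal (2 powr p * 3) * radial p f t" for n t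
  proof -
    have minus: "radial p (\<lambda>z. - h z) t = radial p h t" for h by (simp add: radial_def)
    have "D n t \<le> ennreal (2 powr p) * (radial p f t + radial p (dilation (\<rho> n) f) t)"
      unfolding D_def using radial_add_le[OF p(1) fm, of "\<lambda>z. - dilation (\<rho> n) f z" t] by (simp add: minus)
    also have "\<dots> \<le> ennreal (2 powr p) * (radial p f t + ennreal 2 * radial p f t)"
    proof (intro mult_left_mono add_left_mono)
      have "radial p (dilation (\<rho> n) f) t \<le> ennreal (1 / \<rho> n) * radial p f t"
        by (intro radial_dilation_le fm \<rho>0 \<rho>)
      also have "\<dots> \<le> ennreal 2 * radial p f t"
        using \<rho>(1)[of n] \<rho>0[of n] by (intro mult_right_mono ennreal_leI) (auto simp: field_simps)
      finally show "radial p (dilation (\<rho> n) f) t \<le> ennreal 2 * radial p f t" .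
    qed auto
    also have "radial p f t + ennreal 2 * radial p f t = ennreal 3 * radial p f t"
    proof -
      have "ennreal 3 = 1 + ennreal 2" by simp
      then show ?thesis by (simp only: distrib_right mult_1)
    qed
    finally show ?thesis by (simp add: ennreal_mult' mult.assoc)
  qed
  have "(\<lambda>n. \<integral>\<^sup>+t. ennreal_powr (D n t) (q / p) * indicator {0..2 * pi} t \<partial>lborel) \<longlonglongrightarrow> (\<integral>\<^sup>+t. 0 \<partial>(lborel :: real measure))"
  proof (rule nn_integral_dominated_convergence)
    show "AE t in lborel. ennreal_powr (D n t) (q / p) * indicator {0..2 * pi} t
        \<le> ennreal_powr (ennreal (2 powr p * 3) * radial p f t) (q / p) * indicator {0..2 * pi} t" for n
      using p by (intro AE_I2 mult_right_mono ennreal_powr_mono D_le) auto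
    have "(\<integral>\<^sup>+t. ennreal_powr (ennreal (2 powr p * 3) * radial p f t) (q / p) * indicator {0..2 * pi} t \<partial>lborel)
       = ennreal ((2 powr p * 3) powr (q / p)) * rho_power p q f"
      unfolding rho_power_def ennreal_powr_mult by (subst nn_integral_cmult[symmetric]) (auto simp: mult.assoc)
    then show "(\<integral>\<^sup>+t. ennreal_powr (ennreal (2 powr p * 3) * radial p f t) (q / p) * indicator {0..2 * pi} t \<partial>lborel) < \<infinity>"
      using fin by (simp add: ennreal_mult_less_top)
    have "AE t in lborel. ennreal_powr (radial p f t) (q / p) * indicator {0..2 * pi} t \<noteq> \<infinity>"
      using fin unfolding rho_power_def by (intro nn_integral_PInf_AE) auto
    then show "AE t in lborel. (\<lambda>n. ennreal_powr (D n t) (q / p) * indicator {0..2 * pi} t) \<longlonglongrightarrow> 0"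
    proof eventually_elim
      case (elim t)
      show ?case
      proof (cases "t \<in> {0..2 * pi}")
        case True
        then have "radial p f t < top" using elim by (auto simp: less_top)
        then have "(\<lambda>n. D n t) \<longlonglongrightarrow> 0"
          unfolding D_def by (intro radial_diff_dilation_tendsto_0 p fm cont \<rho> \<rho>0)
        then show ?thesis using True p by (simp add: ennreal_powr_tendsto_0)
      qed simp
    qed
  qed auto
  then have "(\<lambda>n. rho_power p q (\<lambda>z. f z - dilation (\<rho> n) f z)) \<longlonglongrightarrow> 0"
    by (simp add: rho_power_def D_def)
  then have "(\<lambda>n. ennreal (1 / (2 * pi)) * rho_power p q (\<lambda>z. f z - dilation (\<rho> n) f z)) \<longlonglongrightarrow> ennreal (1 / (2 * pi)) * 0"
    by (intro tendsto_mult_ennreal) auto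
  then show ?thesis unfolding rho_eq using p by (intro ennreal_powr_tendsto_0) auto
qed

section \<open>Duality\<close>

definition disc_monomial :: "nat \<Rightarrow> complex \<Rightarrow> complex" where
  "disc_monomial n z = (if cmod z < 1 then z ^ n else 0)"

definition disc_series :: "(nat \<Rightarrow> complex) \<Rightarrow> complex \<Rightarrow> complex" where
  "disc_series a z = (if cmod z < 1 then (\<Sum>n. a n * z ^ n) else 0)"

lemma disc_series_holomorphic:
  assumes "\<And>z. cmod z < 1 \<Longrightarrow> summable (\<lambda>n. a n * z ^ n)"
  shows "disc_series a holomorphic_on ball 0 1"
proof (rule power_series_holomorphic)
  fix w :: complex assume "w \<in> ball 0 1"
  then show "(\<lambda>n. a n * (w - 0) ^ n) sums disc_series a w"
    using assms[of w] by (simp add: disc_series_def summable_sums)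
qed

lemma summable_mult_power_le_one:
  fixes a :: "nat \<Rightarrow> complex"
  assumes "summable (\<lambda>n. cmod (a n))" "cmod z \<le> 1"
  shows "summable (\<lambda>n. cmod (a n * z ^ n))"
proof (rule summable_comparison_test'[OF assms(1)])
  show "norm (cmod (a n * z ^ n)) \<le> cmod (a n)" for n
    using assms(2) by (simp add: norm_mult norm_power mult_left_le power_le_one)
qed

lemma disc_series_norm_le:
  assumes "summable (\<lambda>n. cmod (a n))"
  shows "cmod (disc_series a z) \<le> (\<Sum>n. cmod (a n))"
proof (cases "cmod z < 1")
  case True
  have "cmod (\<Sum>n. a n * z ^ n) \<le> (\<Sum>n. cmod (a n * z ^ n))"
    using True by (intro summable_norm summable_mult_power_le_one assms) auto
  also have "\<dots> \<le> (\<Sum>n. cmod (a n))"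
    using True by (intro suminf_le summable_mult_power_le_one assms) (auto simp: norm_mult norm_power mult_left_le power_le_one)
  finally show ?thesis using True by (simp add: disc_series_def)
qed (use assms in \<open>simp add: disc_series_def suminf_nonneg\<close>)

lemma bounded_in_RM:
  assumes "0 < p" "0 < q" "f holomorphic_on ball 0 1" "\<And>z. 1 \<le> cmod z \<Longrightarrow> f z = 0" "\<And>z. cmod (f z) \<le> M"
  shows "f \<in> RM p q" "RM_norm p q f \<le> M"
proof -
  have M: "0 \<le> M" using assms(5)[of 0] norm_ge_zero order_trans by blast
  have le: "rho p q f \<le> ennreal M" by (rule rho_le_bound) (use assms M in auto)
  then show "f \<in> RM p q" using assms by (auto simp: RM_def intro: order_le_less_trans)
  show "RM_norm p q f \<le> M" unfolding RM_norm_def using enn2real_mono[OF le] M by simp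
qed

lemma disc_series_in_RM:
  assumes "0 < p" "0 < q" "summable (\<lambda>n. cmod (a n))"
  shows "disc_series a \<in> RM p q" "RM_norm p q (disc_series a) \<le> (\<Sum>n. cmod (a n))"
proof -
  have hol: "disc_series a holomorphic_on ball 0 1"
    by (intro disc_series_holomorphic summable_norm_cancel[OF summable_mult_power_le_one] assms) auto
  have zero: "disc_series a z = 0" if "1 \<le> cmod z" for z
    using that by (simp add: disc_series_def)
  show "disc_series a \<in> RM p q" "RM_norm p q (disc_series a) \<le> (\<Sum>n. cmod (a n))"
    using bounded_in_RM[OF assms(1,2) hol zero disc_series_norm_le[OF assms(3)]] by blast+
qed

lemma disc_monomial_in_RM:
  assumes "0 < p" "0 < q"
  shows "disc_monomial n \<in> RM p q" "RM_norm p q (disc_monomial n) \<le> 1"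
proof -
  have hol: "disc_monomial n holomorphic_on ball 0 1"
    by (rule holomorphic_transform[where f = "\<lambda>z. z ^ n"]) (auto simp: disc_monomial_def intro!: holomorphic_intros)
  have bound: "cmod (disc_monomial n z) \<le> 1" for z
    by (auto simp: disc_monomial_def norm_power power_le_one)
  have zero: "disc_monomial n z = 0" if "1 \<le> cmod z" for z
    using that by (simp add: disc_monomial_def)
  show "disc_monomial n \<in> RM p q" "RM_norm p q (disc_monomial n) \<le> 1"
    using bounded_in_RM[OF assms hol zero bound] by blast+
qed

lemma RM_zero: "0 < p \<Longrightarrow> 0 < q \<Longrightarrow> (\<lambda>_. 0) \<in> RM p q"
  using RM_scale[of p q "disc_monomial 0" 0] disc_monomial_in_RM(1)[of p q 0] by simp

lemma RM_norm_nonneg [simp]: "0 \<le> RM_norm p q f"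
  by (simp add: RM_norm_def)

lemma rho_eq_RM_norm: "f \<in> RM p q \<Longrightarrow> rho p q f = ennreal (RM_norm p q f)"
  by (simp add: RM_def RM_norm_def less_top)

abbreviation (input) RM_dual :: "real \<Rightarrow> real \<Rightarrow> ((complex \<Rightarrow> complex) \<Rightarrow> complex) set" where
  "RM_dual p q \<equiv> dual (RM p q) (RM_norm p q)"

abbreviation (input) RM_dual_norm :: "real \<Rightarrow> real \<Rightarrow> ((complex \<Rightarrow> complex) \<Rightarrow> complex) \<Rightarrow> real" where
  "RM_dual_norm p q \<equiv> dual_norm (RM p q) (RM_norm p q)"

lemma dual_add: "\<phi> \<in> dual V N \<Longrightarrow> f \<in> V \<Longrightarrow> g \<in> V \<Longrightarrow> \<phi> (\<lambda>x. f x + g x) = \<phi> f + \<phi> g"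
  and dual_scale: "\<phi> \<in> dual V N \<Longrightarrow> f \<in> V \<Longrightarrow> \<phi> (\<lambda>x. c * f x) = c * \<phi> f"
  and dual_outside: "\<phi> \<in> dual V N \<Longrightarrow> f \<notin> V \<Longrightarrow> \<phi> f = 0"
  by (auto simp: dual_def)

context
  fixes p q :: real and \<phi> :: "(complex \<Rightarrow> complex) \<Rightarrow> complex"
  assumes p: "1 < p" "1 < q" and \<phi>: "\<phi> \<in> RM_dual p q"
begin

lemma dual_bound_dual_norm:
  shows "f \<in> RM p q \<Longrightarrow> cmod (\<phi> f) \<le> RM_dual_norm p q \<phi> * RM_norm p q f"
    and "0 \<le> RM_dual_norm p q \<phi>"
proof -
  have p0: "0 < p" "0 < q" using p by auto
  obtain C where C: "\<And>f. f \<in> RM p q \<Longrightarrow> cmod (\<phi> f) \<le> C * RM_norm p q f"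
    using \<phi> unfolding dual_def by blast
  have bdd: "bdd_above ((\<lambda>f. cmod (\<phi> f)) ` {f \<in> RM p q. RM_norm p q f \<le> 1})"
  proof (rule bdd_aboveI2)
    fix f assume "f \<in> {f \<in> RM p q. RM_norm p q f \<le> 1}"
    then have "cmod (\<phi> f) \<le> C * RM_norm p q f" "RM_norm p q f \<le> 1"
      using C by auto
    moreover from this(2) have "C * RM_norm p q f \<le> \<bar>C\<bar> * 1"
      by (intro mult_mono) auto
    ultimately have "cmod (\<phi> f) \<le> \<bar>C\<bar> * 1" by linarith
    then show "cmod (\<phi> f) \<le> \<bar>C\<bar>" by simp
  qed
  have le: "cmod (\<phi> f) \<le> RM_dual_norm p q \<phi>" if "f \<in> RM p q" "RM_norm p q f \<le> 1" for f
    unfolding dual_norm_def using that by (intro cSUP_upper[OF _ bdd]) auto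
  show "0 \<le> RM_dual_norm p q \<phi>"
    using le[OF disc_monomial_in_RM[OF p0, of 0]] norm_ge_zero order_trans by blast
  show "cmod (\<phi> f) \<le> RM_dual_norm p q \<phi> * RM_norm p q f" if f: "f \<in> RM p q"
  \<comment> \<open>A function of norm 0 cannot be normalised; for it the constant from
    \<open>dual\<close> already forces the value 0.\<close>
  proof (cases "RM_norm p q f = 0")
    case True
    then show ?thesis using C[OF f] by simp
  next
    case False
    define c where "c = RM_norm p q f"
    have c: "c > 0" using False RM_norm_nonneg[of p q f] unfolding c_def by linarith
    have g: "(\<lambda>z. of_real (1 / c) * f z) \<in> RM p q" by (intro RM_scale p0 f)
    have "RM_norm p q (\<lambda>z. of_real (1 / c) * f z) \<le> 1"
      using c by (subst RM_norm_scale[OF p0 f]) (simp add: c_def norm_divide)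
    then have "cmod (\<phi> (\<lambda>z. of_real (1 / c) * f z)) \<le> RM_dual_norm p q \<phi>"
      by (rule le[OF g])
    then have "1 / c * cmod (\<phi> f) \<le> RM_dual_norm p q \<phi>"
      using c by (subst (asm) dual_scale[OF \<phi> f]) (simp add: norm_mult norm_divide)
    then show ?thesis using c by (simp add: c_def[symmetric] field_simps)
  qed
qed

lemma dual_monomial_bound: "cmod (\<phi> (disc_monomial n)) \<le> RM_dual_norm p q \<phi>"
proof -
  have "cmod (\<phi> (disc_monomial n)) \<le> RM_dual_norm p q \<phi> * RM_norm p q (disc_monomial n)"
    using p by (intro dual_bound_dual_norm disc_monomial_in_RM) auto
  also have "\<dots> \<le> RM_dual_norm p q \<phi> * 1"
    using p by (intro mult_left_mono disc_monomial_in_RM dual_bound_dual_norm) auto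
  finally show ?thesis by simp
qed

text \<open>Monomials have norm at most 1, so the tail of the series is controlled in norm by the
  tail of the sum of |a n|, and continuity lets \<open>\<phi>\<close> pass through the sum. The
  price is absolute summability up to the boundary, which dilations and images of compactly
  supported functions under the kernel satisfy.\<close>

lemma dual_disc_series_sums:
  assumes a: "summable (\<lambda>n. cmod (a n))"
  shows "(\<lambda>n. a n * \<phi> (disc_monomial n)) sums \<phi> (disc_series a)"
proof -
  have p0: "0 < p" "0 < q" using p by auto
  define D where "D = RM_dual_norm p q \<phi>"
  define S where "S = (\<lambda>N z. \<Sum>n<N. a n * disc_monomial n z)"
  have S: "S N \<in> RM p q \<and> \<phi> (S N) = (\<Sum>n<N. a n * \<phi> (disc_monomial n))" for N
  proof (induction N)
    case 0
    have "\<phi> (\<lambda>_. 0) = 0" using dual_scale[OF \<phi> RM_zero[OF p0], of 0] by simp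
    then show ?case using RM_zero[OF p0] by (simp add: S_def)
  next
    case (Suc N)
    have m: "(\<lambda>z. a N * disc_monomial N z) \<in> RM p q" by (intro RM_scale p0 disc_monomial_in_RM)
    have e: "S (Suc N) = (\<lambda>z. S N z + a N * disc_monomial N z)" by (simp add: S_def fun_eq_iff)
    show ?case
      unfolding e using Suc RM_add[OF p0 _ m] dual_add[OF \<phi> _ m] dual_scale[OF \<phi> disc_monomial_in_RM(1)[OF p0]]
      by simp
  qed
  define b where "b = (\<lambda>N n. if n < N then 0 else a n)"
  have b: "summable (\<lambda>n. cmod (b N n))" for N
    by (rule summable_comparison_test'[OF a]) (auto simp: b_def)
  have bsum: "(\<Sum>n. cmod (b N n)) = (\<Sum>n. cmod (a (n + N)))" for N
  proof -
    have "(\<Sum>n. cmod (b N n)) = (\<Sum>n. cmod (b N (n + N))) + (\<Sum>n<N. cmod (b N n))"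
      by (rule suminf_split_initial_segment[OF b])
    then show ?thesis by (simp add: b_def)
  qed
  have split: "disc_series a = (\<lambda>z. S N z + disc_series (b N) z)" for N
  proof
    fix z
    show "disc_series a z = S N z + disc_series (b N) z"
    proof (cases "cmod z < 1")
      case True
      have sa: "summable (\<lambda>n. a n * z ^ n)" and sb: "summable (\<lambda>n. b N n * z ^ n)"
        using True by (auto intro!: summable_norm_cancel[OF summable_mult_power_le_one] a b)
      have "(\<Sum>n. a n * z ^ n) = (\<Sum>n. a (n + N) * z ^ (n + N)) + (\<Sum>n<N. a n * z ^ n)"
        by (rule suminf_split_initial_segment[OF sa])
      moreover have "(\<Sum>n. b N n * z ^ n) = (\<Sum>n. b N (n + N) * z ^ (n + N)) + (\<Sum>n<N. b N n * z ^ n)"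
        by (rule suminf_split_initial_segment[OF sb])
      ultimately show ?thesis using True by (simp add: disc_series_def S_def disc_monomial_def b_def)
    qed (simp add: disc_series_def S_def disc_monomial_def)
  qed
  have "norm (\<phi> (disc_series a) - (\<Sum>n<N. a n * \<phi> (disc_monomial n))) \<le> D * (\<Sum>n. cmod (a (n + N)))" for N
  proof -
    have "\<phi> (disc_series a) = \<phi> (S N) + \<phi> (disc_series (b N))"
      by (subst split[of N], rule dual_add[OF \<phi>]) (use S disc_series_in_RM(1)[OF p0 b] in auto)
    then have "norm (\<phi> (disc_series a) - (\<Sum>n<N. a n * \<phi> (disc_monomial n))) = cmod (\<phi> (disc_series (b N)))"
      using S by simp
    also have "\<dots> \<le> D * RM_norm p q (disc_series (b N))"
      unfolding D_def by (intro dual_bound_dual_norm disc_series_in_RM p0 b)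
    also have "\<dots> \<le> D * (\<Sum>n. cmod (b N n))"
      unfolding D_def by (intro mult_left_mono disc_series_in_RM p0 b dual_bound_dual_norm)
    finally show ?thesis by (simp add: bsum)
  qed
  note le = this
  have "(\<lambda>N. \<Sum>n. cmod (a (n + N))) \<longlonglongrightarrow> 0"
    using suminf_exist_split2[OF a] by simp
  then have lim: "(\<lambda>N. D * (\<Sum>n. cmod (a (n + N)))) \<longlonglongrightarrow> 0"
    by (rule tendsto_mult_right_zero)
  have "(\<lambda>N. \<phi> (disc_series a) - (\<Sum>n<N. a n * \<phi> (disc_monomial n))) \<longlonglongrightarrow> 0"
    by (rule Lim_null_comparison[OF always_eventually[OF allI[OF le]] lim])
  then have "(\<lambda>N. \<phi> (disc_series a) - (\<phi> (disc_series a) - (\<Sum>n<N. a n * \<phi> (disc_monomial n)))) \<longlonglongrightarrow> \<phi> (disc_series a) - 0"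
    by (intro tendsto_diff tendsto_const)
  then show ?thesis by (simp add: sums_def)
qed

end

section \<open>Moments, exhaustion by smaller discs, and finiteness of profiles\<close>

lemma polar_power_integrable:
  fixes h :: "real \<times> real \<Rightarrow> complex"
  assumes h: "integrable plane h" and R: "0 \<le> R" and supp: "\<And>z. h z \<noteq> 0 \<Longrightarrow> \<bar>fst z\<bar> \<le> R"
  shows "integrable plane (\<lambda>z. polar z ^ n * h z)" "norm (LINT z|plane. polar z ^ n * h z) \<le> R ^ n * (LINT z|plane. norm (h z))"
    "(LINT z|plane. norm (polar z ^ n * h z)) \<le> R ^ n * (LINT z|plane. norm (h z))"
proof -
  have [measurable]: "h \<in> borel_measurable plane" using h by auto
  have le: "norm (polar z ^ n * h z) \<le> R ^ n * norm (h z)" for z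
    using supp[of z] R by (cases "h z = 0") (auto simp: norm_mult norm_power cmod_polar intro!: mult_right_mono power_mono)
  have i: "integrable plane (\<lambda>z. R ^ n * norm (h z))" using h by auto
  show int: "integrable plane (\<lambda>z. polar z ^ n * h z)"
    by (rule Bochner_Integration.integrable_bound[OF i]) (use le R in \<open>auto intro!: AE_I2\<close>)
  have "(LINT z|plane. norm (polar z ^ n * h z)) \<le> (LINT z|plane. R ^ n * norm (h z))"
    by (rule integral_mono) (use int i le in auto)
  then show n: "(LINT z|plane. norm (polar z ^ n * h z)) \<le> R ^ n * (LINT z|plane. norm (h z))" by simp
  show "norm (LINT z|plane. polar z ^ n * h z) \<le> R ^ n * (LINT z|plane. norm (h z))"
    by (rule order_trans[OF integral_norm_bound n])
qed

text \<open>Sum and integral may be exchanged because the n-th moment is at most R^n times the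
  integral of |h|. Two regimes occur later: R < 1 with coefficients growing at most linearly, and R
  = 1 with absolutely summable coefficients.\<close>

lemma polar_series_sums:
  fixes h :: "real \<times> real \<Rightarrow> complex"
  assumes h: "integrable plane h" and R: "0 \<le> R" and supp: "\<And>z. h z \<noteq> 0 \<Longrightarrow> \<bar>fst z\<bar> \<le> R"
    and c: "summable (\<lambda>n. cmod (c n) * R ^ n)"
  shows "(\<lambda>n. c n * (LINT z|plane. polar z ^ n * h z)) sums (LINT z|plane. (\<Sum>n. c n * polar z ^ n) * h z)"
proof -
  note moment = polar_power_integrable[OF h R supp]
  have "(\<lambda>n. LINT z|plane. c n * (polar z ^ n * h z)) sums (LINT z|plane. (\<Sum>n. c n * (polar z ^ n * h z)))"
  proof (rule sums_integral)
    show "integrable plane (\<lambda>z. c n * (polar z ^ n * h z))" for n using moment(1) by auto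
    show "AE z in plane. summable (\<lambda>n. norm (c n * (polar z ^ n * h z)))"
    proof (rule AE_I2)
      fix z
      show "summable (\<lambda>n. norm (c n * (polar z ^ n * h z)))"
      proof (cases "h z = 0")
        case False
        have "summable (\<lambda>n. cmod (c n) * R ^ n * norm (h z))" using c by (rule summable_mult2)
        then show ?thesis
        proof (rule summable_comparison_test')
          fix n
          have "\<bar>fst z\<bar> ^ n \<le> R ^ n" using supp[OF False] by (intro power_mono) auto
          then show "norm (norm (c n * (polar z ^ n * h z))) \<le> cmod (c n) * R ^ n * norm (h z)"
            by (auto simp: norm_mult norm_power cmod_polar mult.assoc intro!: mult_left_mono mult_right_mono)
        qed
      qed simp
    qed
    have "summable (\<lambda>n. cmod (c n) * R ^ n * (LINT z|plane. norm (h z)))" using c by (rule summable_mult2)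
    then show "summable (\<lambda>n. LINT z|plane. norm (c n * (polar z ^ n * h z)))"
    proof (rule summable_comparison_test')
      fix n
      have "(LINT z|plane. norm (c n * (polar z ^ n * h z))) = cmod (c n) * (LINT z|plane. norm (polar z ^ n * h z))"
        by (simp add: norm_mult)
      also have "\<dots> \<le> cmod (c n) * (R ^ n * (LINT z|plane. norm (h z)))"
        by (intro mult_left_mono moment) auto
      finally show "norm (LINT z|plane. norm (c n * (polar z ^ n * h z))) \<le> cmod (c n) * R ^ n * (LINT z|plane. norm (h z))"
        by (simp add: mult.assoc)
    qed
  qed
  moreover have "(\<Sum>n. c n * (polar z ^ n * h z)) = (\<Sum>n. c n * polar z ^ n) * h z" for z
  proof (cases "h z = 0")
    case False
    have "summable (\<lambda>n. c n * polar z ^ n)"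
    proof (rule summable_norm_cancel, rule summable_comparison_test'[OF c])
      fix n
      show "norm (norm (c n * polar z ^ n)) \<le> cmod (c n) * R ^ n"
        using supp[OF False] by (auto simp: norm_mult norm_power cmod_polar intro!: mult_left_mono power_mono)
    qed
    then show ?thesis by (simp add: suminf_mult2 mult.assoc)
  qed simp
  ultimately show ?thesis using moment(1) by simp
qed

text \<open>The power a is an order isomorphism with inverse the power 1 / a, so it preserves
  suprema.\<close>

lemma ennreal_powr_SUP:
  assumes "0 < a"
  shows "ennreal_powr (SUP n\<in>A. X n) a = (SUP n\<in>A. ennreal_powr (X n) a)"
proof (rule antisym)
  have "X n \<le> ennreal_powr (SUP n\<in>A. ennreal_powr (X n) a) (1 / a)" if "n \<in> A" for n
  proof -
    have "X n = ennreal_powr (ennreal_powr (X n) a) (1 / a)"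
      using assms by (simp add: ennreal_powr_powr)
    also have "\<dots> \<le> ennreal_powr (SUP n\<in>A. ennreal_powr (X n) a) (1 / a)"
      using assms that by (intro ennreal_powr_mono SUP_upper) auto
    finally show ?thesis .
  qed
  then have "ennreal_powr (SUP n\<in>A. X n) a \<le> ennreal_powr (ennreal_powr (SUP n\<in>A. ennreal_powr (X n) a) (1 / a)) a"
    using assms by (intro ennreal_powr_mono SUP_least) auto
  then show "ennreal_powr (SUP n\<in>A. X n) a \<le> (SUP n\<in>A. ennreal_powr (X n) a)"
    using assms by (simp add: ennreal_powr_powr)
  show "(SUP n\<in>A. ennreal_powr (X n) a) \<le> ennreal_powr (SUP n\<in>A. X n) a"
    using assms by (intro SUP_least ennreal_powr_mono SUP_upper) auto
qed

text \<open>Monotone convergence in the radius and, after the increasing power q / p, once more in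
  the angle. It turns estimates uniform in R into finiteness of the norm.\<close>

lemma rho_power_le_of_truncations:
  assumes p: "0 < p" "0 < q" and [measurable]: "f \<in> borel_measurable borel"
    and le: "\<And>R. 0 < R \<Longrightarrow> R < 1 \<Longrightarrow>
      (\<integral>\<^sup>+t\<in>{0..2 * pi}. ennreal_powr (\<integral>\<^sup>+r\<in>{0..R}. ennreal (cmod (f (polar (r, t))) powr p) \<partial>lborel) (q / p) \<partial>lborel) \<le> B"
  shows "rho_power p q f \<le> B"
proof -
  define R where "R = (\<lambda>n. 1 - 1 / (real n + 2))"
  have R: "0 < R n" "R n < 1" for n by (auto simp: R_def field_simps)
  have inc: "R m \<le> R n" if "m \<le> n" for m n using that by (auto simp: R_def intro!: divide_left_mono)
  have ex: "\<exists>n. r \<le> R n" if "r < 1" for r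
  proof -
    obtain n where "1 / (1 - r) < real n" using reals_Archimedean2 by blast
    then have "r \<le> R n" using that by (simp add: R_def field_simps)
    then show ?thesis ..
  qed
  define X where "X = (\<lambda>n t. \<integral>\<^sup>+r\<in>{0..R n}. ennreal (cmod (f (polar (r, t))) powr p) \<partial>lborel)"
  have [measurable]: "X n \<in> borel_measurable borel" for n unfolding X_def by measurable
  have incX: "incseq (\<lambda>n r. ennreal (cmod (f (polar (r, t))) powr p) * indicator {0..R n} r)" for t
    using inc by (auto simp: incseq_def le_fun_def indicator_def intro: order_trans)
  have X_mono: "X m t \<le> X n t" if "m \<le> n" for m n t
    unfolding X_def using incX[of t] that by (intro nn_integral_mono) (auto simp: incseq_def le_fun_def)
  have "radial p f t = (\<integral>\<^sup>+r. (SUP n. ennreal (cmod (f (polar (r, t))) powr p) * indicator {0..R n} r) \<partial>lborel)" for t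
    unfolding radial_def
  proof (rule nn_integral_cong)
    fix r
    have "(SUP n. indicator {0..R n} r) = (indicator {0..<1} r :: ennreal)"
    proof (rule SUP_eqI)
      show "indicator {0..R n} r \<le> (indicator {0..<1} r :: ennreal)" for n
        using R[of n] by (auto simp: indicator_def)
      show "(indicator {0..<1} r :: ennreal) \<le> y" if "\<And>n. n \<in> UNIV \<Longrightarrow> indicator {0..R n} r \<le> y" for y
      proof (cases "r \<in> {0..<1}")
        case True
        then obtain n where "r \<le> R n" using ex by auto
        then show ?thesis using that[of n] True by simp
      qed simp
    qed
    then show "ennreal (cmod (f (of_real r * cis t)) powr p) * indicator {0..<1} r =
       (SUP n. ennreal (cmod (f (polar (r, t))) powr p) * indicator {0..R n} r)"
      by (simp add: SUP_mult_left_ennreal[symmetric] polar_def)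
  qed
  then have rad: "radial p f t = (SUP n. X n t)" for t
    unfolding X_def by (subst nn_integral_monotone_convergence_SUP[symmetric, OF incX]) auto
  have "rho_power p q f = (\<integral>\<^sup>+t. (SUP n. ennreal_powr (X n t) (q / p) * indicator {0..2 * pi} t) \<partial>lborel)"
    unfolding rho_power_def rad using p by (simp add: ennreal_powr_SUP SUP_mult_right_ennreal)
  also have "\<dots> = (SUP n. \<integral>\<^sup>+t. ennreal_powr (X n t) (q / p) * indicator {0..2 * pi} t \<partial>lborel)"
    using p X_mono by (intro nn_integral_monotone_convergence_SUP)
      (auto simp: incseq_def le_fun_def intro!: mult_right_mono ennreal_powr_mono)
  also have "\<dots> \<le> B"
    unfolding X_def by (intro SUP_least le R)
  finally show ?thesis .
qed

text \<open>The radii in the box have total length 1, so the integral along a ray is at most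
  \<open>M powr p\<close> and may be replaced by a real number.\<close>

lemma bounded_box_profile:
  assumes [measurable]: "\<Phi> \<in> borel_measurable plane" and \<Phi>: "\<And>z. 0 \<le> \<Phi> z" "\<And>z. \<Phi> z \<le> M" "in_box \<Phi>" and p: "0 < p"
  obtains A where "A \<in> borel_measurable borel" "\<And>t. 0 \<le> A t" "\<And>t. A t \<le> M powr p"
    "\<And>t. (ray_integral p \<Phi> t) = ennreal (A t)" "\<And>t. t \<notin> {0..2 * pi} \<Longrightarrow> A t = 0"
proof -
  define A where "A = (\<lambda>t. enn2real (ray_integral p \<Phi> t))"
  have le: "(ray_integral p \<Phi> t) \<le> ennreal (M powr p)" for t
  proof -
    have "(ray_integral p \<Phi> t) \<le> (\<integral>\<^sup>+r. ennreal (M powr p) * indicator {0..<1::real} r \<partial>lborel)"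
    proof (rule nn_integral_mono)
      fix r :: real
      show "ennreal (\<Phi> (r, t) powr p) \<le> ennreal (M powr p) * indicator {0..<1} r"
      proof (cases "r \<in> {0..<1}")
        case True
        then show ?thesis using \<Phi> p by (auto intro!: ennreal_leI powr_mono2)
      next
        case False
        then have "\<Phi> (r, t) = 0" using \<Phi>(3) unfolding in_box_def by auto
        then show ?thesis by simp
      qed
    qed
    also have "\<dots> = ennreal (M powr p)" by (subst nn_integral_cmult_indicator) auto
    finally show ?thesis .
  qed
  have eq: "(ray_integral p \<Phi> t) = ennreal (A t)" for t
    unfolding A_def using le_less_trans[OF le[of t]] by (simp add: less_top)
  show thesis
  proof (rule that[OF _ _ _ eq])
    show "A \<in> borel_measurable borel" unfolding A_def by measurable
    show "0 \<le> A t" for t by (simp add: A_def)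
    show "A t \<le> M powr p" for t using le[of t] unfolding eq by (simp add: A_def)
    show "A t = 0" if "t \<notin> {0..2 * pi}" for t
    proof -
      have "\<Phi> (r, t) = 0" for r using \<Phi>(3) that unfolding in_box_def by (metis mem_Sigma_iff)
      then show ?thesis by (simp add: A_def)
    qed
  qed
qed

lemma profile_power_finite:
  fixes A :: "real \<Rightarrow> real"
  assumes "\<And>t. 0 \<le> A t" "\<And>t. A t \<le> B" "\<And>t. t \<notin> {0..2 * pi} \<Longrightarrow> A t = 0" "0 < s"
  obtains N where "(power_integral A s) = ennreal N" "0 \<le> N"
proof -
  have "(power_integral A s) \<le> (\<integral>\<^sup>+t. ennreal (B powr s) * indicator {0..2 * pi} t \<partial>lborel)"
    using assms by (intro nn_integral_mono) (auto simp: indicator_def intro!: ennreal_leI powr_mono2)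
  also have "\<dots> < \<infinity>" by (subst nn_integral_cmult_indicator) (auto simp: ennreal_mult_less_top)
  finally show thesis using that by (cases "\<integral>\<^sup>+t. ennreal (A t powr s) \<partial>lborel") auto
qed

lemma summable_Suc_power:
  fixes R :: real
  assumes "0 \<le> R" "R < 1"
  shows "summable (\<lambda>n. of_nat (Suc n) * R ^ n)"
  using geometric_deriv_sums[of R] assms by (auto simp: sums_iff)

text \<open>On the box F \<le> 1 + F^p, the integrals of F^p along rays are bounded, and the angles
  form a bounded interval.\<close>

lemma integrable_of_profile:
  fixes h :: "real \<times> real \<Rightarrow> complex"
  assumes p: "1 < p" and F: "radial_profile p F \<alpha>" "in_box F" and \<alpha>: "\<And>t. t \<notin> {0..2 * pi} \<Longrightarrow> \<alpha> t = 0"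
    and h [measurable]: "h \<in> borel_measurable plane" and hF: "\<And>z. norm (h z) \<le> F z"
  shows "integrable plane h"
proof (rule integrableI_bounded[OF h])
  have [measurable]: "F \<in> borel_measurable plane" and F0: "\<And>z. 0 \<le> F z"
    and Fi: "\<And>t. (ray_integral p F t) = ennreal (\<alpha> t)"
    and Fz: "\<And>r t. \<alpha> t = 0 \<Longrightarrow> F (r, t) = 0"
    using F(1) by (auto simp: radial_profile_def)
  obtain B where B: "\<And>t. \<alpha> t \<le> B" using F(1) by (auto simp: radial_profile_def)
  have inner: "(\<integral>\<^sup>+r. ennreal (F (r, t)) \<partial>lborel) \<le> (1 + ennreal B) * indicator {0..2 * pi} t" for t
  proof (cases "t \<in> {0..2 * pi}")
    case True
    have "(\<integral>\<^sup>+r. ennreal (F (r, t)) \<partial>lborel) \<le> (\<integral>\<^sup>+r. indicator {0..<1} r + ennreal (F (r, t) powr p) \<partial>lborel)"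
    proof (rule nn_integral_mono)
      fix r :: real
      show "ennreal (F (r, t)) \<le> indicator {0..<1} r + ennreal (F (r, t) powr p)"
      proof (cases "r \<in> {0..<1}")
        case r: True
        have "F (r, t) \<le> 1 + F (r, t) powr p"
        proof (cases "F (r, t) \<le> 1")
          case False
          then have "F (r, t) powr 1 \<le> F (r, t) powr p" using p by (intro powr_mono) auto
          then show ?thesis using False by simp
        qed (simp add: add_increasing2)
        then have "ennreal (F (r, t)) \<le> ennreal (1 + F (r, t) powr p)" by (rule ennreal_leI)
        then show ?thesis using r by simp
      next
        case False
        then have "F (r, t) = 0" using F(2) unfolding in_box_def by auto
        then show ?thesis by simp
      qed
    qed
    also have "\<dots> = 1 + ennreal (\<alpha> t)" by (subst nn_integral_add) (auto simp: Fi)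
    also have "\<dots> \<le> 1 + ennreal B" by (intro add_left_mono ennreal_leI B)
    finally show ?thesis using True by simp
  next
    case False
    then have "F (r, t) = 0" for r using Fz \<alpha> by simp
    then show ?thesis by simp
  qed
  have "(\<integral>\<^sup>+z. ennreal (norm (h z)) \<partial>plane) \<le> (\<integral>\<^sup>+z. ennreal (F z) \<partial>plane)"
    by (intro nn_integral_mono ennreal_leI hF)
  also have "\<dots> = (\<integral>\<^sup>+t. \<integral>\<^sup>+r. ennreal (F (r, t)) \<partial>lborel \<partial>lborel)"
    by (subst lborel_pair.nn_integral_snd) auto
  also have "\<dots> \<le> (\<integral>\<^sup>+t. (1 + ennreal B) * indicator {0..2 * pi} t \<partial>lborel)"
    by (intro nn_integral_mono inner)
  also have "\<dots> < \<infinity>" by (subst nn_integral_cmult_indicator) (auto simp: ennreal_mult_less_top)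
  finally show "(\<integral>\<^sup>+z. ennreal (norm (h z)) \<partial>plane) < \<infinity>" .
qed

section \<open>The norm of the representing function is bounded by that of the functional\<close>

text \<open>The factor n + 1 cancels the value 1 / (n + 1) of the integral of |z|^(2n) against
  normalised area, so pairing z^n with the resulting series returns
  \<open>\<phi> (disc_monomial n)\<close>.\<close>

definition dual_coeff :: "((complex \<Rightarrow> complex) \<Rightarrow> complex) \<Rightarrow> nat \<Rightarrow> complex" where
  "dual_coeff \<phi> n = of_nat (Suc n) * \<phi> (disc_monomial n)"

lemma dual_coeff_bound:
  assumes "1 < p" "1 < q" "\<phi> \<in> RM_dual p q"
  shows "cmod (dual_coeff \<phi> n) \<le> of_nat (Suc n) * RM_dual_norm p q \<phi>"
  unfolding dual_coeff_def norm_mult norm_of_nat by (intro mult_left_mono dual_monomial_bound assms) auto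

lemma dual_coeff_summable:
  assumes "1 < p" "1 < q" "\<phi> \<in> RM_dual p q" and R: "0 \<le> R" "R < 1"
  shows "summable (\<lambda>n. cmod (dual_coeff \<phi> n) * R ^ n)"
proof (rule summable_comparison_test')
  show "summable (\<lambda>n. of_nat (Suc n) * R ^ n * RM_dual_norm p q \<phi>)"
    by (intro summable_mult2 summable_Suc_power R)
  show "norm (cmod (dual_coeff \<phi> n) * R ^ n) \<le> of_nat (Suc n) * R ^ n * RM_dual_norm p q \<phi>" for n
    using mult_right_mono[OF dual_coeff_bound[OF assms(1-3), of n], of "R ^ n"] R by (simp add: mult_ac abs_mult)
qed

lemma dual_coeff_summable':
  assumes "1 < p" "1 < q" "\<phi> \<in> RM_dual p q" and z: "cmod z < 1"
  shows "summable (\<lambda>n. dual_coeff \<phi> n * z ^ n)"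
  using dual_coeff_summable[OF assms(1-3), of "cmod z"] z
  by (intro summable_norm_cancel[of "\<lambda>n. dual_coeff \<phi> n * z ^ n"]) (simp add: norm_mult norm_power)

lemma dual_series_holomorphic:
  assumes "1 < p" "1 < q" "\<phi> \<in> RM_dual p q"
  shows "disc_series (dual_coeff \<phi>) holomorphic_on ball 0 1"
  by (rule disc_series_holomorphic[OF dual_coeff_summable'[OF assms]])

lemma dual_series_norm_le:
  assumes "1 < p" "1 < q" "\<phi> \<in> RM_dual p q" and R: "R < 1" "cmod z \<le> R"
  shows "cmod (disc_series (dual_coeff \<phi>) z) \<le> (\<Sum>n. cmod (dual_coeff \<phi> n) * R ^ n)"
proof -
  have R0: "0 \<le> R" using R norm_ge_zero order_trans by blast
  note sR = dual_coeff_summable[OF assms(1-3) R0 R(1)]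
  have le: "cmod (dual_coeff \<phi> n * z ^ n) \<le> cmod (dual_coeff \<phi> n) * R ^ n" for n
    using R by (auto simp: norm_mult norm_power intro!: mult_left_mono power_mono)
  have sz: "summable (\<lambda>n. cmod (dual_coeff \<phi> n * z ^ n))"
    by (rule summable_comparison_test'[OF sR]) (use le in auto)
  have "cmod (\<Sum>n. dual_coeff \<phi> n * z ^ n) \<le> (\<Sum>n. cmod (dual_coeff \<phi> n * z ^ n))"
    by (rule summable_norm[OF sz])
  also have "\<dots> \<le> (\<Sum>n. cmod (dual_coeff \<phi> n) * R ^ n)"
    by (intro suminf_le le sz sR)
  finally show ?thesis using R by (simp add: disc_series_def)
qed

text \<open>Let N be the integral of \<open>H powr (q' / p')\<close>, the q'-th power of the norm of
  the truncated \<open>g\<close> up to 1 / (2 pi). The test function gives N = \<phi>(P), and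
  |\<phi>(P)| is at most D times the norm of P, hence at most \<open>D * C * N powr (1 / q)\<close>.
  Cancelling leaves \<open>N powr (1 / q') \<le> C * D\<close>, free of the radius.\<close>

lemma dual_series_rho_le:
  fixes p q p' q' :: real
  assumes p: "1 < p" "1 < q" and conj: "1 / p + 1 / p' = 1" "1 / q + 1 / q' = 1"
  obtains C where "0 \<le> C"
    "\<And>\<phi>. \<phi> \<in> RM_dual p q \<Longrightarrow>
       rho p' q' (disc_series (dual_coeff \<phi>)) \<le> ennreal (C * RM_dual_norm p q \<phi>)"
proof -
  have p0: "0 < p" "0 < q" using p by auto
  have pp: "1 < p'" "1 < q'" using conjugate_exponent[OF p(1) conj(1)] conjugate_exponent[OF p(2) conj(2)] by auto
  have conj': "1 / p' + 1 / p = 1" "1 / q' + 1 / q = 1" using conj by auto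
  obtain C where C: "0 \<le> C" and op:
    "\<And>F \<alpha> \<Phi> A N B. radial_profile p F \<alpha> \<Longrightarrow> in_box F \<Longrightarrow>
       (power_integral \<alpha> (q / p)) = ennreal N \<Longrightarrow> 0 < N \<Longrightarrow>
       \<Phi> \<in> borel_measurable plane \<Longrightarrow> in_box \<Phi> \<Longrightarrow> (\<forall>z. 0 \<le> \<Phi> z) \<Longrightarrow>
       (\<forall>z. ennreal (\<Phi> z) \<le> (\<integral>\<^sup>+v. ennreal (F v * disc_kernel z v) \<partial>plane)) \<Longrightarrow>
       A \<in> borel_measurable borel \<Longrightarrow> (\<forall>t. 0 \<le> A t) \<Longrightarrow> (\<forall>t. A t \<le> B) \<Longrightarrow>
       (\<forall>t. (ray_integral p \<Phi> t) = ennreal (A t)) \<Longrightarrow>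
       (power_integral A (q / p)) \<le> ennreal (C powr q * N)"
    by (rule disc_kernel_operator_bound[OF p conj]) (rule that)
  show thesis
  proof (rule that[OF C])
    fix \<phi> assume \<phi>: "\<phi> \<in> RM_dual p q"
    define D where "D = RM_dual_norm p q \<phi>"
    have D0: "0 \<le> D" unfolding D_def by (rule dual_bound_dual_norm(2)[OF p \<phi>])
    define c where "c = dual_coeff \<phi>"
    define g where "g = disc_series c"
    have gm [measurable]: "g \<in> borel_measurable borel"
      unfolding g_def c_def by (rule disc_holomorphic_measurable[OF dual_series_holomorphic[OF p \<phi>]])
        (simp add: disc_series_def)
    have trunc: "(\<integral>\<^sup>+t\<in>{0..2 * pi}. ennreal_powr (\<integral>\<^sup>+r\<in>{0..R}. ennreal (cmod (g (polar (r, t))) powr p') \<partial>lborel) (q' / p') \<partial>lborel)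
        \<le> ennreal ((C * D) powr q')" if R: "0 < R" "R < 1" for R
    proof -
      define \<Phi> where "\<Phi> = (\<lambda>z. cmod (g (polar z)) * indicator ({0..R} \<times> {0..2 * pi}) z)"
      define M where "M = (\<Sum>n. cmod (c n) * R ^ n)"
      have M0: "0 \<le> M" unfolding M_def c_def using R
        by (intro suminf_nonneg dual_coeff_summable[OF p \<phi>]) auto
      have \<Phi>m [measurable]: "\<Phi> \<in> borel_measurable plane" unfolding \<Phi>_def by measurable
      have \<Phi>0: "0 \<le> \<Phi> z" for z by (simp add: \<Phi>_def)
      have \<Phi>M: "\<Phi> z \<le> M" for z
      proof (cases "z \<in> {0..R} \<times> {0..2 * pi}")
        case True
        then have "cmod (g (polar z)) \<le> M"
          unfolding g_def M_def c_def using R by (intro dual_series_norm_le[OF p \<phi>]) (auto simp: cmod_polar)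
        then show ?thesis using True by (simp add: \<Phi>_def)
      qed (use M0 in \<open>simp add: \<Phi>_def\<close>)
      have \<Phi>box: "in_box \<Phi>" using R by (auto simp: in_box_def \<Phi>_def indicator_def)
      have \<Phi>1: "\<Phi> (r, t) = 0" if "1 \<le> r" for r t using that R by (simp add: \<Phi>_def)
      obtain H where Hm [measurable]: "H \<in> borel_measurable borel" and H: "\<And>t. 0 \<le> H t" "\<And>t. H t \<le> M powr p'"
        and Hi: "\<And>t. (ray_integral p' \<Phi> t) = ennreal (H t)" and H0: "\<And>t. t \<notin> {0..2 * pi} \<Longrightarrow> H t = 0"
        using bounded_box_profile[OF \<Phi>m \<Phi>0 \<Phi>M \<Phi>box, of p'] pp by auto
      obtain N where N: "(power_integral H (q' / p')) = ennreal N" "0 \<le> N"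
        using profile_power_finite[of H "M powr p'" "q' / p'"] H H0 pp by auto
      have "(\<integral>\<^sup>+t\<in>{0..2 * pi}. ennreal_powr (\<integral>\<^sup>+r\<in>{0..R}. ennreal (cmod (g (polar (r, t))) powr p') \<partial>lborel) (q' / p') \<partial>lborel)
         = (power_integral H (q' / p'))"
      proof (rule nn_integral_cong)
        fix t
        show "ennreal_powr (\<integral>\<^sup>+r\<in>{0..R}. ennreal (cmod (g (polar (r, t))) powr p') \<partial>lborel) (q' / p') * indicator {0..2 * pi} t
          = ennreal (H t powr (q' / p'))"
        proof (cases "t \<in> {0..2 * pi}")
          case True
          have "(\<integral>\<^sup>+r\<in>{0..R}. ennreal (cmod (g (polar (r, t))) powr p') \<partial>lborel) = ennreal (H t)"
            unfolding Hi[symmetric] using True by (intro nn_integral_cong) (auto simp: \<Phi>_def indicator_def)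
          then show ?thesis using True H by simp
        qed (simp add: H0)
      qed
      also have "\<dots> \<le> ennreal ((C * D) powr q')"
      proof (cases "N = 0")
        case False
        then have Np: "0 < N" using N by simp
        \<comment> \<open>The norming lemma is used with the conjugate pair in first place:
          \<open>F\<close> is extremal for \<open>\<Phi>\<close> measured with p' and q', so
          \<open>F\<close> itself is measured with p and q, and the integral of
          \<open>\<alpha> powr (q / p)\<close> is again N.\<close>
        define F where "F = (\<lambda>z. \<Phi> z powr (p' - 1) * H (snd z) powr (q' / p' - 1))"
        define \<alpha> where "\<alpha> = (\<lambda>t. H t powr (p * (q' / p' - 1) + 1))"
        have F: "radial_profile p F \<alpha>" "\<And>t. \<alpha> t powr (q / p) = H t powr (q' / p')"
          "\<And>t. (\<integral>\<^sup>+r. ennreal (\<Phi> (r, t) * F (r, t)) \<partial>lborel) = ennreal (H t powr (q' / p'))"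
          unfolding F_def \<alpha>_def by (rule norming_function[OF pp conj' \<Phi>m Hm \<Phi>0 \<Phi>1 H Hi]; assumption)+
        have Fbox: "in_box F" using \<Phi>box pp by (auto simp: in_box_def F_def)
        have \<alpha>0: "\<alpha> t = 0" if "t \<notin> {0..2 * pi}" for t using H0[OF that] by (simp add: \<alpha>_def)
        have [measurable]: "F \<in> borel_measurable plane" and F0: "\<And>z. 0 \<le> F z" using F(1) by (auto simp: radial_profile_def)
        have FR: "F z = 0" if "z \<notin> {0..R} \<times> {0..2 * pi}" for z using that by (simp add: F_def \<Phi>_def)
        \<comment> \<open>\<open>F\<close> times the conjugate of the sign of \<open>g\<close>, so
          that the product with \<open>g\<close> is nonnegative. At zeros of \<open>g\<close> the
          quotient is 0 by convention, in accordance with \<open>\<Phi>\<close> being 0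
          there.\<close>
        define h where "h = (\<lambda>z. of_real (F z) * (cnj (g (polar z)) / of_real (cmod (g (polar z)))))"
        have hm [measurable]: "h \<in> borel_measurable plane" unfolding h_def by measurable
        have hF: "norm (h z) \<le> F z" for z
          using F0[of z] by (cases "g (polar z) = 0") (auto simp: h_def norm_mult norm_divide)
        have hi: "integrable plane h" by (rule integrable_of_profile[OF p(1) F(1) Fbox \<alpha>0 hm hF])
        have hR: "\<bar>fst z\<bar> \<le> R" if "h z \<noteq> 0" for z
        proof (rule ccontr)
          assume "\<not> \<bar>fst z\<bar> \<le> R"
          then have "F z = 0" by (intro FR) auto
          then show False using that by (simp add: h_def)
        qed
        have gh: "g (polar z) * h z = of_real (\<Phi> z * F z)" for z
        proof (cases "z \<in> {0..R} \<times> {0..2 * pi}")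
          case True
          have "g (polar z) * cnj (g (polar z)) = of_real (cmod (g (polar z))) * of_real (cmod (g (polar z)))"
            using complex_norm_square[of "g (polar z)"] by (simp add: power2_eq_square)
          then show ?thesis using True by (cases "g (polar z) = 0") (auto simp: h_def \<Phi>_def field_simps)
        qed (simp add: FR h_def)
        have R0: "0 \<le> R" using R by simp
        define m where "m = (\<lambda>n. LINT z|plane. polar z ^ n * h z)"
        define L where "L = (LINT z|plane. norm (h z))"
        have m_le: "cmod (m n) \<le> R ^ n * L" for n
          unfolding m_def L_def by (rule polar_power_integrable[OF hi R0 hR])
        \<comment> \<open>Expanding 1 / (1 - w z)^2 as the sum of (n + 1) w^n z^n shows that these
          are the Taylor coefficients in w of the kernel applied to \<open>h\<close>; R < 1 makes
          them absolutely summable.\<close>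
        define a where "a = (\<lambda>n. of_nat (Suc n) * m n)"
        have a: "summable (\<lambda>n. cmod (a n))"
        proof (rule summable_comparison_test')
          show "summable (\<lambda>n. of_nat (Suc n) * R ^ n * L)" using R by (intro summable_mult2 summable_Suc_power) auto
          show "norm (cmod (a n)) \<le> of_nat (Suc n) * R ^ n * L" for n
            using mult_left_mono[OF m_le[of n], of "of_nat (Suc n)"] by (simp add: a_def norm_mult mult.assoc del: of_nat_Suc)
        qed
        define P where "P = disc_series a"
        have P_RM: "P \<in> RM p q" unfolding P_def by (rule disc_series_in_RM[OF p0 a])
        have [measurable]: "P \<in> borel_measurable borel" by (rule RM_measurable[OF P_RM])
        have "\<phi> P = of_real N"
        proof -
          have "(\<lambda>n. a n * \<phi> (disc_monomial n)) sums \<phi> P"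
            unfolding P_def by (rule dual_disc_series_sums[OF p \<phi> a])
          moreover have "(\<lambda>n. c n * m n) sums (LINT z|plane. (\<Sum>n. c n * polar z ^ n) * h z)"
            unfolding m_def c_def by (rule polar_series_sums[OF hi R0 hR dual_coeff_summable[OF p \<phi> R0 R(2)]])
          \<comment> \<open>The factor n + 1 passes from the kernel to \<open>dual_coeff\<close>:
            the series for \<phi>(P) and for the integral of \<open>g\<close> times \<open>h\<close>
            agree term by term.\<close>
          moreover have "a n * \<phi> (disc_monomial n) = c n * m n" for n
            by (simp add: a_def c_def dual_coeff_def mult_ac del: of_nat_Suc)
          ultimately have "\<phi> P = (LINT z|plane. (\<Sum>n. c n * polar z ^ n) * h z)"
            by (simp add: sums_unique2)
          also have "\<dots> = (LINT z|plane. of_real (\<Phi> z * F z))"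
          proof (rule Bochner_Integration.integral_cong[OF refl])
            fix z
            show "(\<Sum>n. c n * polar z ^ n) * h z = of_real (\<Phi> z * F z)"
            proof (cases "h z = 0")
              case False
              then have "cmod (polar z) < 1" using hR[of z] R by (simp add: cmod_polar)
              then have "(\<Sum>n. c n * polar z ^ n) = g (polar z)" by (simp add: g_def disc_series_def)
              then show ?thesis by (simp add: gh)
            qed (use gh[of z] in simp)
          qed
          also have "\<dots> = of_real (LINT z|plane. \<Phi> z * F z)" by (rule integral_complex_of_real)
          also have "(LINT z|plane. \<Phi> z * F z) = enn2real (\<integral>\<^sup>+z. ennreal (\<Phi> z * F z) \<partial>plane)"
            using \<Phi>0 F0 by (intro integral_eq_nn_integral) auto
          also have "(\<integral>\<^sup>+z. ennreal (\<Phi> z * F z) \<partial>plane) = (\<integral>\<^sup>+t. \<integral>\<^sup>+r. ennreal (\<Phi> (r, t) * F (r, t)) \<partial>lborel \<partial>lborel)"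
            by (subst lborel_pair.nn_integral_snd) auto
          also have "\<dots> = ennreal N" by (simp add: F(3) N(1))
          finally show ?thesis using N by simp
        qed
        then have "N = cmod (\<phi> P)" using N by simp
        also have "\<dots> \<le> D * RM_norm p q P" unfolding D_def by (rule dual_bound_dual_norm(1)[OF p \<phi> P_RM])
        finally have N_le: "N \<le> D * RM_norm p q P" .
        have P_eq: "P w = (LINT v|plane. h v / (1 - w * polar v)\<^sup>2)" if w: "cmod w < 1" for w
        proof -
          have s1: "(\<lambda>n. (of_nat (Suc n) * w ^ n) * m n) sums (LINT v|plane. (\<Sum>n. (of_nat (Suc n) * w ^ n) * polar v ^ n) * h v)"
            unfolding m_def
          proof (rule polar_series_sums[OF hi R0 hR])
            show "summable (\<lambda>n. cmod (of_nat (Suc n) * w ^ n) * R ^ n)"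
            proof (rule summable_comparison_test')
              show "summable (\<lambda>n. of_nat (Suc n) * R ^ n)" using R by (intro summable_Suc_power) auto
              show "norm (cmod (of_nat (Suc n) * w ^ n) * R ^ n) \<le> of_nat (Suc n) * R ^ n" for n
                using R w by (auto simp: norm_mult norm_power power_le_one intro!: mult_right_mono mult_left_le simp del: of_nat_Suc)
            qed
          qed
          have s2: "(\<lambda>n. a n * w ^ n) sums P w"
          proof -
            have "summable (\<lambda>n. a n * w ^ n)"
              using w by (intro summable_norm_cancel[OF summable_mult_power_le_one[OF a]]) auto
            then show ?thesis using w by (simp add: P_def disc_series_def summable_sums)
          qed
          have s3: "(\<lambda>n. (of_nat (Suc n) * w ^ n) * m n) = (\<lambda>n. a n * w ^ n)" by (simp add: a_def mult_ac)
          have "P w = (LINT v|plane. (\<Sum>n. (of_nat (Suc n) * w ^ n) * polar v ^ n) * h v)"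
            by (rule sums_unique2[OF s2 s1[unfolded s3]])
          also have "\<dots> = (LINT v|plane. h v / (1 - w * polar v)\<^sup>2)"
          proof (rule Bochner_Integration.integral_cong[OF refl])
            fix v
            show "(\<Sum>n. (of_nat (Suc n) * w ^ n) * polar v ^ n) * h v = h v / (1 - w * polar v)\<^sup>2"
            proof (cases "h v = 0")
              case False
              then have "cmod (polar v) < 1" using hR[of v] R by (simp add: cmod_polar)
              then have "cmod (w * polar v) < 1" using w mult_left_mono[of "cmod (polar v)" 1 "cmod w"] by (simp add: norm_mult)
              then have "(\<lambda>n. of_nat (Suc n) * (w * polar v) ^ n) sums (1 / (1 - w * polar v)\<^sup>2)"
                by (rule geometric_deriv_sums)
              then have "(\<Sum>n. (of_nat (Suc n) * w ^ n) * polar v ^ n) = 1 / (1 - w * polar v)\<^sup>2"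
                by (simp add: sums_iff power_mult_distrib mult.assoc)
              then show ?thesis by simp
            qed simp
          qed
          finally show ?thesis .
        qed
        define \<Psi> where "\<Psi> = (\<lambda>z. cmod (P (polar z)) * indicator polar_box z)"
        have \<Psi>m [measurable]: "\<Psi> \<in> borel_measurable plane" unfolding \<Psi>_def by measurable
        have \<Psi>0: "0 \<le> \<Psi> z" for z by (simp add: \<Psi>_def)
        have \<Psi>M: "\<Psi> z \<le> (\<Sum>n. cmod (a n))" for z
          using disc_series_norm_le[OF a, of "polar z"] suminf_nonneg[OF a] by (auto simp: \<Psi>_def P_def indicator_def)
        have \<Psi>box: "in_box \<Psi>" by (auto simp: in_box_def \<Psi>_def)
        obtain A where Am [measurable]: "A \<in> borel_measurable borel" and A: "\<And>t. 0 \<le> A t" "\<And>t. A t \<le> (\<Sum>n. cmod (a n)) powr p"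
          and Ai: "\<And>t. (ray_integral p \<Psi> t) = ennreal (A t)" and A0: "\<And>t. t \<notin> {0..2 * pi} \<Longrightarrow> A t = 0"
          using bounded_box_profile[OF \<Psi>m \<Psi>0 \<Psi>M \<Psi>box p0(1)] by blast
        have dom: "ennreal (\<Psi> z) \<le> (\<integral>\<^sup>+v. ennreal (F v * disc_kernel z v) \<partial>plane)" for z
        proof (cases "z \<in> polar_box")
          case True
          have "ennreal (cmod (P (polar z))) \<le> (\<integral>\<^sup>+v. ennreal (norm (h v / (1 - polar z * polar v)\<^sup>2)) \<partial>plane)"
          proof (cases "integrable plane (\<lambda>v. h v / (1 - polar z * polar v)\<^sup>2)")
            case int: True
            show ?thesis unfolding P_eq[OF polar_in_ball[OF True]] by (rule integral_norm_bound_ennreal[OF int])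
          next
            \<comment> \<open>The Bochner integral of a function that is not integrable is 0 by
              convention, and the bound is then trivial.\<close>
            case False
            then show ?thesis unfolding P_eq[OF polar_in_ball[OF True]] by (simp add: not_integrable_integral_eq)
          qed
          also have "\<dots> \<le> (\<integral>\<^sup>+v. ennreal (F v * disc_kernel z v) \<partial>plane)"
          proof (intro nn_integral_mono ennreal_leI)
            fix v
            have "polar z * polar v = of_real (fst z * fst v) * cis (snd z + snd v)"
              by (simp add: polar_def cis_mult[symmetric])
            then have "norm (h v / (1 - polar z * polar v)\<^sup>2) = norm (h v) * disc_kernel z v"
              by (simp add: disc_kernel_def norm_divide norm_power)
            also have "\<dots> \<le> F v * disc_kernel z v" by (intro mult_right_mono hF) auto
            finally show "norm (h v / (1 - polar z * polar v)\<^sup>2) \<le> F v * disc_kernel z v" .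
          qed
          finally show ?thesis using True by (simp add: \<Psi>_def)
        qed (simp add: \<Psi>_def)
        have "rho_power p q P = (power_integral A (q / p))"
          unfolding rho_power_def
        proof (rule nn_integral_cong)
          fix t
          show "ennreal_powr (radial p P t) (q / p) * indicator {0..2 * pi} t = ennreal (A t powr (q / p))"
          proof (cases "t \<in> {0..2 * pi}")
            case True
            have "radial p P t = ennreal (A t)"
              unfolding Ai[symmetric] radial_def using True by (intro nn_integral_cong) (auto simp: \<Psi>_def polar_def indicator_def)
            then show ?thesis using True A by simp
          qed (simp add: A0)
        qed
        also have "\<dots> \<le> ennreal (C powr q * N)"
          by (rule op[OF F(1) Fbox _ Np \<Psi>m \<Psi>box _ _ Am, where B = "(\<Sum>n. cmod (a n)) powr p"]) (use \<Psi>0 dom A Ai in \<open>simp_all add: F(2) N(1)\<close>)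
        \<comment> \<open>The normalising factor is simply estimated by 1, here and again for
          \<open>g\<close> at the end.\<close>
        finally have "ennreal (1 / (2 * pi)) * rho_power p q P \<le> ennreal 1 * ennreal (C powr q * N)"
          using pi_ge_two by (intro mult_mono ennreal_leI) auto
        then have "rho p q P \<le> ennreal_powr (ennreal (C powr q * N)) (1 / q)"
          unfolding rho_eq using p by (intro ennreal_powr_mono) auto
        also have "\<dots> = ennreal (C * N powr (1 / q))"
          using N C p by (simp add: powr_mult powr_powr)
        finally have "RM_norm p q P \<le> C * N powr (1 / q)"
          using rho_eq_RM_norm[OF P_RM] C by (simp add: ennreal_le_iff)
        then have "D * RM_norm p q P \<le> D * (C * N powr (1 / q))" using D0 by (rule mult_left_mono)
        with N_le have "N \<le> D * (C * N powr (1 / q))" by simp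
        moreover have "N = N powr (1 / q') * N powr (1 / q)"
          using Np conj' by (simp add: powr_add[symmetric])
        ultimately have "N powr (1 / q') * N powr (1 / q) \<le> C * D * N powr (1 / q)" by (simp add: mult_ac)
        then have "N powr (1 / q') \<le> C * D" using Np by simp
        then have "(N powr (1 / q')) powr q' \<le> (C * D) powr q'" using pp by (intro powr_mono2) auto
        then show ?thesis using Np pp N by (simp add: powr_powr ennreal_leI)
      qed (simp add: N)
      finally show ?thesis .
    qed
    have "rho_power p' q' g \<le> ennreal ((C * D) powr q')"
      using pp by (intro rho_power_le_of_truncations gm trunc) auto
    then have "ennreal (1 / (2 * pi)) * rho_power p' q' g \<le> ennreal 1 * ennreal ((C * D) powr q')"
      using pi_ge_two by (intro mult_mono ennreal_leI) auto
    then have "rho p' q' g \<le> ennreal_powr (ennreal ((C * D) powr q')) (1 / q')"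
      unfolding rho_eq using pp by (intro ennreal_powr_mono) auto
    then show "rho p' q' (disc_series (dual_coeff \<phi>)) \<le> ennreal (C * RM_dual_norm p q \<phi>)"
      using C D0 pp by (simp add: powr_powr g_def c_def D_def)
  qed
qed

section \<open>The Bergman pairing and its moments\<close>

lemma integral_cis_multiple:
  fixes m :: int
  shows "(LINT t|lborel. indicator {0..2 * pi} t *\<^sub>R cis (of_int m * t)) = (if m = 0 then of_real (2 * pi) else 0)"
proof (cases "m = 0")
  case True
  have "(LINT t|lborel. indicator {0..2 * pi} t *\<^sub>R (1 :: complex)) = (2 * pi) *\<^sub>R 1"
    by (subst integral_scaleR_left) auto
  then show ?thesis using True by (simp add: scaleR_conv_of_real)
next
  case False
  define k where "k = \<i> * of_int m"
  have k: "k \<noteq> 0" using False by (simp add: k_def)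
  have c: "cis (of_int m * t) = exp (k * of_real t)" for t :: real
    by (simp add: cis_conv_exp k_def mult.assoc)
  have "(LINT t|lborel. indicator {0..2 * pi} t *\<^sub>R exp (k * of_real t)) = exp (k * of_real (2 * pi)) / k - exp (k * of_real 0) / k"
  proof (rule integral_FTC_Icc[where F = "\<lambda>t. exp (k * of_real t) / k"])
    fix t :: real
    have "((\<lambda>z. exp (k * z) / k) has_field_derivative exp (k * of_real t)) (at (of_real t))"
      using k by (auto intro!: derivative_eq_intros)
    then have "((\<lambda>t. exp (k * of_real t) / k) has_vector_derivative exp (k * of_real t)) (at t)"
      by (rule has_vector_derivative_real_field)
    then show "((\<lambda>t. exp (k * of_real t) / k) has_vector_derivative exp (k * of_real t)) (at t within {0..2 * pi})"
      by (rule has_vector_derivative_at_within)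
  next
    show "continuous_on {0..2 * pi} (\<lambda>t. exp (k * complex_of_real t))" by (intro continuous_intros)
  qed auto
  moreover have "exp (k * of_real (2 * pi)) = 1"
  proof -
    have "exp (k * of_real (2 * pi)) = cis (2 * pi * of_int m)" using c[of "2 * pi"] by (simp only: mult.commute)
    also have "\<dots> = 1" by (rule cis_multiple_2pi) simp
    finally show ?thesis .
  qed
  ultimately show ?thesis using False by (simp add: c)
qed

text \<open>The factor r is the Jacobian, so integration over \<open>plane\<close> becomes
  integration over the disc with respect to area. Vanishing off the box lets all integrals run over
  the whole plane.\<close>

definition bergman_weight :: "(complex \<Rightarrow> complex) \<Rightarrow> real \<times> real \<Rightarrow> complex" where
  "bergman_weight g z = (if z \<in> polar_box then of_real (fst z) * g (cnj (polar z)) else 0)"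

lemma bergman_weight_measurable [measurable]:
  assumes [measurable]: "g \<in> borel_measurable borel"
  shows "bergman_weight g \<in> borel_measurable plane"
  unfolding bergman_weight_def by measurable

text \<open>The Jacobian is at most 1 on the box, so the pairing for area is dominated by the
  pairing for dr dt.\<close>

lemma bergman_pairing_bound:
  assumes p: "1 < p" "1 < q" and conj: "1 / p + 1 / p' = 1" "1 / q + 1 / q' = 1"
    and [measurable]: "f \<in> borel_measurable borel" "g \<in> borel_measurable borel"
  shows "(\<integral>\<^sup>+z. ennreal (norm (f (polar z) * bergman_weight g z)) \<partial>plane) \<le> ennreal (2 * pi) * (rho p q f * rho p' q' g)"
proof -
  have "(\<integral>\<^sup>+z. ennreal (norm (f (polar z) * bergman_weight g z)) \<partial>plane)
      \<le> (\<integral>\<^sup>+z\<in>polar_box. ennreal (cmod (f (polar z)) * cmod (g (cnj (polar z)))) \<partial>plane)"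
  proof (rule nn_integral_mono)
    fix z
    show "ennreal (norm (f (polar z) * bergman_weight g z)) \<le> ennreal (cmod (f (polar z)) * cmod (g (cnj (polar z)))) * indicator polar_box z"
    proof (cases "z \<in> polar_box")
      case True
      then have "norm (f (polar z) * bergman_weight g z) = cmod (f (polar z)) * (fst z * cmod (g (cnj (polar z))))"
        by (auto simp: bergman_weight_def norm_mult)
      also have "\<dots> \<le> cmod (f (polar z)) * (1 * cmod (g (cnj (polar z))))"
        using True by (intro mult_left_mono mult_right_mono) auto
      finally show ?thesis using True by (simp add: ennreal_leI)
    qed (simp add: bergman_weight_def)
  qed
  also have "\<dots> \<le> ennreal (2 * pi) * (rho p q f * rho p' q' g)"
    by (rule rho_Hoelder[OF p conj]) measurable
  finally show ?thesis .
qed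

lemma bergman_pairing_integrable:
  assumes p: "1 < p" "1 < q" and conj: "1 / p + 1 / p' = 1" "1 / q + 1 / q' = 1"
    and f: "f \<in> RM p q" and g: "g \<in> RM p' q'"
  shows "integrable plane (\<lambda>z. f (polar z) * bergman_weight g z)"
    and "cmod (LINT z|plane. f (polar z) * bergman_weight g z) \<le> 2 * pi * (RM_norm p q f * RM_norm p' q' g)"
proof -
  have [measurable]: "f \<in> borel_measurable borel" "g \<in> borel_measurable borel" by (intro RM_measurable[OF f] RM_measurable[OF g])+
  have le: "(\<integral>\<^sup>+z. ennreal (norm (f (polar z) * bergman_weight g z)) \<partial>plane) \<le> ennreal (2 * pi * (RM_norm p q f * RM_norm p' q' g))"
    using bergman_pairing_bound[OF p conj, of f g] by (simp add: rho_eq_RM_norm[OF f] rho_eq_RM_norm[OF g] ennreal_mult)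
  show int: "integrable plane (\<lambda>z. f (polar z) * bergman_weight g z)"
    by (rule integrableI_bounded) (use le in \<open>auto intro: order_le_less_trans\<close>)
  have "ennreal (cmod (LINT z|plane. f (polar z) * bergman_weight g z)) \<le> ennreal (2 * pi * (RM_norm p q f * RM_norm p' q' g))"
    using integral_norm_bound_ennreal[OF int] le by (rule order_trans)
  then show "cmod (LINT z|plane. f (polar z) * bergman_weight g z) \<le> 2 * pi * (RM_norm p q f * RM_norm p' q' g)"
    by (simp add: ennreal_le_iff)
qed

lemma bergman_weight_integrable:
  assumes p: "1 < p" "1 < q" and conj: "1 / p + 1 / p' = 1" "1 / q + 1 / q' = 1" and g: "g \<in> RM p' q'"
  shows "integrable plane (bergman_weight g)"
proof -
  \<comment> \<open>\<open>disc_monomial 0\<close> is the constant 1 on the disc, and pairing with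
    it leaves the weight itself.\<close>
  have "integrable plane (\<lambda>z. disc_monomial 0 (polar z) * bergman_weight g z)"
    using p by (intro bergman_pairing_integrable[OF p conj _ g] disc_monomial_in_RM) auto
  also have "(\<lambda>z. disc_monomial 0 (polar z) * bergman_weight g z) = bergman_weight g"
    by (auto simp: fun_eq_iff disc_monomial_def bergman_weight_def cmod_polar)
  finally show ?thesis .
qed

lemma bergman_weight_support: "bergman_weight g z \<noteq> 0 \<Longrightarrow> \<bar>fst z\<bar> \<le> 1"
  by (auto simp: bergman_weight_def split: if_splits)

lemma integral_power_half_open: "(LINT r|lborel. indicator {0..<1} r *\<^sub>R (r::real) ^ n) = 1 / (real n + 1)"
proof -
  have "(LINT r|lborel. indicator {0..<1} r *\<^sub>R (r::real) ^ n) = (LINT r|lborel. indicator {0..1} r *\<^sub>R r ^ n)"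
  proof (rule integral_cong_AE)
    have "AE r in lborel. r \<noteq> (1::real)" using AE_lborel_singleton by auto
    then show "AE r in lborel. indicator {0..<1} r *\<^sub>R r ^ n = indicator {0..1} r *\<^sub>R (r::real) ^ n"
      by eventually_elim (auto simp: indicator_def)
  qed auto
  also have "\<dots> = 1 ^ Suc n / (real n + 1) - 0 ^ Suc n / (real n + 1)"
  proof (rule integral_FTC_Icc[where F = "\<lambda>r. r ^ Suc n / (real n + 1)"])
    fix r :: real
    have "((\<lambda>r. r ^ Suc n / (real n + 1)) has_real_derivative r ^ n) (at r within {0..1})"
      using DERIV_cdivide[OF DERIV_pow[of "Suc n" r "{0..1}"], of "real n + 1"] by (simp add: add.commute)
    then show "((\<lambda>r. r ^ Suc n / (real n + 1)) has_vector_derivative r ^ n) (at r within {0..1})"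
      by (simp add: has_real_derivative_iff_has_vector_derivative)
  qed (auto intro!: continuous_intros)
  finally show ?thesis by simp
qed

text \<open>On the circle of radius r orthogonality leaves only the term k = n, equal to 2 pi c(n)
  r^(2n+1), and the integral of r^(2n+1) from 0 to 1 is 1 / (2n + 2). The angle is integrated first
  because the series converges absolutely on each circle, without uniform control up to the
  boundary; integrability of the weight justifies Fubini.\<close>

lemma bergman_weight_moment:
  assumes c: "\<And>r. 0 \<le> r \<Longrightarrow> r < 1 \<Longrightarrow> summable (\<lambda>n. cmod (c n) * r ^ n)"
    and g: "g = disc_series c" and int: "integrable plane (bergman_weight g)"
  shows "(LINT z|plane. polar z ^ n * bergman_weight g z) = of_real pi * c n / of_nat (Suc n)"
proof -
  have inner: "(LINT t|lborel. polar (r, t) ^ n * bergman_weight g (r, t)) = (indicator {0..<1} r *\<^sub>R r ^ (2 * n + 1)) *\<^sub>R (of_real (2 * pi) * c n)" for r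
  proof (cases "r \<in> {0..<1}")
    case True
    then have r: "0 \<le> r" "r < 1" by auto
    define a where "a = (\<lambda>k. of_real (r ^ Suc n) * (c k * of_real (r ^ k)))"
    define e where "e = (\<lambda>k t. indicator {0..2 * pi} t *\<^sub>R cis (of_int (int n - int k) * t))"
    have a: "summable (\<lambda>k. cmod (a k))"
    proof -
      have "summable (\<lambda>k. r ^ Suc n * (cmod (c k) * r ^ k))" by (intro summable_mult c r)
      then show ?thesis using r by (simp add: a_def norm_mult norm_power)
    qed
    have e_norm: "norm (e k t) = indicator {0..2 * pi} t" for k t by (simp add: e_def indicator_def)
    have [measurable]: "e k \<in> borel_measurable borel" for k unfolding e_def by measurable
    have e_int: "integrable lborel (e k)" for k
    proof (rule Bochner_Integration.integrable_bound[of _ "indicator {0..2 * pi} :: real \<Rightarrow> real"])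
      show "integrable lborel (indicator {0..2 * pi} :: real \<Rightarrow> real)" by (rule integrable_real_indicator) auto
    qed (auto simp: e_norm)
    have e_val: "(LINT t|lborel. e k t) = (if k = n then of_real (2 * pi) else 0)" for k
      unfolding e_def using integral_cis_multiple[of "int n - int k"] by auto
    have "(\<lambda>k. LINT t|lborel. a k * e k t) sums (LINT t|lborel. (\<Sum>k. a k * e k t))"
    proof (rule sums_integral)
      show "integrable lborel (\<lambda>t. a k * e k t)" for k using e_int by auto
      show "AE t in lborel. summable (\<lambda>k. norm (a k * e k t))"
        by (rule AE_I2) (simp add: norm_mult e_norm summable_mult2 a)
      have "(LINT t|lborel. norm (a k * e k t)) = cmod (a k) * (2 * pi)" for k
        by (simp add: norm_mult e_norm)
      then show "summable (\<lambda>k. LINT t|lborel. norm (a k * e k t))" by (simp add: summable_mult2 a)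
    qed
    moreover have "(\<Sum>k. a k * e k t) = polar (r, t) ^ n * bergman_weight g (r, t)" for t
    proof (cases "t \<in> {0..2 * pi}")
      case t: True
      have cnj_p: "cnj (polar (r, t)) = of_real r * cis (- t)" by (simp add: polar_def cis_cnj)
      have "cmod (cnj (polar (r, t))) < 1" using r by (simp add: cmod_polar)
      then have "g (cnj (polar (r, t))) = (\<Sum>k. c k * cnj (polar (r, t)) ^ k)" by (simp add: g disc_series_def)
      also have "\<dots> = (\<Sum>k. c k * of_real (r ^ k) * cis (- (real k * t)))"
      proof -
        have "cis (- t) ^ k = cis (- (real k * t))" for k unfolding Complex.DeMoivre by simp
        then show ?thesis unfolding cnj_p by (simp add: power_mult_distrib mult.assoc)
      qed
      finally have "polar (r, t) ^ n * bergman_weight g (r, t)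
          = (of_real (r ^ Suc n) * cis (real n * t)) * (\<Sum>k. c k * of_real (r ^ k) * cis (- (real k * t)))"
        using t True by (simp add: bergman_weight_def polar_def power_mult_distrib Complex.DeMoivre mult_ac)
      also have "\<dots> = (\<Sum>k. (of_real (r ^ Suc n) * cis (real n * t)) * (c k * of_real (r ^ k) * cis (- (real k * t))))"
      proof (rule suminf_mult[symmetric])
        have "summable (\<lambda>k. norm (c k * of_real (r ^ k) * cis (- (real k * t))))"
          using c[OF r] r by (simp add: norm_mult norm_power)
        then show "summable (\<lambda>k. c k * of_real (r ^ k) * cis (- (real k * t)))" by (rule summable_norm_cancel)
      qed
      also have "\<dots> = (\<Sum>k. a k * e k t)"
      proof -
        have "cis (real n * t) * cis (- (real k * t)) = cis (of_int (int n - int k) * t)" for k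
          by (simp add: cis_mult algebra_simps)
        then have "(of_real (r ^ Suc n) * cis (real n * t)) * (c k * of_real (r ^ k) * cis (- (real k * t))) = a k * e k t" for k
          using t by (simp add: a_def e_def mult_ac)
        then show ?thesis by simp
      qed
      finally show ?thesis by simp
    qed (auto simp: e_def bergman_weight_def)
    moreover have "(LINT t|lborel. a k * e k t) = (if k = n then a n * of_real (2 * pi) else 0)" for k
      by (simp add: e_val)
    ultimately have "(\<lambda>k. if k = n then a n * of_real (2 * pi) else 0) sums (LINT t|lborel. polar (r, t) ^ n * bergman_weight g (r, t))"
      by simp
    then have "(LINT t|lborel. polar (r, t) ^ n * bergman_weight g (r, t)) = a n * of_real (2 * pi)"
      by (rule sums_unique2[OF _ sums_single[of n "\<lambda>_. a n * of_real (2 * pi)"]])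
    also have "\<dots> = (indicator {0..<1} r *\<^sub>R r ^ (2 * n + 1)) *\<^sub>R (of_real (2 * pi) * c n)"
    proof -
      have e: "r ^ Suc n * r ^ n = r ^ (2 * n + 1)" by (simp only: power_add[symmetric]) (simp add: mult_2)
      have "a n = of_real (r ^ Suc n * r ^ n) * c n"
        unfolding a_def of_real_mult by (simp only: mult_ac)
      then have "a n = of_real (r ^ (2 * n + 1)) * c n" unfolding e .
      then show ?thesis using True by (simp add: scaleR_conv_of_real del: of_real_power)
    qed
    finally show ?thesis .
  next
    case False
    then have "bergman_weight g (r, t) = 0" for t by (auto simp: bergman_weight_def)
    then show ?thesis using False by simp
  qed
  have "integrable plane (\<lambda>z. polar z ^ n * bergman_weight g z)"
    by (rule polar_power_integrable(1)[OF int, of 1]) (auto intro: bergman_weight_support)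
  then have "(LINT z|plane. polar z ^ n * bergman_weight g z) = (LINT r|lborel. LINT t|lborel. polar (r, t) ^ n * bergman_weight g (r, t))"
    by (rule lborel_pair.integral_fst'[symmetric])
  also have "\<dots> = (LINT r|lborel. indicator {0..<1} r *\<^sub>R r ^ (2 * n + 1)) *\<^sub>R (of_real (2 * pi) * c n)"
    unfolding inner
  proof (rule integral_scaleR_left)
    \<comment> \<open>A nonzero Bochner integral certifies integrability, since the integral would
      be 0 by convention otherwise.\<close>
    have "(LINT r|lborel. indicator {0..<1} r *\<^sub>R (r::real) ^ (2 * n + 1)) \<noteq> 0"
      unfolding integral_power_half_open by simp
    then show "integrable lborel (\<lambda>r. indicator {0..<1} r *\<^sub>R (r::real) ^ (2 * n + 1))"
      using not_integrable_integral_eq by blast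
  qed
  also have "\<dots> = of_real pi * c n / of_nat (Suc n)"
  proof -
    have e: "1 / (real (2 * n + 1) + 1) * 2 * pi = pi / real (Suc n)" by (simp add: field_simps)
    have "(1 / (real (2 * n + 1) + 1)) *\<^sub>R (of_real (2 * pi) * c n) = of_real (pi / real (Suc n)) * c n"
      unfolding scaleR_conv_of_real mult.assoc[symmetric] of_real_mult[symmetric] e ..
    then show ?thesis unfolding integral_power_half_open by (simp del: of_nat_Suc)
  qed
  finally show ?thesis .
qed

section \<open>The functional is controlled by its representing function\<close>

lemma RM_power_series:
  assumes "f \<in> RM p q"
  obtains b where "f = disc_series b" "\<And>r. 0 \<le> r \<Longrightarrow> r < 1 \<Longrightarrow> summable (\<lambda>n. cmod (b n) * r ^ n)"
proof -
  define b where "b = (\<lambda>n. (deriv ^^ n) f 0 / fact n)"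
  have s: "(\<lambda>n. b n * z ^ n) sums f z" if "cmod z < 1" for z
    using holomorphic_power_series[of f 0 1 z] assms that by (simp add: RM_def b_def)
  have "f = disc_series b"
    using s assms by (auto simp: fun_eq_iff disc_series_def RM_def sums_iff)
  moreover have "summable (\<lambda>n. cmod (b n) * r ^ n)" if r: "0 \<le> r" "r < 1" for r
  proof -
    \<comment> \<open>Plain convergence at an intermediate radius gives absolute convergence at the
      smaller one.\<close>
    obtain x where x: "r < x" "x < 1" using dense r by blast
    have "summable (\<lambda>n. b n * of_real x ^ n)" using s[of "of_real x"] x r by (auto simp: sums_iff)
    then have "summable (\<lambda>n. norm (b n * of_real r ^ n))" by (rule powser_insidea) (use x r in auto)
    then show ?thesis using r by (simp add: norm_mult norm_power)
  qed
  ultimately show thesis by (rule that)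
qed

lemma dilation_disc_series: "\<lbrakk>0 \<le> \<rho>; \<rho> \<le> 1\<rbrakk> \<Longrightarrow> dilation \<rho> (disc_series b) = disc_series (\<lambda>n. b n * of_real (\<rho> ^ n))"
proof
  fix z :: complex assume \<rho>: "0 \<le> \<rho>" "\<rho> \<le> 1"
  have "cmod (of_real \<rho> * z) < 1" if "cmod z < 1"
    using mult_right_mono[of \<rho> 1 "cmod z"] \<rho> that by (simp add: norm_mult)
  then show "dilation \<rho> (disc_series b) z = disc_series (\<lambda>n. b n * of_real (\<rho> ^ n)) z"
    by (simp add: dilation_def disc_series_def power_mult_distrib mult.assoc)
qed

text \<open>The factor 1 / \<rho> \<le> 2 is weakened to \<open>2 powr p\<close>, which turns the
  p-th powers into those of 2 f; the constant 2 then leaves the norm by homogeneity.\<close>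

lemma rho_dilation_le:
  assumes p: "1 < p" "0 < q" and [measurable]: "f \<in> borel_measurable borel" and \<rho>: "1 / 2 \<le> \<rho>" "\<rho> < 1"
  shows "rho p q (dilation \<rho> f) \<le> ennreal 2 * rho p q f"
proof -
  have "radial p (dilation \<rho> f) t \<le> ennreal (2 powr p) * radial p f t" for t
  proof -
    have "1 / \<rho> \<le> 2 powr 1" using \<rho> by (simp add: field_simps)
    also have "\<dots> \<le> 2 powr p" using p by (intro powr_mono) auto
    finally have "ennreal (1 / \<rho>) * radial p f t \<le> ennreal (2 powr p) * radial p f t"
      by (intro mult_right_mono ennreal_leI) auto
    then show ?thesis using radial_dilation_le[of f \<rho> p t] \<rho> by (auto intro: order_trans)
  qed
  also have "ennreal (2 powr p) * radial p f t = radial p (\<lambda>z. 2 * f z) t" for t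
    unfolding radial_def by (subst nn_integral_cmult[symmetric]) (auto simp: norm_mult powr_mult ennreal_mult' mult.assoc)
  finally have "rho_power p q (dilation \<rho> f) \<le> rho_power p q (\<lambda>z. 2 * f z)"
    unfolding rho_power_def using p by (intro nn_integral_mono mult_right_mono ennreal_powr_mono) auto
  then have "rho p q (dilation \<rho> f) \<le> rho p q (\<lambda>z. 2 * f z)"
    unfolding rho_eq using p by (intro ennreal_powr_mono mult_left_mono) auto
  also have "\<dots> = ennreal 2 * rho p q f"
    using rho_scale[of p q f 2] p by simp
  finally show ?thesis .
qed

text \<open>For a dilation of \<open>f\<close> the coefficients are absolutely summable, so the
  functional and the pairing can both be expanded term by term, and the moments identify them up to
  the factor pi. Of the constant 4, one factor 2 is 2 pi / pi from Hoelder's inequality and the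
  other is the bound for dilations. Continuity of \<open>\<phi>\<close> carries the estimate to
  \<open>f\<close>.\<close>

lemma dual_norm_le_bergman:
  fixes p q p' q' :: real
  assumes p: "1 < p" "1 < q" and conj: "1 / p + 1 / p' = 1" "1 / q + 1 / q' = 1"
    and \<phi>: "\<phi> \<in> RM_dual p q" and g: "disc_series (dual_coeff \<phi>) \<in> RM p' q'" and f: "f \<in> RM p q"
  shows "cmod (\<phi> f) \<le> 4 * RM_norm p' q' (disc_series (dual_coeff \<phi>)) * RM_norm p q f"
proof -
  have p0: "0 < p" "0 < q" using p by auto
  define g where "g = disc_series (dual_coeff \<phi>)"
  have gRM: "g \<in> RM p' q'" using assms by (simp add: g_def)
  obtain b where fb: "f = disc_series b" and b: "\<And>r. 0 \<le> r \<Longrightarrow> r < 1 \<Longrightarrow> summable (\<lambda>n. cmod (b n) * r ^ n)"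
    by (rule RM_power_series[OF f]) (rule that)
  have fm: "f \<in> borel_measurable borel" by (rule RM_measurable[OF f])
  have Wi: "integrable plane (bergman_weight g)" by (rule bergman_weight_integrable[OF p conj gRM])
  have dil: "dilation \<rho> f \<in> RM p q \<and> cmod (\<phi> (dilation \<rho> f)) \<le> 4 * RM_norm p' q' g * RM_norm p q f" if \<rho>: "1 / 2 \<le> \<rho>" "\<rho> < 1" for \<rho>
  proof -
    define a where "a = (\<lambda>n. b n * of_real (\<rho> ^ n))"
    have \<rho>0: "0 \<le> \<rho>" using \<rho> by simp
    have da: "dilation \<rho> f = disc_series a" unfolding fb a_def using \<rho> by (intro dilation_disc_series) auto
    have a: "summable (\<lambda>n. cmod (a n))" using b[OF \<rho>0 \<rho>(2)] \<rho>0 by (simp add: a_def norm_mult norm_power)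
    have dRM: "dilation \<rho> f \<in> RM p q" unfolding da by (rule disc_series_in_RM[OF p0 a])
    have s: "(\<lambda>n. a n * (LINT z|plane. polar z ^ n * bergman_weight g z)) sums (LINT z|plane. (\<Sum>n. a n * polar z ^ n) * bergman_weight g z)"
      by (rule polar_series_sums[OF Wi, of 1]) (use a in \<open>auto intro: bergman_weight_support\<close>)
    have m: "(LINT z|plane. polar z ^ n * bergman_weight g z) = of_real pi * \<phi> (disc_monomial n)" for n
      using bergman_weight_moment[OF dual_coeff_summable[OF p \<phi>] g_def Wi, of n] by (simp add: dual_coeff_def del: of_nat_Suc)
    have i: "(LINT z|plane. (\<Sum>n. a n * polar z ^ n) * bergman_weight g z) = (LINT z|plane. dilation \<rho> f (polar z) * bergman_weight g z)"
      unfolding da disc_series_def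
      by (intro Bochner_Integration.integral_cong refl) (auto simp: bergman_weight_def cmod_polar)
    have "(\<lambda>n. of_real pi * (a n * \<phi> (disc_monomial n))) sums (LINT z|plane. dilation \<rho> f (polar z) * bergman_weight g z)"
      using s unfolding m i by (simp only: mult.left_commute)
    moreover have "(\<lambda>n. of_real pi * (a n * \<phi> (disc_monomial n))) sums (of_real pi * \<phi> (dilation \<rho> f))"
      unfolding da by (rule sums_mult[OF dual_disc_series_sums[OF p \<phi> a]])
    ultimately have "of_real pi * \<phi> (dilation \<rho> f) = (LINT z|plane. dilation \<rho> f (polar z) * bergman_weight g z)"
      by (metis sums_unique2)
    then have "pi * cmod (\<phi> (dilation \<rho> f)) = cmod (LINT z|plane. dilation \<rho> f (polar z) * bergman_weight g z)"
      by (metis abs_of_pos norm_mult norm_of_real pi_gt_zero)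
    also have "\<dots> \<le> 2 * pi * (RM_norm p q (dilation \<rho> f) * RM_norm p' q' g)"
      by (rule bergman_pairing_integrable(2)[OF p conj dRM gRM])
    finally have "cmod (\<phi> (dilation \<rho> f)) \<le> 2 * (RM_norm p q (dilation \<rho> f) * RM_norm p' q' g)" by simp
    also have "\<dots> \<le> 2 * ((2 * RM_norm p q f) * RM_norm p' q' g)"
    proof (intro mult_left_mono mult_right_mono)
      have "rho p q (dilation \<rho> f) \<le> ennreal 2 * rho p q f" using p \<rho> by (intro rho_dilation_le fm) auto
      then have "ennreal (RM_norm p q (dilation \<rho> f)) \<le> ennreal (2 * RM_norm p q f)"
        unfolding rho_eq_RM_norm[OF f] rho_eq_RM_norm[OF dRM] by (simp only: ennreal_mult RM_norm_nonneg zero_le_numeral)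
      then show "RM_norm p q (dilation \<rho> f) \<le> 2 * RM_norm p q f" by (simp add: ennreal_le_iff)
    qed auto
    finally show ?thesis using dRM by (simp add: mult_ac)
  qed
  \<comment> \<open>The offset 2 starts the sequence at 1 / 2, the smallest ratio that the bound for
    dilations admits.\<close>
  define R where "R = (\<lambda>n. 1 - 1 / (real n + 2))"
  have R: "1 / 2 \<le> R n" "R n < 1" for n by (auto simp: R_def field_simps)
  have R1: "R \<longlonglongrightarrow> 1" unfolding R_def by real_asymp
  have dRM: "dilation (R n) f \<in> RM p q" for n using dil[OF R] by blast
  have diff: "(\<lambda>z. f z - dilation (R n) f z) \<in> RM p q" for n
    using RM_add[OF p0 f RM_scale[OF p0 dRM[of n], of "-1"]] by simp
  have "(\<lambda>n. RM_norm p q (\<lambda>z. f z - dilation (R n) f z)) \<longlonglongrightarrow> 0"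
    using tendsto_enn2real[of _ 0 sequentially] rho_diff_dilation_tendsto_0[OF p0 f R R1] by (simp add: RM_norm_def)
  then have lim0: "(\<lambda>n. RM_dual_norm p q \<phi> * RM_norm p q (\<lambda>z. f z - dilation (R n) f z)) \<longlonglongrightarrow> 0"
    by (rule tendsto_mult_right_zero)
  have "norm (\<phi> f - \<phi> (dilation (R n) f)) \<le> RM_dual_norm p q \<phi> * RM_norm p q (\<lambda>z. f z - dilation (R n) f z)" for n
  proof -
    have "\<phi> (\<lambda>z. f z - dilation (R n) f z) = \<phi> f - \<phi> (dilation (R n) f)"
      using dual_add[OF \<phi> f RM_scale[OF p0 dRM[of n], of "-1"]] dual_scale[OF \<phi> dRM[of n], of "-1"] by simp
    then show ?thesis using dual_bound_dual_norm(1)[OF p \<phi> diff[of n]] by simp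
  qed
  then have "(\<lambda>n. \<phi> f - \<phi> (dilation (R n) f)) \<longlonglongrightarrow> 0"
    by (intro Lim_null_comparison[OF always_eventually[OF allI] lim0])
  then have "(\<lambda>n. \<phi> f - (\<phi> f - \<phi> (dilation (R n) f))) \<longlonglongrightarrow> \<phi> f - 0" by (intro tendsto_diff tendsto_const)
  then have "(\<lambda>n. cmod (\<phi> (dilation (R n) f))) \<longlonglongrightarrow> cmod (\<phi> f)" by (simp add: tendsto_norm)
  then show ?thesis
    by (rule LIMSEQ_le_const2) (use dil[OF R] in \<open>auto simp: g_def\<close>)
qed

section \<open>The inverse map, linearity and the isomorphism\<close>

lemma dualI:
  assumes "\<And>f g. f \<in> V \<Longrightarrow> g \<in> V \<Longrightarrow> \<phi> (\<lambda>x. f x + g x) = \<phi> f + \<phi> g"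
    and "\<And>c f. f \<in> V \<Longrightarrow> \<phi> (\<lambda>x. c * f x) = c * \<phi> f"
    and "\<And>f. f \<in> V \<Longrightarrow> cmod (\<phi> f) \<le> C * N f" and "\<And>f. f \<notin> V \<Longrightarrow> \<phi> f = 0"
  shows "\<phi> \<in> dual V N"
  using assms unfolding dual_def by blast

text \<open>The preimage of \<open>g\<close> under the isomorphism. The value 0 off
  \<open>RM p q\<close> selects the representative that \<open>dual\<close> requires; dividing by pi
  normalises area.\<close>

definition bergman_functional :: "real \<Rightarrow> real \<Rightarrow> (complex \<Rightarrow> complex) \<Rightarrow> (complex \<Rightarrow> complex) \<Rightarrow> complex" where
  "bergman_functional p q g f = (if f \<in> RM p q then (LINT z|plane. f (polar z) * bergman_weight g z) / of_real pi else 0)"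

lemma bergman_functional_in_dual:
  assumes p: "1 < p" "1 < q" and conj: "1 / p + 1 / p' = 1" "1 / q + 1 / q' = 1" and g: "g \<in> RM p' q'"
  shows "bergman_functional p q g \<in> RM_dual p q"
proof -
  have p0: "0 < p" "0 < q" using p by auto
  note int = bergman_pairing_integrable[OF p conj _ g]
  show ?thesis
  proof (rule dualI)
    show "bergman_functional p q g (\<lambda>x. f x + h x) = bergman_functional p q g f + bergman_functional p q g h"
      if "f \<in> RM p q" "h \<in> RM p q" for f h
      using that RM_add[OF p0 that] int(1)[OF that(1)] int(1)[OF that(2)]
      by (simp add: bergman_functional_def distrib_right add_divide_distrib)
    show "bergman_functional p q g (\<lambda>x. c * f x) = c * bergman_functional p q g f" if "f \<in> RM p q" for c f
      using that RM_scale[OF p0 that] by (simp add: bergman_functional_def mult.assoc)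
    show "cmod (bergman_functional p q g f) \<le> (2 * RM_norm p' q' g) * RM_norm p q f" if "f \<in> RM p q" for f
      using int(2)[OF that] that by (simp add: bergman_functional_def norm_divide field_simps)
  qed (simp add: bergman_functional_def)
qed

text \<open>The n-th moment is pi b(n) / (n + 1); division by pi and the factor n + 1 restore the
  Taylor coefficient. This is surjectivity.\<close>

lemma dual_series_bergman_functional:
  assumes p: "1 < p" "1 < q" and conj: "1 / p + 1 / p' = 1" "1 / q + 1 / q' = 1" and g: "g \<in> RM p' q'"
  shows "disc_series (dual_coeff (bergman_functional p q g)) = g"
proof -
  have p0: "0 < p" "0 < q" using p by auto
  obtain b where gb: "g = disc_series b" and b: "\<And>r. 0 \<le> r \<Longrightarrow> r < 1 \<Longrightarrow> summable (\<lambda>n. cmod (b n) * r ^ n)"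
    by (rule RM_power_series[OF g]) (rule that)
  have "dual_coeff (bergman_functional p q g) n = b n" for n
  proof -
    have "(LINT z|plane. disc_monomial n (polar z) * bergman_weight g z) = (LINT z|plane. polar z ^ n * bergman_weight g z)"
      by (intro Bochner_Integration.integral_cong refl) (auto simp: disc_monomial_def bergman_weight_def cmod_polar)
    also have "\<dots> = of_real pi * b n / of_nat (Suc n)"
      by (rule bergman_weight_moment[OF b gb bergman_weight_integrable[OF p conj g]])
    finally show ?thesis
      using disc_monomial_in_RM(1)[OF p0, of n] by (simp add: dual_coeff_def bergman_functional_def del: of_nat_Suc)
  qed
  then show ?thesis by (simp add: gb disc_series_def fun_eq_iff)
qed

lemma dual_linear_combination:
  assumes \<phi>: "\<phi> \<in> dual V N" "\<psi> \<in> dual V N"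
  shows "(\<lambda>f. \<phi> f + c * \<psi> f) \<in> dual V N"
proof -
  obtain C where C: "\<And>f. f \<in> V \<Longrightarrow> cmod (\<phi> f) \<le> C * N f"
    using \<phi>(1) unfolding dual_def by blast
  obtain D where D: "\<And>f. f \<in> V \<Longrightarrow> cmod (\<psi> f) \<le> D * N f"
    using \<phi>(2) unfolding dual_def by blast
  show ?thesis
  proof (rule dualI)
    show "cmod (\<phi> f + c * \<psi> f) \<le> (C + cmod c * D) * N f" if "f \<in> V" for f
    proof -
      have "cmod (\<phi> f + c * \<psi> f) \<le> cmod (\<phi> f) + cmod c * cmod (\<psi> f)"
        using norm_triangle_ineq[of "\<phi> f" "c * \<psi> f"] by (simp add: norm_mult)
      also have "\<dots> \<le> C * N f + cmod c * (D * N f)"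
        using that by (intro add_mono mult_left_mono C D) auto
      finally show ?thesis by (simp add: algebra_simps)
    qed
  qed (use \<phi> in \<open>simp_all add: dual_add dual_scale dual_outside algebra_simps\<close>)
qed

text \<open>One shape covers all uses: c = 1 gives sums, c = -1 differences, and \<psi> = \<phi>
  with c - 1 in place of c gives multiples.\<close>

lemma dual_series_combination:
  assumes p: "1 < p" "1 < q" and \<phi>: "\<phi> \<in> RM_dual p q" "\<psi> \<in> RM_dual p q"
  shows "disc_series (dual_coeff (\<lambda>f. \<phi> f + c * \<psi> f)) = (\<lambda>z. disc_series (dual_coeff \<phi>) z + c * disc_series (dual_coeff \<psi>) z)"
proof
  fix z
  show "disc_series (dual_coeff (\<lambda>f. \<phi> f + c * \<psi> f)) z = disc_series (dual_coeff \<phi>) z + c * disc_series (dual_coeff \<psi>) z"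
  proof (cases "cmod z < 1")
    case True
    note s = dual_coeff_summable'[OF p \<phi>(1) True] dual_coeff_summable'[OF p \<phi>(2) True]
    have "dual_coeff (\<lambda>f. \<phi> f + c * \<psi> f) n * z ^ n = dual_coeff \<phi> n * z ^ n + c * (dual_coeff \<psi> n * z ^ n)" for n
      by (simp add: dual_coeff_def algebra_simps)
    then show ?thesis
      using True s by (simp add: disc_series_def suminf_add[symmetric] suminf_mult[symmetric] summable_mult)
  qed (simp add: disc_series_def)
qed

theorem corollary4p8:
  fixes p q p' q' :: real
  assumes "1 < p" and "1 < q"
    and "1 / p + 1 / p' = 1" and "1 / q + 1 / q' = 1"
  shows "normed_isomorphic
    (dual (RM p q) (RM_norm p q)) (dual_norm (RM p q) (RM_norm p q))
    (RM p' q') (RM_norm p' q')"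
proof -
  let ?V = "RM p q" and ?N = "RM_norm p q" and ?W = "RM p' q'" and ?M = "RM_norm p' q'"
  let ?T = "\<lambda>\<phi>. disc_series (dual_coeff \<phi>)"
  note p = assms(1,2) and conj = assms(3,4)
  have p0: "0 < p" "0 < q" using p by auto
  have pp: "1 < p'" "1 < q'" using conjugate_exponent[OF p(1) conj(1)] conjugate_exponent[OF p(2) conj(2)] by auto
  obtain C where C: "0 \<le> C" and T_le: "\<And>\<phi>. \<phi> \<in> dual ?V ?N \<Longrightarrow> rho p' q' (?T \<phi>) \<le> ennreal (C * dual_norm ?V ?N \<phi>)"
    by (rule dual_series_rho_le[OF p conj]) (rule that)
  have T_RM: "?T \<phi> \<in> ?W" if "\<phi> \<in> dual ?V ?N" for \<phi>
    using dual_series_holomorphic[OF p that] T_le[OF that]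
    by (auto simp: RM_def disc_series_def intro: order_le_less_trans)
  have T_upper: "?M (?T \<phi>) \<le> C * dual_norm ?V ?N \<phi>" if "\<phi> \<in> dual ?V ?N" for \<phi>
    using T_le[OF that] C dual_bound_dual_norm(2)[OF p that] by (simp add: rho_eq_RM_norm[OF T_RM[OF that]] ennreal_le_iff)
  have T_lower: "1 / 4 * dual_norm ?V ?N \<phi> \<le> ?M (?T \<phi>)" if "\<phi> \<in> dual ?V ?N" for \<phi>
  proof -
    have "dual_norm ?V ?N \<phi> \<le> 4 * ?M (?T \<phi>)"
      unfolding dual_norm_def
    proof (rule cSUP_least)
      show "{f \<in> ?V. ?N f \<le> 1} \<noteq> {}" using disc_monomial_in_RM[OF p0] by blast
      fix f assume "f \<in> {f \<in> ?V. ?N f \<le> 1}"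
      then have "cmod (\<phi> f) \<le> 4 * ?M (?T \<phi>) * ?N f" "4 * ?M (?T \<phi>) * ?N f \<le> 4 * ?M (?T \<phi>) * 1"
        using dual_norm_le_bergman[OF p conj that T_RM[OF that]] by (auto intro!: mult_left_le)
      then show "cmod (\<phi> f) \<le> 4 * ?M (?T \<phi>)" by linarith
    qed
    then show ?thesis by simp
  qed
  have inj: "inj_on ?T (dual ?V ?N)"
  proof (rule inj_onI)
    fix \<phi> \<psi> assume \<phi>: "\<phi> \<in> dual ?V ?N" and \<psi>: "\<psi> \<in> dual ?V ?N" and eq: "?T \<phi> = ?T \<psi>"
    \<comment> \<open>The estimate of a functional by its representing function, applied to the
      difference, makes it vanish on \<open>?V\<close>; off \<open>?V\<close> both functionals are 0
      because they are the normalised representatives.\<close>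
    define \<delta> where "\<delta> = (\<lambda>f. \<phi> f + (-1) * \<psi> f)"
    have \<delta>: "\<delta> \<in> dual ?V ?N" unfolding \<delta>_def by (rule dual_linear_combination[OF \<phi> \<psi>])
    have "?T \<delta> = (\<lambda>z. 0)" unfolding \<delta>_def dual_series_combination[OF p \<phi> \<psi>] eq by simp
    then have "?M (?T \<delta>) = 0" using rho_le_bound[of p' q' 0 "\<lambda>_. 0"] pp by (simp add: RM_norm_def)
    show "\<phi> = \<psi>"
    proof
      fix f
      show "\<phi> f = \<psi> f"
      proof (cases "f \<in> ?V")
        case True
        then have "cmod (\<delta> f) \<le> 0"
          using dual_norm_le_bergman[OF p conj \<delta> T_RM[OF \<delta>] True] \<open>?M (?T \<delta>) = 0\<close> by simp
        then show ?thesis by (simp add: \<delta>_def)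
      qed (simp add: dual_outside[OF \<phi>] dual_outside[OF \<psi>])
    qed
  qed
  have "bij_betw ?T (dual ?V ?N) ?W"
    unfolding bij_betw_def
  proof (intro conjI inj equalityI subsetI)
    fix g assume "g \<in> ?T ` dual ?V ?N" then show "g \<in> ?W" using T_RM by auto
  next
    fix g assume g: "g \<in> ?W"
    show "g \<in> ?T ` dual ?V ?N"
      using dual_series_bergman_functional[OF p conj g] bergman_functional_in_dual[OF p conj g]
      by (intro image_eqI[where x = "bergman_functional p q g"]) auto
  qed
  moreover have "?T (\<lambda>x. \<phi> x + \<psi> x) = (\<lambda>y. ?T \<phi> y + ?T \<psi> y)" if "\<phi> \<in> dual ?V ?N" "\<psi> \<in> dual ?V ?N" for \<phi> \<psi>
    using dual_series_combination[OF p that, of 1] by simp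
  moreover have "?T (\<lambda>x. c * \<phi> x) = (\<lambda>y. c * ?T \<phi> y)" if "\<phi> \<in> dual ?V ?N" for c \<phi>
    using dual_series_combination[OF p that that, of "c - 1"] by (simp add: algebra_simps)
  \<comment> \<open>\<open>normed_isomorphic\<close> asks for a positive upper constant, whereas
    \<open>C\<close> is only known to be nonnegative; hence C + 1.\<close>
  moreover have "1 / 4 * dual_norm ?V ?N \<phi> \<le> ?M (?T \<phi>) \<and> ?M (?T \<phi>) \<le> (C + 1) * dual_norm ?V ?N \<phi>" if "\<phi> \<in> dual ?V ?N" for \<phi>
    using T_lower[OF that] T_upper[OF that] dual_bound_dual_norm(2)[OF p that] by (simp add: algebra_simps)
  ultimately show ?thesis
    unfolding normed_isomorphic_def using C
    by (intro exI[of _ ?T] conjI ballI allI exI[of _ "1 / 4 :: real"] exI[of _ "C + 1"]) auto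
qed

end
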